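(* For any smooth fence $Y$ there is a topological embedding $f:Y\to\mathbb F/R^{\mathbb F}$ with $f[\mathrm E(Y)]\subseteq\mathrm E(\mathbb F/R^{\mathbb F})$. Moreover, given any strongly compatible order $\preceq$ on $Y$, $f$ can be chosen so that $f[\mathfrak L_\preceq(Y)]\subseteq\mathfrak L$ and $f[\mathfrak U_\preceq(Y)]\subseteq\mathfrak U$.
   Context: Let $\mathcal L_R=\{R,\le\}$. A topological $\mathcal L_R$-structure is a zero-dimensional compact metrizable space with closed interpretations of $R,\le$. An epimorphism is a continuous surjection $\varphi$ with $r^B=(\varphi\times\varphi)[r^A]$ for $r\in\{R,\le\}$; an automorphism is a bijective epimorphism onto itself. A finite Hasse forest is a finite $\mathcal L_R$-structure where $\le$ is a partial order, $a\,R\,b$ iff $a=b$ or one of $a,b$ is an immediate $\le$-successor of the other, and the Hasse diagram has no cycles; $\mathcal F$ is the family of finite Hasse forests. $\mathbb F$ denotes the projective Fraïssé limit of $\mathcal F$ (unique up to isomorphism): (L1) every $A\in\mathcal F$ is an epimorphic image of $\mathbb F$; (L2) every clopen cover of $\mathbb F$ is refined by the point-preimages of some epimorphism $\mathbb F\to A$, $A\in\mathcal F$; (L3) for $A\in\mathcal F$ and epimorphisms $\varphi_1,\varphi_2:\mathbb F\to A$ there is an automorphism $\psi$ with $\varphi_2=\varphi_1\psi$. $R^{\mathbb F}$ is a closed equivalence relation; the Fraïssé fence is $\mathbb F/R^{\mathbb F}$ with quotient map $p$ and closed partial order $\le^{\mathbb F/R^{\mathbb F}}=(p\times p)[\le^{\mathbb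 F}]$; $\mathfrak L,\mathfrak U$ are its sets of $\le^{\mathbb F/R^{\mathbb F}}$-minimal and -maximal points. A fence is a compact metrizable space whose connected components are points or arcs; it is smooth if it admits a closed partial order whose restriction to each component is total. A strongly compatible order on a fence is a closed partial order, total on each component, such that two points are comparable iff they lie in the same component. For a smooth fence $Y$ with strongly compatible order $\preceq$, $\mathfrak L_\preceq(Y),\mathfrak U_\preceq(Y)$ are the sets of $\preceq$-minimal and $\preceq$-maximal points. A point $x$ of a space $X$ is an endpoint if whenever $x$ lies on an arc $[a,b]\subseteq X$ then $x=a$ or $x=b$ (so points whose component is a singleton are endpoints); $\mathrm E(X)$ is the set of endpoints. *)

theory Defs
  imports "HOL-Analysis.Analysis"
begin

section \<open>Topological structures in the language of a binary relation and an order\<close>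

record 'a lr_structure =
  space_of :: "'a topology"
  rel_of :: "'a rel"
  le_of :: "'a rel"

abbreviation points_of :: "('a, 'z) lr_structure_scheme \<Rightarrow> 'a set"
  where "points_of A \<equiv> topspace (space_of A)"

text \<open>The condition \<open>X dim_le 0\<close> says that the clopen sets form a base, see
  \<open>dimension_le_0_neighbourhood_base_of_clopen\<close>. Closedness in the product also makes the
  relations subsets of \<open>points_of A \<times> points_of A\<close>.\<close>

definition topological_lr_structure :: "'a lr_structure \<Rightarrow> bool" where
  "topological_lr_structure A \<longleftrightarrow>
     compact_space (space_of A) \<and> metrizable_space (space_of A) \<and> space_of A dim_le 0 \<and>
     closedin (prod_topology (space_of A) (space_of A)) (rel_of A) \<and>
     closedin (prod_topology (space_of A) (space_of A)) (le_of A)"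

definition epimorphism :: "'a lr_structure \<Rightarrow> 'b lr_structure \<Rightarrow> ('a \<Rightarrow> 'b) \<Rightarrow> bool" where
  "epimorphism A B \<phi> \<longleftrightarrow>
     continuous_map (space_of A) (space_of B) \<phi> \<and>
     \<phi> ` points_of A = points_of B \<and>
     rel_of B = map_prod \<phi> \<phi> ` rel_of A \<and>
     le_of B = map_prod \<phi> \<phi> ` le_of A"

definition automorphism :: "'a lr_structure \<Rightarrow> ('a \<Rightarrow> 'a) \<Rightarrow> bool" where
  "automorphism A \<psi> \<longleftrightarrow> epimorphism A A \<psi> \<and> bij_betw \<psi> (points_of A) (points_of A)"


section \<open>Finite Hasse forests\<close>

definition immediate_successor :: "'a lr_structure \<Rightarrow> 'a \<Rightarrow> 'a \<Rightarrow> bool" where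
  "immediate_successor A a b \<longleftrightarrow>
     (a, b) \<in> le_of A \<and> a \<noteq> b \<and>
     (\<forall>c. (a, c) \<in> le_of A \<and> (c, b) \<in> le_of A \<longrightarrow> c = a \<or> c = b)"

definition hasse_edge :: "'a lr_structure \<Rightarrow> 'a \<Rightarrow> 'a \<Rightarrow> bool" where
  "hasse_edge A a b \<longleftrightarrow> immediate_successor A a b \<or> immediate_successor A b a"

definition hasse_cycle :: "'a lr_structure \<Rightarrow> 'a list \<Rightarrow> bool" where
  "hasse_cycle A xs \<longleftrightarrow>
     length xs \<ge> 3 \<and> distinct xs \<and>
     (\<forall>i < length xs. hasse_edge A (xs ! i) (xs ! (Suc i mod length xs)))"

text \<open>A finite structure carries the discrete topology, the only zero-dimensional compact
  metrizable one. Structures are nonempty, as usual in model theory; a family containing the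
  empty structure and a nonempty one would have no projective Fraisse limit at all.\<close>

definition finite_hasse_forest :: "'a lr_structure \<Rightarrow> bool" where
  "finite_hasse_forest A \<longleftrightarrow>
     finite (points_of A) \<and> points_of A \<noteq> {} \<and>
     space_of A = discrete_topology (points_of A) \<and>
     partial_order_on (points_of A) (le_of A) \<and>
     rel_of A = {(a, b). a \<in> points_of A \<and> b \<in> points_of A \<and> (a = b \<or> hasse_edge A a b)} \<and>
     (\<nexists>xs. hasse_cycle A xs)"

text \<open>Every finite structure is isomorphic to one whose points are natural numbers, so
  these represent all finite Hasse forests.\<close>

definition finite_hasse_forests :: "nat lr_structure set" where
  "finite_hasse_forests = {A. finite_hasse_forest A}"


section \<open>Projective Fraisse limits\<close>

definition projective_fraisse_limit :: "nat lr_structure set \<Rightarrow> 'a lr_structure \<Rightarrow> bool" where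
  "projective_fraisse_limit \<G> F \<longleftrightarrow>
     topological_lr_structure F \<and>
     (\<forall>A\<in>\<G>. \<exists>\<phi>. epimorphism F A \<phi>) \<and>
     (\<forall>\<U>. (\<forall>U\<in>\<U>. openin (space_of F) U \<and> closedin (space_of F) U) \<and> \<Union>\<U> = points_of F \<longrightarrow>
        (\<exists>A\<in>\<G>. \<exists>\<phi>. epimorphism F A \<phi> \<and>
           (\<forall>a\<in>points_of A. \<exists>U\<in>\<U>. {x \<in> points_of F. \<phi> x = a} \<subseteq> U))) \<and>
     (\<forall>A\<in>\<G>. \<forall>\<phi>\<^sub>1 \<phi>\<^sub>2. epimorphism F A \<phi>\<^sub>1 \<and> epimorphism F A \<phi>\<^sub>2 \<longrightarrow>
        (\<exists>\<psi>. automorphism F \<psi> \<and> (\<forall>x\<in>points_of F. \<phi>\<^sub>2 x = \<phi>\<^sub>1 (\<psi> x))))"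


section \<open>The quotient of a structure by its binary relation\<close>

definition quotient_proj :: "'a lr_structure \<Rightarrow> 'a \<Rightarrow> 'a set" where
  "quotient_proj A x = rel_of A `` {x}"

text \<open>The intended use is for \<open>rel_of A\<close> an equivalence relation on \<open>points_of A\<close>; the
  points of the quotient are then its classes.\<close>

definition quotient_space :: "'a lr_structure \<Rightarrow> 'a set topology" where
  "quotient_space A = topology (\<lambda>V. V \<subseteq> points_of A // rel_of A \<and>
     openin (space_of A) {x \<in> points_of A. quotient_proj A x \<in> V})"

definition quotient_le :: "'a lr_structure \<Rightarrow> 'a set rel" where
  "quotient_le A = map_prod (quotient_proj A) (quotient_proj A) ` le_of A"

lemma openin_quotient_space:
  "openin (quotient_space A) V \<longleftrightarrow>
     V \<subseteq> points_of A // rel_of A \<and> openin (space_of A) {x \<in> points_of A. quotient_proj A x \<in> V}"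
proof -
  have "istopology (\<lambda>V. V \<subseteq> points_of A // rel_of A \<and>
     openin (space_of A) {x \<in> points_of A. quotient_proj A x \<in> V})" (is "istopology ?P")
    unfolding istopology_def
  proof (intro conjI allI impI)
    fix S T assume S: "?P S" and T: "?P T"
    then show "S \<inter> T \<subseteq> points_of A // rel_of A" by blast
    have "{x \<in> points_of A. quotient_proj A x \<in> S \<inter> T} =
      {x \<in> points_of A. quotient_proj A x \<in> S} \<inter> {x \<in> points_of A. quotient_proj A x \<in> T}"
      by blast
    then show "openin (space_of A) {x \<in> points_of A. quotient_proj A x \<in> S \<inter> T}"
      using S T by (simp add: openin_Int)
  next
    fix \<K> assume K: "\<forall>V\<in>\<K>. ?P V"
    then show "\<Union>\<K> \<subseteq> points_of A // rel_of A" by blast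
    have "{x \<in> points_of A. quotient_proj A x \<in> \<Union>\<K>} =
      \<Union> ((\<lambda>V. {x \<in> points_of A. quotient_proj A x \<in> V}) ` \<K>)"
      by blast
    then show "openin (space_of A) {x \<in> points_of A. quotient_proj A x \<in> \<Union>\<K>}"
      using K by auto
  qed
  then show ?thesis
    by (simp add: quotient_space_def topology_inverse')
qed

lemma topspace_quotient_space: "topspace (quotient_space A) = points_of A // rel_of A"
proof
  show "topspace (quotient_space A) \<subseteq> points_of A // rel_of A"
    using openin_quotient_space openin_topspace by blast
  have "{x \<in> points_of A. quotient_proj A x \<in> points_of A // rel_of A} = points_of A"
    by (auto simp: quotient_proj_def quotient_def)
  then have "openin (quotient_space A) (points_of A // rel_of A)"
    by (simp add: openin_quotient_space)
  then show "points_of A // rel_of A \<subseteq> topspace (quotient_space A)"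
    by (rule openin_subset)
qed

lemma quotient_map_quotient_proj:
  "quotient_map (space_of A) (quotient_space A) (quotient_proj A)"
  unfolding quotient_map_def topspace_quotient_space
  by (auto simp: openin_quotient_space quotient_proj_def quotient_def)


section \<open>Fences, compatible orders and endpoints\<close>

definition fence :: "'a topology \<Rightarrow> bool" where
  "fence X \<longleftrightarrow>
     compact_space X \<and> metrizable_space X \<and>
     (\<forall>C \<in> connected_components_of X.
        (\<exists>x. C = {x}) \<or> subtopology X C homeomorphic_space top_of_set {0..1::real})"

definition closed_partial_order :: "'a topology \<Rightarrow> 'a rel \<Rightarrow> bool" where
  "closed_partial_order X r \<longleftrightarrow>
     closedin (prod_topology X X) r \<and> partial_order_on (topspace X) r"

definition smooth_fence :: "'a topology \<Rightarrow> bool" where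
  "smooth_fence X \<longleftrightarrow> fence X \<and>
     (\<exists>r. closed_partial_order X r \<and> (\<forall>C \<in> connected_components_of X. total_on C r))"

definition strongly_compatible_order :: "'a topology \<Rightarrow> 'a rel \<Rightarrow> bool" where
  "strongly_compatible_order X r \<longleftrightarrow>
     closed_partial_order X r \<and>
     (\<forall>C \<in> connected_components_of X. total_on C r) \<and>
     (\<forall>x \<in> topspace X. \<forall>y \<in> topspace X.
        (x, y) \<in> r \<or> (y, x) \<in> r \<longleftrightarrow> connected_component_of X x y)"

definition minimal_points :: "'a topology \<Rightarrow> 'a rel \<Rightarrow> 'a set" where
  "minimal_points X r = {x \<in> topspace X. \<forall>y \<in> topspace X. (y, x) \<in> r \<longrightarrow> y = x}"

definition maximal_points :: "'a topology \<Rightarrow> 'a rel \<Rightarrow> 'a set" where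
  "maximal_points X r = {x \<in> topspace X. \<forall>y \<in> topspace X. (x, y) \<in> r \<longrightarrow> y = x}"

text \<open>An arc in \<open>X\<close> with endpoints \<open>a\<close>, \<open>b\<close> is the image of an embedding \<open>g\<close> of the unit
  interval with \<open>g 0 = a\<close> and \<open>g 1 = b\<close>.\<close>

definition endpoints :: "'a topology \<Rightarrow> 'a set" where
  "endpoints X = {x \<in> topspace X.
     \<forall>g. embedding_map (top_of_set {0..1::real}) X g \<and> x \<in> g ` {0..1} \<longrightarrow> x = g 0 \<or> x = g 1}"

end

theory Submission
  imports Defs
begin

text \<open>Two points of \<open>F\<close> are \<open>R\<close>-related as soon as, in every epimorphism onto a disjoint union of
  finite chains, their images lie in one chain at bounded distance: a chain can be blown up by repeating
  each of its points, and the epimorphism lifts along the blow-up. Choose a sequence of such epimorphisms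
  \<open>\<phi> n\<close>, each refining the previous one, that detects \<open>R\<close>.

  On the side of \<open>Y\<close>, Nachbin's order version of Urysohn's lemma yields a continuous \<open>h\<close> that is
  strictly monotone, hence injective on components, and countably many clopen sets separate the components.
  A point \<open>y\<close> is then located at stage \<open>n\<close> by the clopen piece \<open>c n y\<close> containing it and
  by the cell \<open>\<lfloor>E n * h y\<rfloor>\<close> of an ever finer grid. The \<open>\<phi> n\<close> are built so that every piece
  owns a chain, indexed by the cells met by its points; this is possible since adding to a chain forest a
  further chain, mapped anywhere by a walk, keeps the bonding map an epimorphism. The image of \<open>y\<close> is the
  \<open>R\<close>-class of the point of \<open>F\<close> with these coordinates. Since the chain of a piece is no longer than the
  piece requires and the pieces shrink to components, extremal points of \<open>Y\<close> are
  approached by ends of chains, so they go to extremal points of the quotient.\<close>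

section \<open>Compact ordered spaces\<close>

text \<open>The obstacle lies in refining a forest. The next forest has to decide one more relation,
  so it must map onto a forest \<open>A1\<close> whose fibre over a point of an old chain is
  arbitrary, whereas its heights over a piece of \<open>Y\<close> are dictated by \<open>h\<close>.
  The way out is to lift each old chain to one increasing walk of edges in \<open>A1\<close> and to
  cut every cell into \<open>D\<close> subcells, \<open>D\<close> exceeding the length of every such
  walk: the subcells of one cell then suffice to pass through the part of the walk above that cell.
  This is the origin of the factors \<open>D n\<close>.

  Comparisons are made up to distance 2 in a chain: one step is lost because close points of
  \<open>Y\<close> may sit in adjacent cells, another because \<open>R\<close>-related points may
  sit at adjacent heights.

  Nothing is proved about the shape of the components of the quotient. The claim on endpoints is
  reduced to the one on extremal points: in \<open>Y\<close> endpoints are extremal for a strongly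
  compatible order, and in the quotient extremal points are endpoints because points of a connected
  set are comparable.\<close>

lemma countable_subcover_of_open_complement:
  assumes "compact_space X" and "metrizable_space X" and "closedin X S"
    and op: "\<And>p. P p \<Longrightarrow> openin X (W p)"
    and cover: "\<And>x. x \<in> topspace X - S \<Longrightarrow> \<exists>p. P p \<and> x \<in> W p"
    and "P p\<^sub>0"
  obtains c :: "nat \<Rightarrow> 'p" where "\<And>n. P (c n)" "\<And>x. x \<in> topspace X - S \<Longrightarrow> \<exists>n. x \<in> W (c n)"
proof -
  \<comment> \<open>Open sets of a metrizable space are F-sigma; with compactness this makes the
    complement of \<open>S\<close> Lindelof, so countably many of the \<open>W p\<close> cover
    it.\<close>
  have "fsigma_in X (topspace X - S)"
    using assms open_imp_fsigma_in by blast
  then obtain \<K> where \<K>: "countable \<K>" "\<And>K. K \<in> \<K> \<Longrightarrow> closedin X K" "\<Union>\<K> = topspace X - S"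
    unfolding fsigma_in_def union_of_def by auto
  have "Lindelof_space (subtopology X (\<Union>\<K>))"
    using \<K>(1,2) Lindelof_space_closedin_subtopology[OF compact_imp_Lindelof_space[OF \<open>compact_space X\<close>]]
    by (intro Lindelof_space_Union) auto
  then have "Lindelof_space (subtopology X (topspace X - S))"
    using \<K> by simp
  moreover have "\<forall>U\<in>W ` Collect P. openin X U" "topspace X - S \<subseteq> \<Union> (W ` Collect P)"
    using op cover by auto
  ultimately obtain V where V: "countable V" "V \<subseteq> W ` Collect P" "topspace X - S \<subseteq> \<Union>V"
    by (metis Lindelof_space_subtopology_subset Diff_subset)
  obtain Q where Q: "countable Q" "Q \<subseteq> Collect P" "V = W ` Q"
    using V by (metis countable_subset_image)
  \<comment> \<open>\<open>Q\<close> can be empty, for instance when \<open>S\<close> is the whole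
    space; \<open>p\<^sub>0\<close> then supplies the values of the sequence.\<close>
  have "countable (insert p\<^sub>0 Q)" "insert p\<^sub>0 Q \<noteq> {}"
    using Q by auto
  then have ran: "range (from_nat_into (insert p\<^sub>0 Q)) = insert p\<^sub>0 Q"
    by (simp add: range_from_nat_into)
  show thesis
  proof
    show "P (from_nat_into (insert p\<^sub>0 Q) n)" for n
      using ran Q(2) \<open>P p\<^sub>0\<close> by (metis insertE mem_Collect_eq rangeI subsetD)
    show "\<exists>n. x \<in> W (from_nat_into (insert p\<^sub>0 Q) n)" if "x \<in> topspace X - S" for x
    proof -
      obtain p where p: "p \<in> Q" "x \<in> W p"
        using \<open>x \<in> topspace X - S\<close> V(3) Q(3) by auto
      then have "p \<in> range (from_nat_into (insert p\<^sub>0 Q))"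
        unfolding ran by simp
      then show ?thesis
        using p by auto
    qed
  qed
qed

text \<open>In a compact Hausdorff space components are intersections of clopen sets. Wilder's
  theorem yields the clopen set between the compact component of \<open>x\<close> and the open
  complement of \<open>y\<close>.\<close>

lemma separate_connected_components:
  assumes "compact_space X" "Hausdorff_space X" "x \<in> topspace X" "y \<in> topspace X"
    and "\<not> connected_component_of X x y"
  obtains U where "openin X U" "closedin X U" "x \<in> U" "y \<notin> U"
proof -
  let ?C = "connected_component_of_set X x"
  have "?C \<in> connected_components_of X"
    using assms by (simp add: connected_component_in_connected_components_of)
  moreover have "compactin X ?C"
    by (simp add: assms closedin_compact_space closedin_connected_component_of)
  moreover have "openin X (topspace X - {y})"
    by (simp add: assms closedin_Hausdorff_singleton openin_diff)
  moreover have "?C \<subseteq> topspace X - {y}"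
    using assms connected_component_of_subset_topspace by fastforce
  moreover have "locally_compact_space X"
    by (simp add: assms compact_imp_locally_compact_space)
  ultimately obtain U V where UV: "openin X U" "openin X V" "disjnt U V" "U \<union> V = topspace X"
    "?C \<subseteq> U" "U \<subseteq> topspace X - {y}"
    using assms(2) wilder_locally_compact_component_thm by metis
  have "U = topspace X - V"
    using UV(3,4) by (auto simp: disjnt_iff)
  then have "closedin X U"
    using UV(2) by blast
  moreover have "x \<in> U"
    using UV assms connected_component_of_refl[of X x] by auto
  ultimately show thesis
    using UV that by blast
qed

text \<open>Closedness is used twice: to separate components by countably many clopen sets, and to
  cut an order down to pairs within a component without losing its closedness.\<close>

lemma closedin_connected_component_rel:
  assumes "compact_space X" "Hausdorff_space X"
  shows "closedin (prod_topology X X) {(x, y). connected_component_of X x y}"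
proof -
  let ?S = "{(x, y). connected_component_of X x y}"
  have "openin (prod_topology X X) (topspace X \<times> topspace X - ?S)"
  proof (subst openin_subopen, intro ballI)
    fix p assume "p \<in> topspace X \<times> topspace X - ?S"
    then obtain x y where xy: "p = (x, y)" "x \<in> topspace X" "y \<in> topspace X" "(x, y) \<notin> ?S"
      by blast
    then obtain U where U: "openin X U" "closedin X U" "x \<in> U" "y \<notin> U"
      using separate_connected_components[OF assms] by auto
    have "openin (prod_topology X X) (U \<times> (topspace X - U))"
      using U by (auto simp: openin_prod_Times_iff)
    moreover have "U \<times> (topspace X - U) \<subseteq> topspace X \<times> topspace X - ?S"
    proof -
      have "b \<in> U" if "connected_component_of X a b" "a \<in> U" for a b
        using connected_imp_quasi_component_of[OF that(1)] that(2) U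
        unfolding quasi_component_of_def by blast
      then show ?thesis
        using openin_subset[OF U(1)] by auto
    qed
    ultimately show "\<exists>T. openin (prod_topology X X) T \<and> p \<in> T \<and>
        T \<subseteq> topspace X \<times> topspace X - ?S"
      using U xy by blast
  qed
  moreover have "?S \<subseteq> topspace X \<times> topspace X"
    using connected_component_in_topspace by fastforce
  ultimately show ?thesis
    by (simp add: closedin_def)
qed

lemma closedin_relation_Image:
  assumes "compact_space X" and "closedin (prod_topology X Y) r" and "closedin X C"
  shows "closedin Y (r `` C)"
proof -
  have "closedin (prod_topology X Y) (r \<inter> C \<times> topspace Y)"
    using assms by (intro closedin_Int) (auto simp: closedin_prod_Times_iff)
  then have "closedin Y (snd ` (r \<inter> C \<times> topspace Y))"
    using closed_map_snd[OF assms(1)] by (auto simp: closed_map_def)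
  moreover have "snd ` (r \<inter> C \<times> topspace Y) = r `` C"
    using closedin_subset[OF assms(2)] by force
  ultimately show ?thesis by simp
qed

lemma closedin_converse:
  assumes "closedin (prod_topology X Y) r"
  shows "closedin (prod_topology Y X) (r\<inverse>)"
proof -
  have "continuous_map (prod_topology Y X) (prod_topology X Y) prod.swap"
    unfolding prod.swap_def by (intro continuous_intros)
  then have "closedin (prod_topology Y X) {p \<in> topspace (prod_topology Y X). prod.swap p \<in> r}"
    using assms closedin_continuous_map_preimage by blast
  moreover have "{p \<in> topspace (prod_topology Y X). prod.swap p \<in> r} = r\<inverse>"
    using closedin_subset[OF assms] by auto
  ultimately show ?thesis by simp
qed

section \<open>Nachbin's order version of Urysohn's lemma\<close>

lemma dyadics_dense:
  fixes y z :: real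
  assumes "0 \<le> y" "y < z" "z \<le> 1"
  obtains q where "q \<in> dyadics \<inter> {0..1}" "y < q" "q < z"
proof -
  obtain n where "1 / (z - y) < 2 ^ n"
    using real_arch_pow[of 2 "1 / (z - y)"] by auto
  then have n: "1 < 2 ^ n * (z - y)"
    using assms by (simp add: field_simps)
  define m where "m = nat \<lfloor>2 ^ n * y\<rfloor> + 1"
  have "real m = \<lfloor>2 ^ n * y\<rfloor> + 1"
    using assms by (simp add: m_def)
  then have m: "2 ^ n * y < real m" "real m \<le> 2 ^ n * y + 1"
    by linarith+
  then have "y < real m / 2 ^ n" "real m / 2 ^ n < z"
    using n by (auto simp: field_simps)
  moreover have "real m / 2 ^ n \<in> dyadics"
    unfolding dyadics_def by blast
  ultimately show thesis
    using that assms by force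
qed

text \<open>The order version of normality. An ordinary interpolant \<open>U0\<close> is shrunk to
  the largest down-set inside it: this stays open because up-sets of closed sets are closed in a
  compact space, and still contains the down-set \<open>C\<close>. The conclusion speaks of the
  down-set generated by the closure, since that is a closed down-set and can take the place of
  \<open>C\<close> in the next interpolation.\<close>

lemma open_downset_interpolation:
  assumes "compact_space X" "Hausdorff_space X" and r: "closed_partial_order X r"
    and C: "closedin X C" "r\<inverse> `` C \<subseteq> C" and V: "openin X V" "r\<inverse> `` V \<subseteq> V" and "C \<subseteq> V"
  obtains U where "openin X U" "r\<inverse> `` U \<subseteq> U" "C \<subseteq> U" "r\<inverse> `` (X closure_of U) \<subseteq> V"
proof -
  have clo: "closedin (prod_topology X X) r" and po: "partial_order_on (topspace X) r"
    using r by (auto simp: closed_partial_order_def)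
  have "normal_space X"
    using assms compact_Hausdorff_or_regular_imp_normal_space by blast
  then obtain U0 where U0: "openin X U0" "C \<subseteq> U0" "X closure_of U0 \<subseteq> V"
    using C(1) V(1) \<open>C \<subseteq> V\<close> unfolding normal_space_alt by meson
  define U where "U = topspace X - r `` (topspace X - U0)"
  have UU0: "U \<subseteq> U0"
    using po unfolding U_def partial_order_on_def preorder_on_def refl_on_def by auto
  show thesis
  proof
    show "openin X U"
      unfolding U_def using closedin_relation_Image[OF assms(1) clo] U0(1) by blast
    have "trans r"
      using po by (simp add: partial_order_on_def preorder_on_def)
    then show "r\<inverse> `` U \<subseteq> U"
      using closedin_subset[OF clo] by (auto simp: U_def dest: transD)
    show "C \<subseteq> U"
      using C U0 closedin_subset[OF C(1)] by (auto simp: U_def)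
    have "X closure_of U \<subseteq> V"
      using UU0 U0(3) closure_of_mono by blast
    then show "r\<inverse> `` (X closure_of U) \<subseteq> V"
      using V(2) by blast
  qed
qed

text \<open>Urysohn's construction with a dyadic family of open down-sets. As every
  \<open>G q\<close> is a down-set, a smaller point lies in more of them, so the infimum of the
  indices is monotone.\<close>

lemma monotone_Urysohn:
  assumes "compact_space X" "Hausdorff_space X" and r: "closed_partial_order X r"
    and x: "x \<in> topspace X" and y: "y \<in> topspace X" and "(y, x) \<notin> r"
  obtains h where "continuous_map X euclideanreal h" "\<And>a. h a \<in> {0..1}"
    "\<And>a b. (a, b) \<in> r \<Longrightarrow> h a \<le> h b" "h x < h y"
proof -
  have clo: "closedin (prod_topology X X) r" and po: "partial_order_on (topspace X) r"
    using r by (auto simp: closed_partial_order_def)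
  have sub: "r \<subseteq> topspace X \<times> topspace X" and tr: "trans r" and
    re: "\<And>a. a \<in> topspace X \<Longrightarrow> (a, a) \<in> r"
    using closedin_subset[OF clo] po
    by (auto simp: partial_order_on_def preorder_on_def refl_on_def)
  have down: "closedin X (r\<inverse> `` S)" "r\<inverse> `` (r\<inverse> `` S) \<subseteq> r\<inverse> `` S" if "closedin X S" for S
    using closedin_relation_Image[OF assms(1) closedin_converse[OF clo] that] tr
    by (auto dest: transD)
  \<comment> \<open>\<open>R\<close> carries openness and down-closure of both sets along, so that
    the recursion over the dyadics delivers these properties for every \<open>G q\<close>.\<close>
  define R where "R U V \<longleftrightarrow> openin X U \<and> r\<inverse> `` U \<subseteq> U \<and> openin X V \<and> r\<inverse> `` V \<subseteq> V \<and>
    r\<inverse> `` (X closure_of U) \<subseteq> V" for U V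
  have Rcl: "X closure_of U \<subseteq> V" if "R U V" for U V
    using that re closure_of_subset_topspace[of X U] unfolding R_def by blast
  have Rsub: "U \<subseteq> V" if "R U V" for U V
    using Rcl[OF that] that closure_of_subset[of U X] openin_subset[of X U] unfolding R_def by blast
  \<comment> \<open>The largest down-set that omits \<open>y\<close>, which forces
    \<open>h y\<close> up to 1, while \<open>x\<close> in \<open>U0\<close> forces
    \<open>h x\<close> down to 0.\<close>
  define U1 where "U1 = topspace X - r `` {y}"
  have U1: "openin X U1" "r\<inverse> `` U1 \<subseteq> U1"
    using closedin_relation_Image[OF assms(1) clo, of "{y}"] tr sub y assms(2)
    by (auto simp: U1_def closedin_Hausdorff_singleton dest: transD)
  have xcl: "closedin X {x}"
    using x assms(2) by (simp add: closedin_Hausdorff_singleton)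
  have "r\<inverse> `` {x} \<subseteq> U1"
    using x \<open>(y, x) \<notin> r\<close> sub U1(2) by (auto simp: U1_def)
  then obtain U0 where U0: "openin X U0" "r\<inverse> `` U0 \<subseteq> U0" "r\<inverse> `` {x} \<subseteq> U0"
    "r\<inverse> `` (X closure_of U0) \<subseteq> U1"
    using open_downset_interpolation[OF assms(1-3) down[OF xcl] U1] by metis
  have "\<exists>G :: real \<Rightarrow> 'a set. G 0 = U0 \<and> G 1 = U1 \<and>
      (\<forall>x \<in> dyadics \<inter> {0..1}. \<forall>y \<in> dyadics \<inter> {0..1}. x < y \<longrightarrow> R (G x) (G y))"
  proof (rule recursion_on_dyadic_fractions)
    show "R U0 U1"
      using U0 U1 by (simp add: R_def)
    show "\<exists>W. R U W \<and> R W V" if "R U V" for U V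
    proof -
      have "openin X V" "r\<inverse> `` V \<subseteq> V" "r\<inverse> `` (X closure_of U) \<subseteq> V"
        using that by (auto simp: R_def)
      then obtain W where "openin X W" "r\<inverse> `` W \<subseteq> W" "r\<inverse> `` (X closure_of U) \<subseteq> W"
          "r\<inverse> `` (X closure_of W) \<subseteq> V"
        using open_downset_interpolation[OF assms(1-3) down[OF closedin_closure_of[of X U]]] by metis
      then show ?thesis
        using that unfolding R_def by blast
    qed
    show "R U W" if "R U V" "R V W" for U V W
      using Rsub[OF that(2)] that unfolding R_def by blast
  qed
  then obtain G :: "real \<Rightarrow> 'a set" where G0: "G 0 = U0" and G1: "G 1 = U1" and
    G: "\<And>p q. p \<in> dyadics \<inter> {0..1} \<Longrightarrow> q \<in> dyadics \<inter> {0..1} \<Longrightarrow> p < q \<Longrightarrow> R (G p) (G q)"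
    by blast
  have 01: "0 \<in> dyadics \<inter> {0..1::real}" "1 \<in> dyadics \<inter> {0..1::real}"
    using real_in_dyadics[of 0] real_in_dyadics[of 1] by auto
  have GG: "openin X (G q)" "r\<inverse> `` G q \<subseteq> G q" if "q \<in> dyadics \<inter> {0..1}" for q
    using G[OF 01(1) that] G0 U0 that unfolding R_def by (cases "q = 0"; force)+
  \<comment> \<open>The element 1 keeps the infimum meaningful at points that lie in no
    \<open>G q\<close>.\<close>
  define D where "D a = insert 1 {q \<in> dyadics \<inter> {0..1}. a \<in> G q}" for a
  define h where "h a = Inf (D a)" for a
  have D: "D a \<noteq> {}" "bdd_below (D a)" for a
    unfolding D_def by (blast, intro bdd_belowI[of _ 0], auto)
  have h01: "h a \<in> {0..1}" for a
    using D by (auto simp: h_def D_def intro: cInf_lower cInf_greatest)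
  have le: "h a \<le> q" if "q \<in> dyadics \<inter> {0..1}" "a \<in> G q" for a q
    unfolding h_def using that D by (intro cInf_lower) (auto simp: D_def)
  have less: "\<exists>p\<in>dyadics \<inter> {0..1}. p < q \<and> a \<in> G p" if "h a < q" "q \<le> 1" for a q
  proof -
    have "\<exists>p\<in>D a. p < q"
      using cInf_less_iff[OF D, of a q] that unfolding h_def by blast
    then show ?thesis
      using that by (auto simp: D_def)
  qed
  have ge: "q \<le> h a" if "q \<in> dyadics \<inter> {0..1}" "a \<notin> G q" for a q
    using less[of a q] Rsub[OF G] that by (meson IntD2 atLeastAtMost_iff not_le subsetD)
  have lower: "openin X {a \<in> topspace X. h a < t}" for t
  proof (cases "t \<le> 1")
    case True
    have "{a \<in> topspace X. h a < t} = \<Union> (G ` {q \<in> dyadics \<inter> {0..1}. q < t})"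
      using less[OF _ True] le GG openin_subset by fastforce
    then show ?thesis
      using GG by auto
  next
    case False
    then have "h a < t" for a
      using h01[of a] by simp
    then have "{a \<in> topspace X. h a < t} = topspace X"
      by simp
    then show ?thesis by simp
  qed
  have upper: "openin X {a \<in> topspace X. t < h a}" for t
  proof (cases "0 \<le> t")
    case True
    have "{a \<in> topspace X. t < h a} =
        (\<Union>q\<in>{q \<in> dyadics \<inter> {0..1}. t < q}. topspace X - X closure_of (G q))" (is "?L = ?R")
    proof
      show "?L \<subseteq> ?R"
      proof clarify
        fix a assume a: "a \<in> topspace X" "t < h a"
        obtain q where q: "q \<in> dyadics \<inter> {0..1}" "t < q" "q < h a"
          using dyadics_dense[OF True a(2)] h01[of a] by auto
        \<comment> \<open>A second dyadic is needed: only being outside the larger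
          \<open>G q'\<close> keeps \<open>a\<close> off the closure of \<open>G q\<close>.\<close>
        obtain q' where q': "q' \<in> dyadics \<inter> {0..1}" "q < q'" "q' < h a"
          using dyadics_dense[of q "h a"] q h01[of a] by auto
        have "a \<notin> G q'"
          using le q' by force
        then have "a \<notin> X closure_of (G q)"
          using Rcl[OF G[OF q(1) q'(1,2)]] by blast
        then show "a \<in> ?R"
          using a q by blast
      qed
      show "?R \<subseteq> ?L"
      proof clarify
        fix a q assume a: "a \<in> topspace X" "a \<notin> X closure_of (G q)"
          and q: "q \<in> dyadics" "q \<in> {0..1}" "t < q"
        have "a \<notin> G q"
          using a GG(1)[of q] q closure_of_subset[of "G q" X] openin_subset by blast
        then show "t < h a"
          using ge q by force
      qed
    qed
    moreover have "openin X ?R"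
      by (intro openin_Union) auto
    ultimately show ?thesis
      by simp
  next
    case False
    then have "t < h a" for a
      using h01[of a] by simp
    then have "{a \<in> topspace X. t < h a} = topspace X"
      by simp
    then show ?thesis by simp
  qed
  have "continuous_map X euclideanreal h"
    using lower upper by (simp add: continuous_map_upper_lower_semicontinuous_lt)
  moreover have "h a \<le> h b" if "(a, b) \<in> r" for a b
  proof -
    have "a \<in> G q" if "b \<in> G q" "q \<in> dyadics \<inter> {0..1}" for q
      using GG(2)[OF that(2)] that \<open>(a, b) \<in> r\<close> by blast
    then have "D b \<subseteq> D a"
      by (auto simp: D_def)
    then show ?thesis
      unfolding h_def using D by (intro cInf_superset_mono) auto
  qed
  moreover have "h x < h y"
  proof -
    have "x \<in> G 0"
      using U0(3) re[OF x] unfolding G0 by blast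
    then have "h x \<le> 0"
      using le[OF 01(1)] by blast
    moreover have "y \<notin> G 1"
      using re[OF y] unfolding G1 U1_def by blast
    then have "1 \<le> h y"
      using ge[OF 01(2)] by blast
    ultimately show ?thesis by linarith
  qed
  ultimately show thesis
    using that h01 by blast
qed

text \<open>Countably many monotone functions detect all pairs outside \<open>r\<close>. Their sum
  with weights \<open>(1/2) ^ Suc n\<close> is continuous by the Weierstrass test and stays in the
  unit interval. For distinct \<open>a\<close>, \<open>b\<close> with \<open>(a, b) \<in> r\<close>,
  antisymmetry puts \<open>(b, a)\<close> outside \<open>r\<close>, so at least one summand
  increases strictly.\<close>

lemma strictly_monotone_function:
  assumes "compact_space X" "metrizable_space X" and r: "closed_partial_order X r"
  obtains h where "continuous_map X euclideanreal h" "\<And>a. h a \<in> {0..1}"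
    "\<And>a b. (a, b) \<in> r \<Longrightarrow> h a \<le> h b" "\<And>a b. (a, b) \<in> r \<Longrightarrow> a \<noteq> b \<Longrightarrow> h a < h b"
proof -
  have clo: "closedin (prod_topology X X) r" and po: "partial_order_on (topspace X) r"
    using r by (auto simp: closed_partial_order_def)
  have Haus: "Hausdorff_space X"
    using assms metrizable_imp_Hausdorff_space by blast
  define P where "P k \<longleftrightarrow> continuous_map X euclideanreal k \<and> (\<forall>a. k a \<in> {0..1}) \<and>
    (\<forall>a b. (a, b) \<in> r \<longrightarrow> k a \<le> k b)" for k :: "'a \<Rightarrow> real"
  define W where "W k = {p \<in> topspace (prod_topology X X). k (snd p) < k (fst p)}" for k :: "'a \<Rightarrow> real"
  have op: "openin (prod_topology X X) (W k)" if "P k" for k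
  proof -
    have k: "continuous_map X euclideanreal k"
      using that by (simp add: P_def)
    have "continuous_map (prod_topology X X) euclideanreal (\<lambda>p. k (fst p) - k (snd p))"
      using continuous_map_compose[OF continuous_map_fst k] continuous_map_compose[OF continuous_map_snd k]
      by (intro continuous_intros) (auto simp: comp_def)
    then have "openin (prod_topology X X)
        {p \<in> topspace (prod_topology X X). k (fst p) - k (snd p) \<in> {0<..}}"
      by (rule openin_continuous_map_preimage) auto
    then show ?thesis
      by (simp add: W_def)
  qed
  have cover: "\<exists>k. P k \<and> p \<in> W k" if "p \<in> topspace (prod_topology X X) - r" for p
  proof -
    have "snd p \<in> topspace X" "fst p \<in> topspace X" "(fst p, snd p) \<notin> r"
      using that by auto
    then obtain k where "continuous_map X euclideanreal k" "\<And>a. k a \<in> {0..1}"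
      "\<And>a b. (a, b) \<in> r \<Longrightarrow> k a \<le> k b" "k (snd p) < k (fst p)"
      using monotone_Urysohn[OF assms(1) Haus r] by metis
    then show ?thesis
      using that by (auto simp: P_def W_def)
  qed
  have P0: "P (\<lambda>_. 0)"
    by (simp add: P_def)
  have cmp: "compact_space (prod_topology X X)" "metrizable_space (prod_topology X X)"
    using assms by (auto simp: compact_space_prod_topology metrizable_space_prod_topology)
  obtain k where k: "\<And>n. P (k n)"
    and sep: "\<And>p. p \<in> topspace (prod_topology X X) - r \<Longrightarrow> \<exists>n::nat. p \<in> W (k n)"
    using countable_subcover_of_open_complement[where P = P and W = W, OF cmp clo op cover P0] by blast
  have k01: "0 \<le> k n a" "k n a \<le> 1" and kmono: "(a, b) \<in> r \<Longrightarrow> k n a \<le> k n b"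
    and kcont: "continuous_map X euclideanreal (k n)" for n a b
    using k[of n] by (auto simp: P_def)
  define t where "t a n = (1/2) ^ Suc n * k n a" for a n
  have t0: "0 \<le> t a n" and t1: "t a n \<le> (1/2) ^ Suc n" for a n
    using k01[of n a] unfolding t_def by (auto intro: mult_left_le simp del: power_Suc)
  have g: "summable (\<lambda>n. (1/2::real) ^ Suc n)" "(\<Sum>n. (1/2::real) ^ Suc n) = 1"
    using power_half_series by (auto simp: sums_iff)
  have sm: "summable (t a)" for a
    by (rule summable_comparison_test'[OF g(1)]) (use t0 t1 in \<open>simp add: abs_of_nonneg del: power_Suc\<close>)
  define h where "h a = suminf (t a)" for a
  have "continuous_map X euclideanreal h"
  proof -
    have fin: "continuous_map X euclideanreal (\<lambda>a. \<Sum>n<m. t a n)" for m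
      unfolding t_def by (intro continuous_intros kcont) auto
    have ul: "uniform_limit UNIV (\<lambda>m a. \<Sum>n<m. t a n) h sequentially"
      unfolding h_def
      by (rule Weierstrass_m_test[OF _ g(1)]) (use t0 t1 in \<open>simp add: abs_of_nonneg del: power_Suc\<close>)
    have "continuous_map X (Met_TC.mtopology) h"
    proof (rule Met_TC.continuous_map_uniform_limit[where F = sequentially])
      show "\<forall>\<^sub>F m in sequentially. continuous_map X Met_TC.mtopology (\<lambda>a. \<Sum>n<m. t a n)"
        using fin by simp
      show "\<forall>\<^sub>F m in sequentially. \<forall>x\<in>topspace X. h x \<in> UNIV \<and> dist (\<Sum>n<m. t x n) (h x) < \<epsilon>"
        if "\<epsilon> > 0" for \<epsilon>
        using uniform_limitD[OF ul that] by (auto elim: eventually_mono)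
    qed simp
    then show ?thesis by simp
  qed
  moreover have "h a \<in> {0..1}" for a
    using suminf_nonneg[OF sm t0] suminf_le[OF t1 sm g(1)] g(2) unfolding h_def by (simp del: power_Suc)
  moreover have tm: "t a n \<le> t b n" if "(a, b) \<in> r" for a b n
    unfolding t_def using kmono[OF that] by (simp add: mult_left_mono)
  then have "h a \<le> h b" if "(a, b) \<in> r" for a b
    unfolding h_def using sm that by (intro suminf_le) auto
  moreover have "h a < h b" if ab: "(a, b) \<in> r" "a \<noteq> b" for a b
  proof -
    have "(b, a) \<notin> r" "(b, a) \<in> topspace (prod_topology X X)"
      using ab po closedin_subset[OF clo] by (auto simp: partial_order_on_def antisym_def)
    then obtain n where "(b, a) \<in> W (k n)"
      using sep by blast
    then have "t a n < t b n"
      by (simp add: W_def t_def)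
    then have "0 < (\<Sum>n. t b n - t a n)"
      using tm[OF ab(1)] by (intro suminf_pos2[of _ n] summable_diff sm) auto
    then show ?thesis
      unfolding h_def using suminf_diff[OF sm[of b] sm[of a]] by linarith
  qed
  ultimately show thesis
    using that[of h] by simp
qed

section \<open>Finite chain forests\<close>

text \<open>The forests built below have natural numbers as points; \<open>prod_encode (i, z)\<close> is the point at
  height \<open>z\<close> of the \<open>i\<close>-th chain.\<close>

definition near :: "nat \<Rightarrow> nat \<Rightarrow> nat \<Rightarrow> bool" where
  "near d x y \<longleftrightarrow> fst (prod_decode x) = fst (prod_decode y) \<and>
     snd (prod_decode x) \<le> snd (prod_decode y) + d \<and> snd (prod_decode y) \<le> snd (prod_decode x) + d"

text \<open>Heights run from \<open>lo i\<close> instead of 0, so that a height can be the number of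
  a grid cell.\<close>

definition chain_forest :: "nat set \<Rightarrow> (nat \<Rightarrow> nat) \<Rightarrow> (nat \<Rightarrow> nat) \<Rightarrow> nat lr_structure" where
  "chain_forest I lo hi =
     (let V = prod_encode ` (SIGMA i:I. {lo i..hi i}) in
       \<lparr>space_of = discrete_topology V,
        rel_of = {(x, y). x \<in> V \<and> y \<in> V \<and> near 1 x y},
        le_of = {(x, y). x \<in> V \<and> y \<in> V \<and> fst (prod_decode x) = fst (prod_decode y) \<and>
                   snd (prod_decode x) \<le> snd (prod_decode y)}\<rparr>)"

lemma near_encode [simp]:
  "near d (prod_encode (i, z)) (prod_encode (j, z')) \<longleftrightarrow> i = j \<and> z \<le> z' + d \<and> z' \<le> z + d"
  by (auto simp: near_def)

lemma near_refl [simp]: "near d x x"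
  by (simp add: near_def)

lemma near_sym: "near d x y \<longleftrightarrow> near d y x"
  by (auto simp: near_def)

lemma near_mono: "near d x y \<Longrightarrow> d \<le> e \<Longrightarrow> near e x y"
  by (auto simp: near_def)

lemma near_trans: "near d x y \<Longrightarrow> near e y w \<Longrightarrow> near (d + e) x w"
  by (auto simp: near_def)

lemma space_of_chain_forest: "space_of (chain_forest I lo hi) = discrete_topology (points_of (chain_forest I lo hi))"
  by (simp add: chain_forest_def Let_def)

lemma points_of_chain_forest:
  "points_of (chain_forest I lo hi) = prod_encode ` (SIGMA i:I. {lo i..hi i})"
  by (simp add: chain_forest_def Let_def)

lemma mem_points_of_chain_forest [simp]:
  "prod_encode (i, z) \<in> points_of (chain_forest I lo hi) \<longleftrightarrow> i \<in> I \<and> lo i \<le> z \<and> z \<le> hi i"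
  by (auto simp: points_of_chain_forest)

lemma mem_rel_of_chain_forest:
  "(x, y) \<in> rel_of (chain_forest I lo hi) \<longleftrightarrow>
     x \<in> points_of (chain_forest I lo hi) \<and> y \<in> points_of (chain_forest I lo hi) \<and> near 1 x y"
  by (simp add: chain_forest_def Let_def)

lemma mem_le_of_chain_forest:
  "(x, y) \<in> le_of (chain_forest I lo hi) \<longleftrightarrow>
     x \<in> points_of (chain_forest I lo hi) \<and> y \<in> points_of (chain_forest I lo hi) \<and>
     fst (prod_decode x) = fst (prod_decode y) \<and> snd (prod_decode x) \<le> snd (prod_decode y)"
  by (simp add: chain_forest_def Let_def)

lemma points_of_chain_forestE:
  assumes "x \<in> points_of (chain_forest I lo hi)"
  obtains i z where "x = prod_encode (i, z)" "i \<in> I" "lo i \<le> z" "z \<le> hi i"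
  using assms by (auto simp: points_of_chain_forest)

lemma immediate_successor_chain_forest:
  "immediate_successor (chain_forest I lo hi) x y \<longleftrightarrow>
     x \<in> points_of (chain_forest I lo hi) \<and> y \<in> points_of (chain_forest I lo hi) \<and>
     fst (prod_decode x) = fst (prod_decode y) \<and> snd (prod_decode y) = Suc (snd (prod_decode x))"
    (is "?L \<longleftrightarrow> ?R")
proof
  assume L: ?L
  then have xy: "x \<in> points_of (chain_forest I lo hi)" "y \<in> points_of (chain_forest I lo hi)"
    by (auto simp: immediate_successor_def mem_le_of_chain_forest)
  obtain i z where x: "x = prod_encode (i, z)" "i \<in> I" "lo i \<le> z" "z \<le> hi i"
    using xy(1) by (rule points_of_chain_forestE)
  obtain j z' where y: "y = prod_encode (j, z')" "j \<in> I" "lo j \<le> z'" "z' \<le> hi j"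
    using xy(2) by (rule points_of_chain_forestE)
  have ij: "j = i" "z \<le> z'" "z \<noteq> z'"
    using L x y by (auto simp: immediate_successor_def mem_le_of_chain_forest)
  then have "(x, prod_encode (i, Suc z)) \<in> le_of (chain_forest I lo hi)"
    "(prod_encode (i, Suc z), y) \<in> le_of (chain_forest I lo hi)"
    using x y by (auto simp: mem_le_of_chain_forest)
  then have "prod_encode (i, Suc z) = x \<or> prod_encode (i, Suc z) = y"
    using L by (auto simp: immediate_successor_def)
  then have "z' = Suc z"
    using x y ij by simp
  then show ?R
    using x y ij xy by simp
next
  assume R: ?R
  have "c = x \<or> c = y" if c: "(x, c) \<in> le_of (chain_forest I lo hi)" "(c, y) \<in> le_of (chain_forest I lo hi)" for c
  proof -
    have "fst (prod_decode c) = fst (prod_decode x)" "fst (prod_decode c) = fst (prod_decode y)"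
      "snd (prod_decode x) \<le> snd (prod_decode c)" "snd (prod_decode c) \<le> Suc (snd (prod_decode x))"
      using c R by (auto simp: mem_le_of_chain_forest)
    then have "prod_decode c = prod_decode x \<or> prod_decode c = prod_decode y"
      using R by (auto simp: prod_eq_iff le_Suc_eq)
    then show ?thesis
      by (metis prod_decode_inverse)
  qed
  moreover have "(x, y) \<in> le_of (chain_forest I lo hi)" "x \<noteq> y"
    using R by (auto simp: mem_le_of_chain_forest)
  ultimately show ?L
    by (auto simp: immediate_successor_def)
qed

lemma hasse_edge_chain_forest:
  "hasse_edge (chain_forest I lo hi) x y \<Longrightarrow>
     fst (prod_decode x) = fst (prod_decode y) \<and>
     (snd (prod_decode y) = Suc (snd (prod_decode x)) \<or> snd (prod_decode x) = Suc (snd (prod_decode y)))"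
  by (auto simp: hasse_edge_def immediate_successor_chain_forest)

text \<open>Both neighbours of a highest point of a cycle lie exactly one step below it in the same
  chain, so they coincide; but in a cycle of length at least 3 they are distinct entries.\<close>

lemma no_hasse_cycle_chain_forest: "\<not> hasse_cycle (chain_forest I lo hi) xs"
proof
  assume cyc: "hasse_cycle (chain_forest I lo hi) xs"
  define n where "n = length xs"
  have n: "3 \<le> n" and dist: "distinct xs"
    and edge: "\<And>i. i < n \<Longrightarrow> hasse_edge (chain_forest I lo hi) (xs ! i) (xs ! (Suc i mod n))"
    using cyc by (auto simp: hasse_cycle_def n_def)
  define ht where "ht i = snd (prod_decode (xs ! i))" for i
  have "0 \<in> {..<n}"
    using n by simp
  then have "finite (ht ` {..<n})" "ht ` {..<n} \<noteq> {}"
    by blast+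
  then obtain k where k: "k < n" "ht k = Max (ht ` {..<n})"
    using Max_in by (metis (no_types, lifting) imageE lessThan_iff)
  have top: "ht i \<le> ht k" if "i < n" for i
    using that k by simp
  define p where "p = (if k = 0 then n - 1 else k - 1)"
  define s where "s = (if Suc k = n then 0 else Suc k)"
  have ps: "p < n" "Suc p mod n = k" "s < n" "Suc k mod n = s" "p \<noteq> s"
    using n k by (auto simp: p_def s_def)
  have "fst (prod_decode (xs ! p)) = fst (prod_decode (xs ! s))" "ht p = ht s"
    using hasse_edge_chain_forest[OF edge[OF ps(1)]] hasse_edge_chain_forest[OF edge[OF k(1)]]
      top[OF ps(1)] top[OF ps(3)] ps by (auto simp: ht_def)
  then have "prod_decode (xs ! p) = prod_decode (xs ! s)"
    by (auto simp: ht_def prod_eq_iff)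
  then have "xs ! p = xs ! s"
    by (metis prod_decode_inverse)
  then show False
    using dist ps by (simp add: n_def nth_eq_iff_index_eq)
qed

lemma chain_forest_in_finite_hasse_forests:
  assumes "finite I" "I \<noteq> {}" "\<And>i. i \<in> I \<Longrightarrow> lo i \<le> hi i"
  shows "chain_forest I lo hi \<in> finite_hasse_forests"
proof -
  let ?C = "chain_forest I lo hi"
  have "finite (points_of ?C)"
    unfolding points_of_chain_forest using assms by auto
  moreover have "points_of ?C \<noteq> {}"
    unfolding points_of_chain_forest using assms by fastforce
  moreover have "partial_order_on (points_of ?C) (le_of ?C)"
  proof -
    have "x = y" if "(x, y) \<in> le_of ?C" "(y, x) \<in> le_of ?C" for x y
    proof -
      have "prod_decode x = prod_decode y"
        using that unfolding mem_le_of_chain_forest prod_eq_iff by linarith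
      then show ?thesis
        by (metis prod_decode_inverse)
    qed
    then have "antisym (le_of ?C)"
      by (blast intro: antisymI)
    moreover have "trans (le_of ?C)"
      by (rule transI) (simp add: mem_le_of_chain_forest)
    moreover have "refl_on (points_of ?C) (le_of ?C)" "le_of ?C \<subseteq> points_of ?C \<times> points_of ?C"
      by (auto simp: refl_on_def mem_le_of_chain_forest)
    ultimately show ?thesis
      by (simp add: partial_order_on_def preorder_on_def)
  qed
  moreover have "rel_of ?C = {(a, b). a \<in> points_of ?C \<and> b \<in> points_of ?C \<and> (a = b \<or> hasse_edge ?C a b)}"
  proof -
    have "near 1 a b \<longleftrightarrow> a = b \<or> hasse_edge ?C a b" if ab: "a \<in> points_of ?C" "b \<in> points_of ?C" for a b
    proof -
      have "a = b \<longleftrightarrow> prod_decode a = prod_decode b"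
        by (metis prod_decode_inverse)
      then show ?thesis
        using ab by (auto simp: near_def hasse_edge_def immediate_successor_chain_forest prod_eq_iff)
    qed
    then show ?thesis
      by (auto simp: mem_rel_of_chain_forest)
  qed
  ultimately show ?thesis
    using no_hasse_cycle_chain_forest space_of_chain_forest
    by (simp add: finite_hasse_forests_def finite_hasse_forest_def)
qed

lemma finite_hasse_forestsD:
  assumes "A \<in> finite_hasse_forests"
  shows "finite (points_of A)" "points_of A \<noteq> {}" "space_of A = discrete_topology (points_of A)"
    "le_of A \<subseteq> points_of A \<times> points_of A" "rel_of A \<subseteq> points_of A \<times> points_of A"
    "\<And>a. a \<in> points_of A \<Longrightarrow> (a, a) \<in> le_of A \<inter> rel_of A"
    "trans (le_of A)" "antisym (le_of A)" "sym (rel_of A)"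
    "rel_of A \<subseteq> le_of A \<union> (le_of A)\<inverse>"
    "\<And>a b. immediate_successor A a b \<Longrightarrow> (a, b) \<in> le_of A \<inter> rel_of A"
proof -
  have A: "finite_hasse_forest A"
    using assms by (simp add: finite_hasse_forests_def)
  then have R: "rel_of A = {(a, b). a \<in> points_of A \<and> b \<in> points_of A \<and> (a = b \<or> hasse_edge A a b)}"
    and P: "partial_order_on (points_of A) (le_of A)"
    by (simp_all add: finite_hasse_forest_def)
  show "finite (points_of A)" "points_of A \<noteq> {}" "space_of A = discrete_topology (points_of A)"
    using A by (simp_all add: finite_hasse_forest_def)
  show L: "le_of A \<subseteq> points_of A \<times> points_of A" and "trans (le_of A)" "antisym (le_of A)"
    using P by (auto simp: partial_order_on_def preorder_on_def refl_on_def)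
  show "rel_of A \<subseteq> points_of A \<times> points_of A" "sym (rel_of A)"
    unfolding R sym_def hasse_edge_def by auto
  show refl: "(a, a) \<in> le_of A \<inter> rel_of A" if "a \<in> points_of A" for a
    using P that unfolding R by (auto simp: partial_order_on_def preorder_on_def refl_on_def)
  show "rel_of A \<subseteq> le_of A \<union> (le_of A)\<inverse>"
    using refl unfolding R by (auto simp: hasse_edge_def immediate_successor_def)
  show "(a, b) \<in> le_of A \<inter> rel_of A" if "immediate_successor A a b" for a b
    using that L unfolding R hasse_edge_def by (auto simp: immediate_successor_def)
qed

section \<open>Walks in finite forests and chain forests lying over them\<close>

lemma le_imp_saturated_chain:
  assumes A: "A \<in> finite_hasse_forests" and "(a, b) \<in> le_of A"
  shows "(a, b) \<in> (le_of A \<inter> rel_of A)\<^sup>*"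
  using assms(2)
proof (induction "card {c. (a, c) \<in> le_of A \<and> (c, b) \<in> le_of A}" arbitrary: a b rule: less_induct)
  case less
  note D = finite_hasse_forestsD[OF A]
  let ?J = "\<lambda>a b. {c. (a, c) \<in> le_of A \<and> (c, b) \<in> le_of A}"
  have fin: "finite (?J a b)" for a b
    by (rule finite_subset[OF _ D(1)]) (use D(4) in auto)
  show ?case
  proof (cases "a = b \<or> immediate_successor A a b")
    case True
    then show ?thesis
      using D(11) by auto
  next
    case False
    \<comment> \<open>A point strictly between \<open>a\<close> and \<open>b\<close> splits their
      order interval into two strictly smaller ones.\<close>
    then obtain c where c: "(a, c) \<in> le_of A" "(c, b) \<in> le_of A" "c \<noteq> a" "c \<noteq> b"
      using less.prems by (auto simp: immediate_successor_def)
    have sub: "?J a c \<subseteq> ?J a b" "?J c b \<subseteq> ?J a b"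
      using c D(7) by (auto dest: transD)
    have "b \<in> ?J a b - ?J a c" "a \<in> ?J a b - ?J c b"
      using c less.prems D(4,6,8) by (auto dest: antisymD)
    then have "?J a c \<subset> ?J a b" "?J c b \<subset> ?J a b"
      using sub by blast+
    then have "card (?J a c) < card (?J a b)" "card (?J c b) < card (?J a b)"
      by (simp_all only: psubset_card_mono[OF fin])
    then show ?thesis
      using less.hyps c(1,2) by (meson rtrancl_trans)
  qed
qed

text \<open>The last clause makes each related pair, including \<open>a = b\<close>, a single step
  of its own walk. Chains mapped along these walks therefore hit the relation as well as the
  order.\<close>

lemma walk_exists:
  assumes A: "A \<in> finite_hasse_forests" and "(a, b) \<in> le_of A"
  obtains k p where "p 0 = a" "p k = b" "\<And>j. j < k \<Longrightarrow> (p j, p (Suc j)) \<in> le_of A \<inter> rel_of A"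
    "(a, b) \<in> rel_of A \<Longrightarrow> k = 1"
proof (cases "(a, b) \<in> rel_of A")
  case True
  show thesis
    by (rule that[of "\<lambda>j. if j = 0 then a else b" 1]) (use True assms(2) in auto)
next
  case False
  obtain k where "(a, b) \<in> (le_of A \<inter> rel_of A) ^^ k"
    using le_imp_saturated_chain[OF assms] rtrancl_imp_relpow by metis
  then obtain p where "p 0 = a" "p k = b" "\<forall>j<k. (p j, p (Suc j)) \<in> le_of A \<inter> rel_of A"
    unfolding relpow_fun_conv by blast
  then show thesis
    using that False by blast
qed

text \<open>Both relations of a chain forest are generated by single upward steps, so preserving
  those is enough. For surjectivity it is enough to hit increasing edges, since
  \<open>rel_of A\<close> is symmetric and contained in the union of the order and its
  converse.\<close>

lemma chain_forest_epimorphism: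
  assumes A: "A \<in> finite_hasse_forests"
    and g: "\<And>i z. i \<in> I \<Longrightarrow> lo i \<le> z \<Longrightarrow> z \<le> hi i \<Longrightarrow> g i z \<in> points_of A"
    and step: "\<And>i z. i \<in> I \<Longrightarrow> lo i \<le> z \<Longrightarrow> z < hi i \<Longrightarrow> (g i z, g i (Suc z)) \<in> le_of A \<inter> rel_of A"
    and le: "\<And>a b. (a, b) \<in> le_of A \<Longrightarrow> \<exists>i\<in>I. \<exists>z z'. lo i \<le> z \<and> z \<le> z' \<and> z' \<le> hi i \<and> a = g i z \<and> b = g i z'"
    and rel: "\<And>a b. (a, b) \<in> le_of A \<inter> rel_of A \<Longrightarrow>
      \<exists>i\<in>I. \<exists>z z'. lo i \<le> z \<and> z \<le> z' \<and> z' \<le> Suc z \<and> z' \<le> hi i \<and> a = g i z \<and> b = g i z'"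
  shows "epimorphism (chain_forest I lo hi) A (\<lambda>x. case prod_decode x of (i, z) \<Rightarrow> g i z)" (is "epimorphism ?C A ?s")
proof -
  note D = finite_hasse_forestsD[OF A]
  have s: "?s (prod_encode (i, z)) = g i z" for i z
    by simp
  have mono: "(g i z, g i z') \<in> le_of A" if "i \<in> I" "lo i \<le> z" "z \<le> z'" "z' \<le> hi i" for i z z'
    using that(3,4)
  proof (induction z' rule: dec_induct)
    case base
    then show ?case
      using g D(6) that by auto
  next
    case (step n)
    have "(g i n, g i (Suc n)) \<in> le_of A"
      using assms(3)[of i n] step that by auto
    then show ?case
      using step D(7) by (auto dest: transD)
  qed
  have adj: "(g i z, g i z') \<in> rel_of A" if "i \<in> I" "lo i \<le> z" "z \<le> z'" "z' \<le> Suc z" "z' \<le> hi i" for i z z'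
  proof (cases "z' = z")
    case True
    then show ?thesis
      using g D(6) that by auto
  next
    case False
    then show ?thesis
      using that step[of i z] by (auto simp: le_Suc_eq)
  qed
  have pts: "?s ` points_of ?C = points_of A"
  proof
    show "?s ` points_of ?C \<subseteq> points_of A"
      using g by (auto elim!: points_of_chain_forestE)
    show "points_of A \<subseteq> ?s ` points_of ?C"
    proof
      fix a assume "a \<in> points_of A"
      then obtain i z where "i \<in> I" "lo i \<le> z" "z \<le> hi i" "a = g i z"
        using le[of a a] D(6) by fastforce
      then have "prod_encode (i, z) \<in> points_of ?C" "a = ?s (prod_encode (i, z))"
        by auto
      then show "a \<in> ?s ` points_of ?C"
        by blast
    qed
  qed
  have "rel_of A = map_prod ?s ?s ` rel_of ?C"
  proof
    show "map_prod ?s ?s ` rel_of ?C \<subseteq> rel_of A"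
    proof clarify
      fix x y assume xy: "(x, y) \<in> rel_of ?C"
      then have "x \<in> points_of ?C" "y \<in> points_of ?C"
        by (auto simp: mem_rel_of_chain_forest)
      then obtain i z j z' where x: "x = prod_encode (i, z)" "i \<in> I" "lo i \<le> z" "z \<le> hi i"
        and y: "y = prod_encode (j, z')" "j \<in> I" "lo j \<le> z'" "z' \<le> hi j"
        by (auto elim!: points_of_chain_forestE)
      then have "j = i" "z \<le> Suc z'" "z' \<le> Suc z"
        using xy by (auto simp: mem_rel_of_chain_forest)
      then have "(g i z, g j z') \<in> rel_of A"
        using adj[of i z z'] adj[of i z' z] x y symD[OF D(9)] by (meson nat_le_linear)
      then show "(?s x, ?s y) \<in> rel_of A"
        using x y by simp
    qed
    show "rel_of A \<subseteq> map_prod ?s ?s ` rel_of ?C"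
    proof clarify
      have up: "(a, b) \<in> map_prod ?s ?s ` rel_of ?C \<and> (b, a) \<in> map_prod ?s ?s ` rel_of ?C"
        if ab: "(a, b) \<in> le_of A \<inter> rel_of A" for a b
      proof -
        obtain i z z' where *: "i \<in> I" "lo i \<le> z" "z \<le> z'" "z' \<le> Suc z" "z' \<le> hi i" "a = g i z" "b = g i z'"
          using rel[OF ab] by blast
        then have "(prod_encode (i, z), prod_encode (i, z')) \<in> rel_of ?C"
          "(prod_encode (i, z'), prod_encode (i, z)) \<in> rel_of ?C"
          by (auto simp: mem_rel_of_chain_forest)
        then show ?thesis
          unfolding image_iff using s * by (metis map_prod_simp)
      qed
      fix a b assume "(a, b) \<in> rel_of A"
      then show "(a, b) \<in> map_prod ?s ?s ` rel_of ?C"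
        using up[of a b] up[of b a] D(10) symD[OF D(9)] by blast
    qed
  qed
  moreover have "le_of A = map_prod ?s ?s ` le_of ?C"
  proof
    show "map_prod ?s ?s ` le_of ?C \<subseteq> le_of A"
    proof clarify
      fix x y assume xy: "(x, y) \<in> le_of ?C"
      then have "x \<in> points_of ?C" "y \<in> points_of ?C"
        by (auto simp: mem_le_of_chain_forest)
      then obtain i z j z' where x: "x = prod_encode (i, z)" "i \<in> I" "lo i \<le> z" "z \<le> hi i"
        and y: "y = prod_encode (j, z')" "j \<in> I" "lo j \<le> z'" "z' \<le> hi j"
        by (auto elim!: points_of_chain_forestE)
      then have "j = i" "z \<le> z'"
        using xy by (auto simp: mem_le_of_chain_forest)
      then show "(?s x, ?s y) \<in> le_of A"
        using mono[of i z z'] x y by simp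
    qed
    show "le_of A \<subseteq> map_prod ?s ?s ` le_of ?C"
    proof clarify
      fix a b assume "(a, b) \<in> le_of A"
      then obtain i z z' where *: "i \<in> I" "lo i \<le> z" "z \<le> z'" "z' \<le> hi i" "a = g i z" "b = g i z'"
        using le by blast
      then have "(prod_encode (i, z), prod_encode (i, z')) \<in> le_of ?C"
        by (auto simp: mem_le_of_chain_forest)
      then show "(a, b) \<in> map_prod ?s ?s ` le_of ?C"
        unfolding image_iff using s * by (metis map_prod_simp)
    qed
  qed
  moreover have "continuous_map (space_of ?C) (space_of A) ?s"
    by (subst space_of_chain_forest) (use pts D(3) in \<open>auto simp: continuous_map_def\<close>)
  ultimately show ?thesis
    using pts by (simp add: epimorphism_def)
qed

text \<open>The chains of \<open>J\<close> are prescribed; the odd indices are left for the chains that turn the map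
  into an epimorphism. Those repeat every point \<open>M\<close> times.\<close>

lemma chain_forest_cover:
  assumes A: "A \<in> finite_hasse_forests" and "0 < M" and J: "finite J" "\<forall>i\<in>J. even i"
    and lohi: "\<forall>i\<in>J. lo i \<le> hi i"
    and g: "\<forall>i\<in>J. \<forall>z. lo i \<le> z \<and> z \<le> hi i \<longrightarrow> g i z \<in> points_of A"
    and step: "\<forall>i\<in>J. \<forall>z. lo i \<le> z \<and> z < hi i \<longrightarrow> (g i z, g i (Suc z)) \<in> le_of A \<inter> rel_of A"
  obtains I lo' hi' g' where "J \<subseteq> I" "\<forall>i\<in>J. lo' i = lo i \<and> hi' i = hi i \<and> g' i = g i"
    "chain_forest I lo' hi' \<in> finite_hasse_forests"
    "epimorphism (chain_forest I lo' hi') A (\<lambda>x. case prod_decode x of (i, z) \<Rightarrow> g' i z)"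
    "\<forall>i\<in>I - J. \<forall>z z'. z \<le> z' \<and> z' \<le> hi' i \<and> z' \<le> z + M \<longrightarrow> (g' i z, g' i z') \<in> rel_of A"
proof -
  note D = finite_hasse_forestsD[OF A]
  have "\<forall>q\<in>le_of A. \<exists>k p. p 0 = fst q \<and> p k = snd q \<and> (\<forall>j<k. (p j, p (Suc j)) \<in> le_of A \<inter> rel_of A) \<and>
      (q \<in> rel_of A \<longrightarrow> k = 1)"
    using walk_exists[OF A] by (metis prod.collapse)
  then obtain k p where walk: "\<And>q. q \<in> le_of A \<Longrightarrow> p q 0 = fst q \<and> p q (k q) = snd q \<and>
      (\<forall>j<k q. (p q j, p q (Suc j)) \<in> le_of A \<inter> rel_of A) \<and> (q \<in> rel_of A \<longrightarrow> k q = (1::nat))"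
    by metis
  \<comment> \<open>Every comparable pair receives a chain of its own, mapped along a walk from its
    lower to its upper point.\<close>
  define code where "code q = Suc (2 * prod_encode q)" for q :: "nat \<times> nat"
  define I where "I = J \<union> code ` le_of A"
  define dec where "dec i = prod_decode (i div 2)" for i
  have dec [simp]: "dec (code q) = q" for q
    by (simp add: dec_def code_def)
  define lo' where "lo' i = (if i \<in> J then lo i else 0)" for i
  \<comment> \<open>The heights form \<open>k + 1\<close> blocks of length \<open>M\<close>, one
    block for each point of the walk.\<close>
  define hi' where "hi' i = (if i \<in> J then hi i else M * k (dec i) + (M - 1))" for i
  define g' where "g' i = (if i \<in> J then g i else (\<lambda>z. p (dec i) (z div M)))" for i
  have codeJ: "code q \<notin> J" for q
    using J(2) by (auto simp: code_def)
  have I_cases: "i \<in> J \<or> (\<exists>q\<in>le_of A. i = code q)" if "i \<in> I" for i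
    using that by (auto simp: I_def)
  have new: "lo' (code q) = 0" "hi' (code q) = M * k q + (M - 1)" "g' (code q) z = p q (z div M)" for q z
    using codeJ by (auto simp: lo'_def hi'_def g'_def)
  have divM: "z div M \<le> k q" if "z \<le> hi' (code q)" for z q
  proof -
    have "z < M * Suc (k q)"
      using that \<open>0 < M\<close> by (simp add: new)
    then show ?thesis
      using \<open>0 < M\<close> by (metis less_Suc_eq_le less_mult_imp_div_less mult.commute)
  qed
  have pstep: "(p q m, p q (Suc m)) \<in> le_of A \<inter> rel_of A" if "q \<in> le_of A" "m < k q" for q m
    using walk that by blast
  have ppt: "p q m \<in> points_of A" if "q \<in> le_of A" "m \<le> k q" for q m
  proof (cases "m = k q")
    case True
    then show ?thesis
      using walk[OF that(1)] that D(4) by auto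
  next
    case False
    then have "(p q m, p q (Suc m)) \<in> le_of A"
      using pstep[of q m] that by auto
    then show ?thesis
      using D(4) by auto
  qed
  \<comment> \<open>A jump by at most \<open>M\<close> crosses at most one block boundary, hence
    costs at most one step of the walk.\<close>
  have near: "(p q (z div M), p q (z' div M)) \<in> le_of A \<inter> rel_of A"
    if q: "q \<in> le_of A" and z: "z' \<le> hi' (code q)" "z \<le> z'" "z' \<le> z + M" for q z z'
  proof -
    have "z div M \<le> z' div M" "z' div M \<le> (z + M) div M"
      using z by (auto intro: div_le_mono)
    then have "z' div M = z div M \<or> z' div M = Suc (z div M)"
      using \<open>0 < M\<close> by auto
    then show ?thesis
      using pstep[OF q, of "z div M"] ppt[OF q divM[OF z(1)]] D(6) divM[OF z(1)] by auto
  qed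
  have lohi': "lo' i \<le> hi' i" if "i \<in> I" for i
    using I_cases[OF that] lohi by (auto simp: new lo'_def hi'_def)
  have C: "chain_forest I lo' hi' \<in> finite_hasse_forests"
  proof (rule chain_forest_in_finite_hasse_forests)
    show "finite I"
      unfolding I_def using J(1) finite_subset[OF D(4)] D(1) by simp
    show "I \<noteq> {}"
      using D(2,6) unfolding I_def by blast
  qed (rule lohi')
  have "epimorphism (chain_forest I lo' hi') A (\<lambda>x. case prod_decode x of (i, z) \<Rightarrow> g' i z)"
  proof (rule chain_forest_epimorphism[OF A])
    show "g' i z \<in> points_of A" if "i \<in> I" "lo' i \<le> z" "z \<le> hi' i" for i z
      using I_cases[OF that(1)]
    proof
      assume "i \<in> J"
      then show ?thesis
        using g that by (simp add: lo'_def hi'_def g'_def)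
    next
      assume "\<exists>q\<in>le_of A. i = code q"
      then show ?thesis
        using ppt divM that by (auto simp: new)
    qed
    show "(g' i z, g' i (Suc z)) \<in> le_of A \<inter> rel_of A" if "i \<in> I" "lo' i \<le> z" "z < hi' i" for i z
      using I_cases[OF that(1)]
    proof
      assume "i \<in> J"
      then show ?thesis
        using step that by (simp add: lo'_def hi'_def g'_def)
    next
      assume "\<exists>q\<in>le_of A. i = code q"
      then obtain q where q: "q \<in> le_of A" "i = code q"
        by blast
      then show ?thesis
        using near[OF q(1), of "Suc z" z] that \<open>0 < M\<close> by (simp add: new)
    qed
    show "\<exists>i\<in>I. \<exists>z z'. lo' i \<le> z \<and> z \<le> z' \<and> z' \<le> hi' i \<and> a = g' i z \<and> b = g' i z'"
      if ab: "(a, b) \<in> le_of A" for a b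
    proof (intro bexI exI conjI)
      show "code (a, b) \<in> I"
        using ab by (simp add: I_def)
      show "a = g' (code (a, b)) 0" "b = g' (code (a, b)) (M * k (a, b))"
        using walk[OF ab] \<open>0 < M\<close> by (auto simp: new)
    qed (simp_all add: new)
    show "\<exists>i\<in>I. \<exists>z z'. lo' i \<le> z \<and> z \<le> z' \<and> z' \<le> Suc z \<and> z' \<le> hi' i \<and> a = g' i z \<and> b = g' i z'"
      if ab: "(a, b) \<in> le_of A \<inter> rel_of A" for a b
    proof (intro bexI exI conjI)
      show "code (a, b) \<in> I"
        using ab by (simp add: I_def)
      have "k (a, b) = 1" "p (a, b) 0 = a" "p (a, b) 1 = b"
        using walk[of "(a, b)"] ab by auto
      \<comment> \<open>The last height over \<open>a\<close> and the first height over
        \<open>b\<close> are neighbours in the chain.\<close>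
      then show "a = g' (code (a, b)) (M - 1)" "b = g' (code (a, b)) M" "M \<le> hi' (code (a, b))"
        using \<open>0 < M\<close> by (auto simp: new)
    qed (use \<open>0 < M\<close> in \<open>simp_all add: new\<close>)
  qed
  moreover have "(g' i z, g' i z') \<in> rel_of A"
    if i: "i \<in> I - J" and z: "z \<le> z'" "z' \<le> hi' i" "z' \<le> z + M" for i z z'
  proof -
    obtain q where q: "q \<in> le_of A" "i = code q"
      using i I_cases by blast
    then show ?thesis
      using near[OF q(1), of z' z] z by (simp add: new)
  qed
  ultimately show thesis
    using that[of I lo' hi' g'] C by (auto simp: I_def lo'_def hi'_def g'_def)
qed

text \<open>The heights \<open>q\<close> of a walk climb from \<open>l\<close> to \<open>h\<close>
  and may dwell anywhere; \<open>\<tau>\<close> reparametrises the walk so that at time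
  \<open>z\<close> it is at height \<open>z div m\<close>. The greedy rule advances whenever the
  next height is not ahead of the current block. As a block is longer than the whole walk, the walk
  is ready to climb when the block ends.\<close>

lemma stretch_steps:
  fixes q :: "nat \<Rightarrow> nat"
  assumes "q 0 = l" "q k = h" and step: "\<And>j. j < k \<Longrightarrow> q (Suc j) = q j \<or> q (Suc j) = Suc (q j)" and "k < m"
  obtains \<tau> where "\<And>z. l * m \<le> z \<Longrightarrow> z < Suc h * m \<Longrightarrow> \<tau> z \<le> k \<and> q (\<tau> z) = z div m"
    "\<And>z. l * m \<le> z \<Longrightarrow> Suc z < Suc h * m \<Longrightarrow> \<tau> (Suc z) = \<tau> z \<or> \<tau> (Suc z) = Suc (\<tau> z)"
proof -
  define \<sigma> where "\<sigma> = rec_nat 0 (\<lambda>n s. if s < k \<and> q (Suc s) \<le> (l * m + Suc n) div m then Suc s else s)"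
  have \<sigma>0: "\<sigma> 0 = 0"
    and \<sigma>S: "\<sigma> (Suc n) = (if \<sigma> n < k \<and> q (Suc (\<sigma> n)) \<le> (l * m + Suc n) div m then Suc (\<sigma> n) else \<sigma> n)" for n
    by (auto simp: \<sigma>_def)
  \<comment> \<open>Within a block of length \<open>m > k\<close> there is room to run through the whole fibre, which the last
    disjunct keeps track of.\<close>
  have inv: "\<sigma> n \<le> k \<and> q (\<sigma> n) = (l * m + n) div m \<and>
      (\<sigma> n = k \<or> q (Suc (\<sigma> n)) = Suc (q (\<sigma> n)) \<or> (l * m + n) mod m \<le> \<sigma> n)"
    if "l * m + n < Suc h * m" for n
    using that
  proof (induction n)
    case 0
    then show ?case
      using assms by (simp add: \<sigma>0)
  next
    case (Suc n)
    define z where "z = l * m + n"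
    have IH: "\<sigma> n \<le> k" "q (\<sigma> n) = z div m"
      "\<sigma> n = k \<or> q (Suc (\<sigma> n)) = Suc (q (\<sigma> n)) \<or> z mod m \<le> \<sigma> n"
      using Suc by (auto simp: z_def)
    have zS: "l * m + Suc n = Suc z"
      by (simp add: z_def)
    have "Suc z < Suc h * m"
      using Suc.prems by (simp add: z_def)
    then have "Suc z div m \<le> h"
      using \<open>k < m\<close> less_mult_imp_div_less by (metis less_Suc_eq_le)
    have zm: "z mod m < m"
      using \<open>k < m\<close> by simp
    show ?case
    proof (cases "Suc (z mod m) = m")
      case True
      then have S: "Suc z div m = Suc (z div m)" "Suc z mod m = 0"
        by (auto simp: div_Suc mod_Suc)
      have "\<sigma> n < k"
        using IH \<open>q k = h\<close> \<open>Suc z div m \<le> h\<close> S by (metis Suc_n_not_le_n le_neq_implies_less)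
      \<comment> \<open>Here \<open>z mod m = m - 1\<close>, which is at least \<open>k\<close> and
        so exceeds \<open>\<sigma> n\<close>. This rules out the last disjunct: the walk stands at
        the end of its fibre.\<close>
      moreover have "q (Suc (\<sigma> n)) = Suc (q (\<sigma> n))"
        using IH(3) True \<open>\<sigma> n < k\<close> \<open>k < m\<close> by auto
      ultimately show ?thesis
        unfolding \<sigma>S zS S using IH S by simp
    next
      case False
      then have S: "Suc z div m = z div m" "Suc z mod m = Suc (z mod m)"
        by (auto simp: div_Suc mod_Suc)
      show ?thesis
        unfolding \<sigma>S zS S using IH step[of "\<sigma> n"] by auto
    qed
  qed
  show thesis
  proof (rule that[of "\<lambda>z. \<sigma> (z - l * m)"])
    show "\<sigma> (z - l * m) \<le> k \<and> q (\<sigma> (z - l * m)) = z div m" if "l * m \<le> z" "z < Suc h * m" for z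
      using inv[of "z - l * m"] that by simp
    show "\<sigma> (Suc z - l * m) = \<sigma> (z - l * m) \<or> \<sigma> (Suc z - l * m) = Suc (\<sigma> (z - l * m))"
      if "l * m \<le> z" "Suc z < Suc h * m" for z
      using that \<sigma>S by (simp add: Suc_diff_le)
  qed
qed

section \<open>Epimorphisms from the limit\<close>

lemma epimorphism_imageD:
  assumes "epimorphism A B f"
  shows "x \<in> points_of A \<Longrightarrow> f x \<in> points_of B"
    and "(x, y) \<in> rel_of A \<Longrightarrow> (f x, f y) \<in> rel_of B"
    and "(x, y) \<in> le_of A \<Longrightarrow> (f x, f y) \<in> le_of B"
  using assms by (auto simp: epimorphism_def rev_image_eqI)

lemma epimorphism_compose:
  assumes "epimorphism A B f" and "epimorphism B C g"
  shows "epimorphism A C (\<lambda>x. g (f x))"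
proof -
  have "map_prod (\<lambda>x. g (f x)) (\<lambda>x. g (f x)) ` S = map_prod g g ` map_prod f f ` S" for S
    unfolding image_image by (rule image_cong) auto
  moreover have "continuous_map (space_of A) (space_of C) (\<lambda>x. g (f x))"
    using assms continuous_map_compose[of "space_of A" "space_of B" f "space_of C" g]
    by (simp add: epimorphism_def comp_def)
  moreover have "(\<lambda>x. g (f x)) ` points_of A = g ` f ` points_of A"
    by (simp add: image_comp comp_def)
  ultimately show ?thesis
    using assms by (simp add: epimorphism_def)
qed

definition cell :: "nat \<Rightarrow> real \<Rightarrow> nat" where
  "cell E t = nat \<lfloor>real E * t\<rfloor>"

text \<open>Refining the grid by an integer factor lets \<open>div\<close> recover the old cell
  number. This matches the bonding maps between chains, which divide heights by
  \<open>D\<close>.\<close>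

lemma cell_mult_div: "0 \<le> t \<Longrightarrow> 0 < D \<Longrightarrow> cell (E * D) t div D = cell E t"
proof -
  assume "0 \<le> t" "0 < D"
  have "\<lfloor>(real (E * D) * t) / real_of_int (int D)\<rfloor> = \<lfloor>real (E * D) * t\<rfloor> div int D"
    by (rule floor_divide_real_eq_div) simp
  moreover have "(real (E * D) * t) / real_of_int (int D) = real E * t"
    using \<open>0 < D\<close> by simp
  moreover have "0 \<le> \<lfloor>real (E * D) * t\<rfloor>"
    using \<open>0 \<le> t\<close> by simp
  ultimately show ?thesis
    unfolding cell_def by (metis nat_div_distrib nat_int)
qed

lemma cell_le: "t \<le> 1 \<Longrightarrow> cell E t \<le> E"
proof -
  assume "t \<le> 1"
  then have "real E * t \<le> real E"
    by (simp add: mult_left_le)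
  then have "\<lfloor>real E * t\<rfloor> \<le> int E"
    by linarith
  then show ?thesis
    by (simp add: cell_def)
qed

lemma cell_bounds: "0 \<le> t \<Longrightarrow> real (cell E t) \<le> real E * t \<and> real E * t < real (cell E t) + 1"
  by (simp add: cell_def)

locale hasse_limit =
  fixes F :: "'a lr_structure"
  assumes limit: "projective_fraisse_limit finite_hasse_forests F"
begin

lemma topological: "topological_lr_structure F"
  using limit by (simp add: projective_fraisse_limit_def)

lemma compact: "compact_space (space_of F)" and metrizable: "metrizable_space (space_of F)"
  and closed_rel: "closedin (prod_topology (space_of F) (space_of F)) (rel_of F)"
  and closed_le: "closedin (prod_topology (space_of F) (space_of F)) (le_of F)"
  using topological by (simp_all add: topological_lr_structure_def)

lemma Hausdorff: "Hausdorff_space (space_of F)"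
  using metrizable metrizable_imp_Hausdorff_space by blast

lemma rel_subset: "rel_of F \<subseteq> points_of F \<times> points_of F" and le_subset: "le_of F \<subseteq> points_of F \<times> points_of F"
  using closedin_subset[OF closed_rel] closedin_subset[OF closed_le] by auto

lemma epimorphism_exists: "A \<in> finite_hasse_forests \<Longrightarrow> \<exists>\<phi>. epimorphism F A \<phi>"
  using limit by (simp add: projective_fraisse_limit_def)

lemma refine_cover:
  assumes "\<And>U. U \<in> \<U> \<Longrightarrow> openin (space_of F) U \<and> closedin (space_of F) U" "\<Union>\<U> = points_of F"
  obtains A \<phi> where "A \<in> finite_hasse_forests" "epimorphism F A \<phi>"
    "\<And>x. x \<in> points_of F \<Longrightarrow> \<exists>U\<in>\<U>. \<forall>y\<in>points_of F. \<phi> y = \<phi> x \<longrightarrow> y \<in> U"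
proof -
  obtain A \<phi> where A: "A \<in> finite_hasse_forests" "epimorphism F A \<phi>"
    and *: "\<forall>a\<in>points_of A. \<exists>U\<in>\<U>. {x \<in> points_of F. \<phi> x = a} \<subseteq> U"
    using limit assms unfolding projective_fraisse_limit_def by meson
  show thesis
  proof (rule that[OF A])
    fix x assume "x \<in> points_of F"
    then have "\<phi> x \<in> points_of A"
      using epimorphism_imageD(1)[OF A(2)] by blast
    then obtain U where "U \<in> \<U>" "{y \<in> points_of F. \<phi> y = \<phi> x} \<subseteq> U"
      using * by blast
    then show "\<exists>U\<in>\<U>. \<forall>y\<in>points_of F. \<phi> y = \<phi> x \<longrightarrow> y \<in> U"
      by blast
  qed
qed

text \<open>Projectivity of the limit: by (L1) some epimorphism onto \<open>B\<close> exists, and by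
  (L3) its composition with \<open>\<pi>\<close> differs from \<open>\<phi>\<close> only by an
  automorphism.\<close>

lemma lift:
  assumes "A \<in> finite_hasse_forests" "B \<in> finite_hasse_forests" "epimorphism F A \<phi>" "epimorphism B A \<pi>"
  obtains \<psi> where "epimorphism F B \<psi>" "\<And>x. x \<in> points_of F \<Longrightarrow> \<phi> x = \<pi> (\<psi> x)"
proof -
  obtain \<psi>\<^sub>0 where \<psi>\<^sub>0: "epimorphism F B \<psi>\<^sub>0"
    using epimorphism_exists assms(2) by blast
  obtain \<sigma> where \<sigma>: "automorphism F \<sigma>" "\<And>x. x \<in> points_of F \<Longrightarrow> \<phi> x = \<pi> (\<psi>\<^sub>0 (\<sigma> x))"
    using limit assms(1,3) epimorphism_compose[OF \<psi>\<^sub>0 assms(4)]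
    unfolding projective_fraisse_limit_def by meson
  show thesis
    using that[of "\<lambda>x. \<psi>\<^sub>0 (\<sigma> x)"] \<sigma> epimorphism_compose[of F F \<sigma>, OF _ \<psi>\<^sub>0]
    by (simp add: automorphism_def)
qed

lemma clopen_preimage:
  assumes "A \<in> finite_hasse_forests" "epimorphism F A \<phi>"
  shows "openin (space_of F) {x \<in> points_of F. \<phi> x \<in> S}" "closedin (space_of F) {x \<in> points_of F. \<phi> x \<in> S}"
proof -
  have c: "continuous_map (space_of F) (discrete_topology (points_of A)) \<phi>"
    using assms finite_hasse_forestsD(3)[OF assms(1)] unfolding epimorphism_def by metis
  have "{x \<in> points_of F. \<phi> x \<in> S} = {x \<in> points_of F. \<phi> x \<in> S \<inter> points_of A}"
    using epimorphism_imageD(1)[OF assms(2)] by blast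
  then show "openin (space_of F) {x \<in> points_of F. \<phi> x \<in> S}" "closedin (space_of F) {x \<in> points_of F. \<phi> x \<in> S}"
    using openin_continuous_map_preimage[OF c, of "S \<inter> points_of A"]
      closedin_continuous_map_preimage[OF c, of "S \<inter> points_of A"] by auto
qed

lemma factor:
  assumes \<phi>: "epimorphism F A \<phi>" and \<psi>: "epimorphism F B \<psi>" and "A \<in> finite_hasse_forests"
    and fib: "\<And>x y. x \<in> points_of F \<Longrightarrow> y \<in> points_of F \<Longrightarrow> \<phi> x = \<phi> y \<Longrightarrow> \<psi> x = \<psi> y"
  obtains \<pi> where "epimorphism A B \<pi>" "\<And>x. x \<in> points_of F \<Longrightarrow> \<psi> x = \<pi> (\<phi> x)"
proof -
  define \<pi> where "\<pi> a = \<psi> (SOME x. x \<in> points_of F \<and> \<phi> x = a)" for a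
  have \<pi>: "\<psi> x = \<pi> (\<phi> x)" if "x \<in> points_of F" for x
  proof -
    have "(SOME y. y \<in> points_of F \<and> \<phi> y = \<phi> x) \<in> points_of F \<and> \<phi> (SOME y. y \<in> points_of F \<and> \<phi> y = \<phi> x) = \<phi> x"
      by (rule someI) (use that in simp)
    then show ?thesis
      unfolding \<pi>_def using fib that by metis
  qed
  have comp: "map_prod \<pi> \<pi> ` map_prod \<phi> \<phi> ` S = map_prod \<psi> \<psi> ` S" if "S \<subseteq> points_of F \<times> points_of F" for S
    unfolding image_image by (rule image_cong) (use that \<pi> in auto)
  have "\<pi> ` points_of A = points_of B"
  proof -
    have "\<pi> ` points_of A = \<pi> ` \<phi> ` points_of F"
      using \<phi> by (simp add: epimorphism_def)
    also have "\<dots> = \<psi> ` points_of F"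
      unfolding image_image by (rule image_cong) (use \<pi> in auto)
    finally show ?thesis
      using \<psi> by (simp add: epimorphism_def)
  qed
  moreover have "continuous_map (space_of A) (space_of B) \<pi>"
    using calculation finite_hasse_forestsD(3)[OF assms(3)] by (metis continuous_map_from_discrete_topology image_subset_iff_funcset order_refl)
  moreover have "rel_of B = map_prod \<pi> \<pi> ` rel_of A" "le_of B = map_prod \<pi> \<pi> ` le_of A"
    using \<phi> \<psi> comp[OF rel_subset] comp[OF le_subset] by (simp_all add: epimorphism_def)
  ultimately show thesis
    using that[of \<pi>] \<pi> by (simp add: epimorphism_def)
qed

text \<open>The joint fibres of \<open>\<phi>\<close> and \<open>\<psi>\<close> form a clopen cover;
  both maps factor through any epimorphism whose fibres refine it.\<close>

lemma common_refinement:
  assumes "A \<in> finite_hasse_forests" "epimorphism F A \<phi>" "B \<in> finite_hasse_forests" "epimorphism F B \<psi>"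
  obtains C \<theta> \<pi> \<rho> where "C \<in> finite_hasse_forests" "epimorphism F C \<theta>"
    "epimorphism C A \<pi>" "\<And>x. x \<in> points_of F \<Longrightarrow> \<phi> x = \<pi> (\<theta> x)"
    "epimorphism C B \<rho>" "\<And>x. x \<in> points_of F \<Longrightarrow> \<psi> x = \<rho> (\<theta> x)"
proof -
  define \<U> where "\<U> = (\<lambda>w. {x \<in> points_of F. \<phi> x \<in> {\<phi> w}} \<inter> {x \<in> points_of F. \<psi> x \<in> {\<psi> w}}) ` points_of F"
  have clopen: "openin (space_of F) U \<and> closedin (space_of F) U" if "U \<in> \<U>" for U
    using that clopen_preimage assms unfolding \<U>_def by blast
  have "\<Union>\<U> = points_of F"
    by (auto simp: \<U>_def)
  then obtain C \<theta> where C: "C \<in> finite_hasse_forests" "epimorphism F C \<theta>"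
    and *: "\<And>x. x \<in> points_of F \<Longrightarrow> \<exists>U\<in>\<U>. \<forall>y\<in>points_of F. \<theta> y = \<theta> x \<longrightarrow> y \<in> U"
    using refine_cover[OF clopen] by metis
  have fib: "\<phi> x = \<phi> y \<and> \<psi> x = \<psi> y" if "x \<in> points_of F" "y \<in> points_of F" "\<theta> x = \<theta> y" for x y
    using *[OF that(1)] that unfolding \<U>_def by auto
  obtain \<pi> where "epimorphism C A \<pi>" "\<And>x. x \<in> points_of F \<Longrightarrow> \<phi> x = \<pi> (\<theta> x)"
    using factor[OF C(2) assms(2) C(1)] fib by metis
  moreover obtain \<rho> where "epimorphism C B \<rho>" "\<And>x. x \<in> points_of F \<Longrightarrow> \<psi> x = \<rho> (\<theta> x)"
    using factor[OF C(2) assms(4) C(1)] fib by metis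
  ultimately show thesis
    using that C by blast
qed

section \<open>Reading the relations of the limit off its finite quotients\<close>

lemma separate_from_closed_relation:
  assumes T: "closedin (prod_topology (space_of F) (space_of F)) T"
    and "w \<in> points_of F" "u \<in> points_of F" "(w, u) \<notin> T"
  obtains A \<phi> where "A \<in> finite_hasse_forests" "epimorphism F A \<phi>"
    "\<And>w' u'. (w', u') \<in> T \<Longrightarrow> \<phi> w' = \<phi> w \<Longrightarrow> \<phi> u' = \<phi> u \<Longrightarrow> False"
proof -
  let ?X = "space_of F"
  have "openin (prod_topology ?X ?X) (topspace ?X \<times> topspace ?X - T)"
    using T by (metis openin_diff openin_topspace topspace_prod_topology)
  then have "\<exists>U V. openin ?X U \<and> openin ?X V \<and> w \<in> U \<and> u \<in> V \<and> U \<times> V \<subseteq> topspace ?X \<times> topspace ?X - T"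
    using assms(2-4) by (simp add: openin_prod_topology_alt)
  then obtain U V where UV: "openin ?X U" "openin ?X V" "w \<in> U" "u \<in> V" "U \<times> V \<subseteq> topspace ?X \<times> topspace ?X - T"
    by blast
  have "?X dim_le 0"
    using topological by (simp add: topological_lr_structure_def)
  then have clopen: "\<exists>K. closedin ?X K \<and> openin ?X K \<and> x \<in> K \<and> K \<subseteq> W" if "openin ?X W" "x \<in> W" for x W
    using that unfolding dimension_le_0_neighbourhood_base_of_clopen neighbourhood_base_of
    by (meson subset_iff)
  obtain K where K: "closedin ?X K" "openin ?X K" "w \<in> K" "K \<subseteq> U"
    using clopen[OF UV(1,3)] by blast
  obtain L where L: "closedin ?X L" "openin ?X L" "u \<in> L" "L \<subseteq> V"
    using clopen[OF UV(2,4)] by blast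
  \<comment> \<open>\<open>K\<close> and \<open>L\<close> may overlap. The cover is the partition
    they generate, so a fibre lying in one piece is inside \<open>K\<close> as soon as it contains
    \<open>w\<close>, and inside \<open>L\<close> as soon as it contains \<open>u\<close>.\<close>
  define \<U> where "\<U> = {K \<inter> L, K - L, L - K, topspace ?X - (K \<union> L)}"
  have clopen: "openin ?X W \<and> closedin ?X W" if "W \<in> \<U>" for W
    using that K L unfolding \<U>_def by (auto intro: openin_diff closedin_diff)
  have "\<Union>\<U> = topspace ?X"
    using openin_subset[OF K(2)] openin_subset[OF L(2)] by (auto simp: \<U>_def)
  then obtain A \<phi> where A: "A \<in> finite_hasse_forests" "epimorphism F A \<phi>"
    and *: "\<And>x. x \<in> points_of F \<Longrightarrow> \<exists>U\<in>\<U>. \<forall>y\<in>points_of F. \<phi> y = \<phi> x \<longrightarrow> y \<in> U"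
    using refine_cover[OF clopen] by metis
  have wK: "y \<in> K" if "y \<in> points_of F" "\<phi> y = \<phi> w" for y
    using *[OF assms(2)] assms(2) K(3) that unfolding \<U>_def by blast
  have uL: "y \<in> L" if "y \<in> points_of F" "\<phi> y = \<phi> u" for y
    using *[OF assms(3)] assms(3) L(3) that unfolding \<U>_def by blast
  show thesis
  proof (rule that[OF A])
    fix w' u' assume "(w', u') \<in> T" "\<phi> w' = \<phi> w" "\<phi> u' = \<phi> u"
    moreover have "w' \<in> points_of F" "u' \<in> points_of F"
      using closedin_subset[OF T] \<open>(w', u') \<in> T\<close> by auto
    ultimately show False
      using wK uL K(4) L(4) UV(5) by blast
  qed
qed

lemma separate_rel:
  assumes "w \<in> points_of F" "u \<in> points_of F" "(w, u) \<notin> rel_of F"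
  obtains A \<phi> where "A \<in> finite_hasse_forests" "epimorphism F A \<phi>" "(\<phi> w, \<phi> u) \<notin> rel_of A"
proof -
  obtain A \<phi> where A: "A \<in> finite_hasse_forests" "epimorphism F A \<phi>"
    "\<And>w' u'. (w', u') \<in> rel_of F \<Longrightarrow> \<phi> w' = \<phi> w \<Longrightarrow> \<phi> u' = \<phi> u \<Longrightarrow> False"
    using separate_from_closed_relation[OF closed_rel assms] by metis
  moreover have "(\<phi> w, \<phi> u) \<notin> rel_of A"
  proof
    assume "(\<phi> w, \<phi> u) \<in> rel_of A"
    then obtain w' u' where "(w', u') \<in> rel_of F" "\<phi> w' = \<phi> w" "\<phi> u' = \<phi> u"
      using A(2) unfolding epimorphism_def by auto
    then show False
      using A(3) by blast
  qed
  ultimately show thesis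
    using that by blast
qed

lemma separate_le:
  assumes "w \<in> points_of F" "u \<in> points_of F" "(w, u) \<notin> le_of F"
  obtains A \<phi> where "A \<in> finite_hasse_forests" "epimorphism F A \<phi>" "(\<phi> w, \<phi> u) \<notin> le_of A"
proof -
  obtain A \<phi> where A: "A \<in> finite_hasse_forests" "epimorphism F A \<phi>"
    "\<And>w' u'. (w', u') \<in> le_of F \<Longrightarrow> \<phi> w' = \<phi> w \<Longrightarrow> \<phi> u' = \<phi> u \<Longrightarrow> False"
    using separate_from_closed_relation[OF closed_le assms] by metis
  moreover have "(\<phi> w, \<phi> u) \<notin> le_of A"
  proof
    assume "(\<phi> w, \<phi> u) \<in> le_of A"
    then obtain w' u' where "(w', u') \<in> le_of F" "\<phi> w' = \<phi> w" "\<phi> u' = \<phi> u"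
      using A(2) unfolding epimorphism_def by auto
    then show False
      using A(3) by blast
  qed
  ultimately show thesis
    using that by blast
qed

text \<open>Lifts \<open>\<phi>\<close> along the forest of \<open>chain_forest_cover\<close>. The
  last clause is the gain from repeating points \<open>M\<close> times; it leaves out the chains of
  \<open>J\<close>, whose maps are dictated by \<open>g\<close>.\<close>

lemma refine_by_chains:
  assumes A: "A \<in> finite_hasse_forests" and "epimorphism F A \<phi>" and "0 < M" and J: "finite J" "\<forall>i\<in>J. even i"
    and lohi: "\<forall>i\<in>J. lo i \<le> hi i"
    and g: "\<forall>i\<in>J. \<forall>z. lo i \<le> z \<and> z \<le> hi i \<longrightarrow> g i z \<in> points_of A"
    and step: "\<forall>i\<in>J. \<forall>z. lo i \<le> z \<and> z < hi i \<longrightarrow> (g i z, g i (Suc z)) \<in> le_of A \<inter> rel_of A"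
  obtains I lo' hi' \<psi> \<pi> where "J \<subseteq> I" "\<forall>i\<in>J. lo' i = lo i \<and> hi' i = hi i"
    "\<forall>i\<in>J. \<forall>z. \<pi> (prod_encode (i, z)) = g i z"
    "chain_forest I lo' hi' \<in> finite_hasse_forests" "epimorphism F (chain_forest I lo' hi') \<psi>"
    "epimorphism (chain_forest I lo' hi') A \<pi>" "\<forall>x\<in>points_of F. \<phi> x = \<pi> (\<psi> x)"
    "\<forall>x\<in>points_of F. \<forall>y\<in>points_of F. fst (prod_decode (\<psi> x)) \<notin> J \<and>
      near M (\<psi> x) (\<psi> y) \<longrightarrow> (\<phi> x, \<phi> y) \<in> rel_of A"
proof -
  obtain I lo' hi' g' where I: "J \<subseteq> I" "\<forall>i\<in>J. lo' i = lo i \<and> hi' i = hi i \<and> g' i = g i"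
    and C: "chain_forest I lo' hi' \<in> finite_hasse_forests"
    and g': "epimorphism (chain_forest I lo' hi') A (\<lambda>x. case prod_decode x of (i, z) \<Rightarrow> g' i z)"
    and adj: "\<forall>i\<in>I - J. \<forall>z z'. z \<le> z' \<and> z' \<le> hi' i \<and> z' \<le> z + M \<longrightarrow> (g' i z, g' i z') \<in> rel_of A"
    by (rule chain_forest_cover[OF A assms(3) J lohi g step])
  define \<pi> where "\<pi> = (\<lambda>x. case prod_decode x of (i, z) \<Rightarrow> g' i z)"
  have \<pi>: "epimorphism (chain_forest I lo' hi') A \<pi>" "\<pi> (prod_encode (i, z)) = g' i z" for i z
    using g' by (auto simp: \<pi>_def)
  obtain \<psi> where \<psi>: "epimorphism F (chain_forest I lo' hi') \<psi>" "\<And>x. x \<in> points_of F \<Longrightarrow> \<phi> x = \<pi> (\<psi> x)"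
    using lift[OF A C assms(2) \<pi>(1)] by metis
  have "(\<phi> x, \<phi> y) \<in> rel_of A"
    if xy: "x \<in> points_of F" "y \<in> points_of F" "fst (prod_decode (\<psi> x)) \<notin> J" "near M (\<psi> x) (\<psi> y)" for x y
  proof -
    obtain i z where x: "\<psi> x = prod_encode (i, z)" "i \<in> I" "z \<le> hi' i"
      using epimorphism_imageD(1)[OF \<psi>(1) xy(1)] by (rule points_of_chain_forestE)
    obtain j z' where y: "\<psi> y = prod_encode (j, z')" "j \<in> I" "z' \<le> hi' j"
      using epimorphism_imageD(1)[OF \<psi>(1) xy(2)] by (rule points_of_chain_forestE)
    have "j = i" "z \<le> z' + M" "z' \<le> z + M" "i \<notin> J"
      using x y xy by auto
    moreover have "(g' i a, g' i b) \<in> rel_of A" if "a \<le> b" "b \<le> hi' i" "b \<le> a + M" for a b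
      using adj that \<open>i \<in> I\<close> \<open>i \<notin> J\<close> by blast
    ultimately have "(g' i z, g' i z') \<in> rel_of A"
      using x y symD[OF finite_hasse_forestsD(9)[OF A]] by (metis nat_le_linear)
    then show ?thesis
      using x y \<open>j = i\<close> \<pi>(2) \<psi>(2) xy by simp
  qed
  then show thesis
    using that[of I lo' hi' \<pi> \<psi>] I \<pi> C \<psi> by simp
qed

lemma refine_by_separated_chains:
  assumes "A \<in> finite_hasse_forests" "epimorphism F A \<phi>"
  obtains I lo hi \<psi> \<pi> where "chain_forest I lo hi \<in> finite_hasse_forests"
    "epimorphism F (chain_forest I lo hi) \<psi>" "epimorphism (chain_forest I lo hi) A \<pi>"
    "\<And>x. x \<in> points_of F \<Longrightarrow> \<phi> x = \<pi> (\<psi> x)"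
    "\<And>x y. x \<in> points_of F \<Longrightarrow> y \<in> points_of F \<Longrightarrow> near (Suc d) (\<psi> x) (\<psi> y) \<Longrightarrow> (\<phi> x, \<phi> y) \<in> rel_of A"
  by (rule refine_by_chains[OF assms, of "Suc d" "{}"]) (auto intro: that)

lemma separate_rel_by_chains:
  assumes "w \<in> points_of F" "u \<in> points_of F" "(w, u) \<notin> rel_of F"
  obtains I lo hi \<psi> where "chain_forest I lo hi \<in> finite_hasse_forests"
    "epimorphism F (chain_forest I lo hi) \<psi>" "\<not> near d (\<psi> w) (\<psi> u)"
proof -
  obtain A \<phi> where A: "A \<in> finite_hasse_forests" "epimorphism F A \<phi>" "(\<phi> w, \<phi> u) \<notin> rel_of A"
    using separate_rel[OF assms] by metis
  obtain I lo hi \<psi> where "chain_forest I lo hi \<in> finite_hasse_forests"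
    "epimorphism F (chain_forest I lo hi) \<psi>"
    "\<And>x y. x \<in> points_of F \<Longrightarrow> y \<in> points_of F \<Longrightarrow> near (Suc d) (\<psi> x) (\<psi> y) \<Longrightarrow> (\<phi> x, \<phi> y) \<in> rel_of A"
    using refine_by_separated_chains[OF A(1,2)] by metis
  then show thesis
    using that A(3) assms near_mono[of d _ _ "Suc d"] by (metis le_SucI order_refl)
qed

lemma relI_near:
  assumes "w \<in> points_of F" "u \<in> points_of F"
    and "\<And>I lo hi \<psi>. chain_forest I lo hi \<in> finite_hasse_forests \<Longrightarrow>
      epimorphism F (chain_forest I lo hi) \<psi> \<Longrightarrow> near d (\<psi> w) (\<psi> u)"
  shows "(w, u) \<in> rel_of F"
proof (rule ccontr)
  assume "(w, u) \<notin> rel_of F"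
  then obtain I lo hi \<psi> where "chain_forest I lo hi \<in> finite_hasse_forests"
    "epimorphism F (chain_forest I lo hi) \<psi>" "\<not> near d (\<psi> w) (\<psi> u)"
    by (rule separate_rel_by_chains[OF assms(1,2)])
  then show False
    using assms(3) by blast
qed

lemma rel_imp_near:
  assumes "epimorphism F (chain_forest I lo hi) \<psi>" "(w, u) \<in> rel_of F"
  shows "near 1 (\<psi> w) (\<psi> u)"
  using epimorphism_imageD(2)[OF assms] by (simp add: mem_rel_of_chain_forest)

text \<open>In chain forests related points are at distance at most 1. Composing two such steps
  gives distance 2, and this still implies the relation because \<open>relI_near\<close> admits any
  bound.\<close>

lemma equiv_rel: "equiv (points_of F) (rel_of F)"
proof (rule equivI)
  show "refl_on (points_of F) (rel_of F)"
    using relI_near[of _ _ 0] by (auto simp: refl_on_def)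
  show "sym (rel_of F)"
  proof (rule symI)
    fix w u assume wu: "(w, u) \<in> rel_of F"
    then show "(u, w) \<in> rel_of F"
      using rel_subset rel_imp_near near_sym by (intro relI_near[of _ _ 1]) blast+
  qed
  show "trans (rel_of F)"
  proof (rule transI)
    fix w u v assume "(w, u) \<in> rel_of F" "(u, v) \<in> rel_of F"
    then show "(w, v) \<in> rel_of F"
      using rel_subset rel_imp_near near_trans[of 1 _ _ 1] by (intro relI_near[of _ _ "1 + 1"]) blast+
  qed
  show "rel_of F \<subseteq> points_of F \<times> points_of F"
    by (rule rel_subset)
qed

text \<open>Each epimorphism separates an open set of pairs, and these open sets cover the
  complement of the closed relation. Countably many of them suffice, which makes a construction in
  stages possible.\<close>

lemma separating_sequence:
  obtains I :: "nat \<Rightarrow> nat set" and lo hi \<eta> where "\<forall>n. chain_forest (I n) (lo n) (hi n) \<in> finite_hasse_forests"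
    "\<forall>n. epimorphism F (chain_forest (I n) (lo n) (hi n)) (\<eta> n)"
    "\<forall>w\<in>points_of F. \<forall>u\<in>points_of F. (\<forall>n. near d (\<eta> n w) (\<eta> n u)) \<longrightarrow> (w, u) \<in> rel_of F"
proof -
  define P where "P p \<longleftrightarrow> (case p of (I, lo, hi, \<psi>) \<Rightarrow> chain_forest I lo hi \<in> finite_hasse_forests \<and>
    epimorphism F (chain_forest I lo hi) \<psi>)" for p :: "nat set \<times> (nat \<Rightarrow> nat) \<times> (nat \<Rightarrow> nat) \<times> ('a \<Rightarrow> nat)"
  define W where "W p = (case p of (I, lo, hi, \<psi>) \<Rightarrow> {q \<in> points_of F \<times> points_of F. \<not> near d (\<psi> (fst q)) (\<psi> (snd q))})"
    for p :: "nat set \<times> (nat \<Rightarrow> nat) \<times> (nat \<Rightarrow> nat) \<times> ('a \<Rightarrow> nat)"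
  let ?XX = "prod_topology (space_of F) (space_of F)"
  have "openin ?XX (W p)" if "P p" for p
  proof -
    obtain I lo hi \<psi> where p: "p = (I, lo, hi, \<psi>)"
      by (cases p)
    then have C: "chain_forest I lo hi \<in> finite_hasse_forests" "epimorphism F (chain_forest I lo hi) \<psi>"
      using that by (auto simp: P_def)
    have "W p = (\<Union>(a, b)\<in>{(a, b). \<not> near d a b}. {x \<in> points_of F. \<psi> x \<in> {a}} \<times> {x \<in> points_of F. \<psi> x \<in> {b}})"
      by (auto simp: W_def p)
    also have "openin ?XX \<dots>"
      using clopen_preimage(1)[OF C]
      by (intro openin_Union) (auto simp only: openin_prod_Times_iff split: prod.splits)
    finally show ?thesis .
  qed
  moreover have "\<exists>p. P p \<and> q \<in> W p" if "q \<in> topspace ?XX - rel_of F" for q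
  proof -
    obtain w u where "q = (w, u)"
      by (cases q)
    with that have q: "q = (w, u)" "w \<in> points_of F" "u \<in> points_of F" "(w, u) \<notin> rel_of F"
      by auto
    obtain I lo hi \<psi> where "chain_forest I lo hi \<in> finite_hasse_forests"
      "epimorphism F (chain_forest I lo hi) \<psi>" "\<not> near d (\<psi> w) (\<psi> u)"
      using separate_rel_by_chains[OF q(2-4)] by metis
    then have "P (I, lo, hi, \<psi>) \<and> q \<in> W (I, lo, hi, \<psi>)"
      using q by (auto simp: P_def W_def)
    then show ?thesis by blast
  qed
  moreover have "\<exists>p. P p"
  proof -
    have "chain_forest {0} (\<lambda>_. 0) (\<lambda>_. 0) \<in> finite_hasse_forests"
      by (rule chain_forest_in_finite_hasse_forests) auto
    moreover from this obtain \<psi> where "epimorphism F (chain_forest {0} (\<lambda>_. 0) (\<lambda>_. 0)) \<psi>"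
      using epimorphism_exists by blast
    ultimately have "P ({0}, \<lambda>_. 0, \<lambda>_. 0, \<psi>)"
      by (simp add: P_def)
    then show ?thesis by blast
  qed
  moreover have "compact_space ?XX" "metrizable_space ?XX"
    using compact metrizable by (auto simp: compact_space_prod_topology metrizable_space_prod_topology)
  ultimately obtain c where c: "\<And>n::nat. P (c n)" and cov: "\<And>q. q \<in> topspace ?XX - rel_of F \<Longrightarrow> \<exists>n. q \<in> W (c n)"
    using countable_subcover_of_open_complement[where P = P and W = W, OF _ _ closed_rel] by metis
  define I where "I n = fst (c n)" for n
  define lo where "lo n = fst (snd (c n))" for n
  define hi where "hi n = fst (snd (snd (c n)))" for n
  define \<eta> where "\<eta> n = snd (snd (snd (c n)))" for n
  have c_eq: "c n = (I n, lo n, hi n, \<eta> n)" for n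
    by (simp add: I_def lo_def hi_def \<eta>_def)
  have "(w, u) \<in> rel_of F" if "w \<in> points_of F" "u \<in> points_of F" "\<forall>n. near d (\<eta> n w) (\<eta> n u)" for w u
  proof (rule ccontr)
    assume "(w, u) \<notin> rel_of F"
    then have "(w, u) \<in> topspace ?XX - rel_of F"
      using that(1,2) by simp
    then obtain n where "(w, u) \<in> W (c n)"
      using cov by blast
    then show False
      using that(3) by (simp add: W_def c_eq)
  qed
  then show thesis
    using that[of I lo hi \<eta>] c by (simp add: P_def c_eq)
qed

text \<open>One stage of the construction: the new forest must decide \<open>\<eta>\<close> and
  carry the finer pieces \<open>c'\<close> and a finer grid. A common refinement \<open>A1\<close>
  of \<open>A\<close> and the old forest takes care of \<open>\<eta>\<close>. The chain of a new
  piece is sent along the lift to \<open>A1\<close> of the chain of the old piece containing it,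
  restricted to the subcells that the new piece spans.\<close>

lemma refine_with_fence_chains:
  fixes h :: "'b \<Rightarrow> real" and c c' :: "'b \<Rightarrow> nat"
  assumes A: "A \<in> finite_hasse_forests" "epimorphism F A \<eta>"
    and C: "chain_forest I lo hi \<in> finite_hasse_forests" "epimorphism F (chain_forest I lo hi) \<phi>"
    and h: "\<forall>y\<in>T. h y \<in> {0..1}"
    and c: "\<forall>y\<in>T. 2 * c y \<in> I \<and> lo (2 * c y) \<le> cell E (h y) \<and> cell E (h y) \<le> hi (2 * c y)"
    and c': "finite (c' ` T)" "\<forall>y\<in>T. \<forall>y'\<in>T. c' y = c' y' \<longrightarrow> c y = c y'"
  obtains D I' lo' hi' \<phi>' where "2 \<le> D" "chain_forest I' lo' hi' \<in> finite_hasse_forests"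
    "epimorphism F (chain_forest I' lo' hi') \<phi>'"
    "\<forall>y\<in>T. 2 * c' y \<in> I' \<and> lo' (2 * c' y) \<le> cell (E * D) (h y) \<and> cell (E * D) (h y) \<le> hi' (2 * c' y)"
    "\<forall>y\<in>T. \<exists>y'\<in>T. c' y' = c' y \<and> lo' (2 * c' y) = cell (E * D) (h y')"
    "\<forall>y\<in>T. \<exists>y'\<in>T. c' y' = c' y \<and> hi' (2 * c' y) = cell (E * D) (h y')"
    "\<forall>w\<in>points_of F. \<forall>u\<in>points_of F. near 1 (\<phi>' w) (\<phi>' u) \<longrightarrow> (\<eta> w, \<eta> u) \<in> rel_of A"
    "\<forall>w\<in>points_of F. \<forall>y\<in>T. \<forall>z. \<phi>' w = prod_encode (2 * c' y, z) \<longrightarrow> \<phi> w = prod_encode (2 * c y, z div D)"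
proof -
  let ?C = "chain_forest I lo hi"
  obtain A1 \<theta> \<pi> \<rho> where A1: "A1 \<in> finite_hasse_forests" and \<theta>: "epimorphism F A1 \<theta>"
    and \<pi>: "epimorphism A1 ?C \<pi>" "\<And>x. x \<in> points_of F \<Longrightarrow> \<phi> x = \<pi> (\<theta> x)"
    and \<rho>: "epimorphism A1 A \<rho>" "\<And>x. x \<in> points_of F \<Longrightarrow> \<eta> x = \<rho> (\<theta> x)"
    using common_refinement[OF C A] by metis
  note D1 = finite_hasse_forestsD[OF A1]
  \<comment> \<open>\<open>I\<close> may contain indices of empty chains. Those of nonempty chains
    are finitely many, since each contributes a point to a finite forest.\<close>
  define Ic where "Ic = {i \<in> I. lo i \<le> hi i}"
  have "finite Ic"
  proof -
    have "(\<lambda>i. prod_encode (i, lo i)) ` Ic \<subseteq> points_of ?C"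
      by (auto simp: Ic_def)
    then have "finite ((\<lambda>i. prod_encode (i, lo i)) ` Ic)"
      using finite_hasse_forestsD(1)[OF C(1)] finite_subset by blast
    then show ?thesis
      by (rule finite_imageD) (auto simp: inj_on_def)
  qed
  \<comment> \<open>The bottom and top of a chain form a comparable pair, which is the image under
    \<open>\<pi>\<close> of a comparable pair of \<open>A1\<close>; a walk joining the latter lies
    over the whole chain.\<close>
  have "\<exists>k p. p k \<in> points_of A1 \<and> \<pi> (p 0) = prod_encode (i, lo i) \<and> \<pi> (p k) = prod_encode (i, hi i) \<and>
      (\<forall>j<k. (p j, p (Suc j)) \<in> le_of A1 \<inter> rel_of A1)" if "i \<in> Ic" for i
  proof -
    have "(prod_encode (i, lo i), prod_encode (i, hi i)) \<in> le_of ?C"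
      using that by (auto simp: mem_le_of_chain_forest Ic_def)
    then obtain a b where ab: "(a, b) \<in> le_of A1" "\<pi> a = prod_encode (i, lo i)" "\<pi> b = prod_encode (i, hi i)"
      using \<pi>(1) by (auto simp: epimorphism_def)
    obtain k p where "p 0 = a" "p k = b" "\<And>j. j < k \<Longrightarrow> (p j, p (Suc j)) \<in> le_of A1 \<inter> rel_of A1"
      using walk_exists[OF A1 ab(1)] by metis
    then show ?thesis
      using ab D1(4) by (intro exI[of _ k] exI[of _ p]) auto
  qed
  then obtain k p where p: "\<And>i. i \<in> Ic \<Longrightarrow> p i (k i) \<in> points_of A1 \<and> \<pi> (p i 0) = prod_encode (i, lo i) \<and> \<pi> (p i (k i)) = prod_encode (i, hi i)"
    and pstep: "\<And>i j. i \<in> Ic \<Longrightarrow> j < k i \<Longrightarrow> (p i j, p i (Suc j)) \<in> le_of A1 \<inter> rel_of A1"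
    by metis
  have ppt: "p i j \<in> points_of A1" if "i \<in> Ic" "j \<le> k i" for i j
    using p[OF that(1)] pstep[OF that(1), of j] D1(4) that(2) by (cases "j = k i") auto
  define q where "q i j = snd (prod_decode (\<pi> (p i j)))" for i j
  have \<pi>p: "\<pi> (p i j) = prod_encode (i, q i j)" if "i \<in> Ic" "j \<le> k i" for i j
    using that(2)
  proof (induction j)
    case 0
    then show ?case
      using p[OF that(1)] by (simp add: q_def)
  next
    case (Suc j)
    have "(\<pi> (p i j), \<pi> (p i (Suc j))) \<in> le_of ?C"
      using epimorphism_imageD(3)[OF \<pi>(1)] pstep[OF that(1), of j] Suc.prems by simp
    then have "fst (prod_decode (\<pi> (p i (Suc j)))) = i"
      using Suc by (auto simp: mem_le_of_chain_forest)
    then show ?case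
      unfolding q_def by (metis prod.collapse prod_decode_inverse)
  qed
  have q: "q i 0 = lo i" "q i (k i) = hi i" if "i \<in> Ic" for i
    using p[OF that] by (auto simp: q_def)
  \<comment> \<open>A step of the walk is increasing and an edge, and \<open>\<pi>\<close> preserves
    both, so the height grows by 0 or 1.\<close>
  have qstep: "q i (Suc j) = q i j \<or> q i (Suc j) = Suc (q i j)" if "i \<in> Ic" "j < k i" for i j
  proof -
    have "(\<pi> (p i j), \<pi> (p i (Suc j))) \<in> le_of ?C" "(\<pi> (p i j), \<pi> (p i (Suc j))) \<in> rel_of ?C"
      using epimorphism_imageD(2,3)[OF \<pi>(1)] pstep[OF that] by simp_all
    then show ?thesis
      using \<pi>p that by (auto simp: mem_le_of_chain_forest mem_rel_of_chain_forest)
  qed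
  \<comment> \<open>The bound by \<open>k i\<close> gives each cell room for the entire walk;
    \<open>2 \<le> D\<close> makes the mesh of the grids tend to 0.\<close>
  obtain D where D: "2 \<le> D" "\<And>i. i \<in> Ic \<Longrightarrow> k i < D"
  proof -
    obtain m where "\<And>x. x \<in> k ` Ic \<Longrightarrow> x < m"
      using \<open>finite Ic\<close> finite_nat_set_iff_bounded by (metis finite_imageI)
    then show thesis
      using that[of "max 2 m"] by (simp add: less_max_iff_disj)
  qed
  have "\<exists>\<tau>. (\<forall>z. lo i * D \<le> z \<longrightarrow> z < Suc (hi i) * D \<longrightarrow> \<tau> z \<le> k i \<and> q i (\<tau> z) = z div D) \<and>
     (\<forall>z. lo i * D \<le> z \<longrightarrow> Suc z < Suc (hi i) * D \<longrightarrow> \<tau> (Suc z) = \<tau> z \<or> \<tau> (Suc z) = Suc (\<tau> z))" if "i \<in> Ic" for i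
    using stretch_steps[OF q[OF that] qstep[OF that] D(2)[OF that]] by metis
  then obtain \<tau> where
    \<tau>: "\<And>i z. i \<in> Ic \<Longrightarrow> lo i * D \<le> z \<Longrightarrow> z < Suc (hi i) * D \<Longrightarrow> \<tau> i z \<le> k i \<and> q i (\<tau> i z) = z div D" and
    \<tau>S: "\<And>i z. i \<in> Ic \<Longrightarrow> lo i * D \<le> z \<Longrightarrow> Suc z < Suc (hi i) * D \<Longrightarrow> \<tau> i (Suc z) = \<tau> i z \<or> \<tau> i (Suc z) = Suc (\<tau> i z)"
    by metis
  \<comment> \<open>Doubling the number of a piece makes the index of its chain even, which reserves
    the odd indices for the chains that complete the epimorphism.\<close>
  define J where "J = (\<lambda>y. 2 * c' y) ` T"
  \<comment> \<open>The chain of a piece will run from the least to the greatest of these cells: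
    gaps are filled, but both ends are cells of points of the piece.\<close>
  define cells where "cells j = (\<lambda>y. cell (E * D) (h y)) ` {y \<in> T. 2 * c' y = j}" for j
  \<comment> \<open>The old chain above which a new one is placed. Any representative will do, since
    \<open>c'\<close> refines \<open>c\<close>.\<close>
  define par where "par j = 2 * c (SOME y. y \<in> T \<and> 2 * c' y = j)" for j
  have par: "par (2 * c' y) = 2 * c y" if "y \<in> T" for y
  proof -
    define s where "s = (SOME y'. y' \<in> T \<and> 2 * c' y' = 2 * c' y)"
    have "s \<in> T \<and> 2 * c' s = 2 * c' y"
      unfolding s_def by (rule someI[of _ y]) (use that in simp)
    then have "c s = c y"
      using c'(2) that by (metis mult_cancel1 zero_neq_numeral)
    then show ?thesis
      by (simp add: par_def s_def)
  qed
  have cells: "finite (cells j)" "j \<in> J \<Longrightarrow> cells j \<noteq> {}" for j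
  proof -
    have "cells j \<subseteq> {..E * D}"
      using h by (auto simp: cells_def intro!: cell_le)
    then show "finite (cells j)"
      using finite_subset by blast
    show "cells j \<noteq> {}" if "j \<in> J"
      using that by (auto simp: J_def cells_def)
  qed
  have range: "par j \<in> Ic \<and> lo (par j) * D \<le> z \<and> z < Suc (hi (par j)) * D"
    if j: "j \<in> J" "Min (cells j) \<le> z" "z \<le> Max (cells j)" for j z
  proof -
    have *: "par j \<in> Ic \<and> lo (par j) * D \<le> x \<and> x < Suc (hi (par j)) * D" if x: "x \<in> cells j" for x
    proof -
      obtain y where y: "y \<in> T" "2 * c' y = j" "x = cell (E * D) (h y)"
        using x by (auto simp: cells_def)
      have "x div D = cell E (h y)"
        using y h D(1) cell_mult_div by simp
      then have "par j \<in> I" "lo (par j) \<le> x div D" "x div D \<le> hi (par j)"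
        using c par[OF y(1)] y by auto
      moreover have "lo (par j) * D \<le> x \<longleftrightarrow> lo (par j) \<le> x div D"
        "x < Suc (hi (par j)) * D \<longleftrightarrow> x div D < Suc (hi (par j))"
        using D(1) by (simp_all only: less_eq_div_iff_mult_less_eq div_less_iff_less_mult)
      ultimately show ?thesis
        unfolding Ic_def by auto
    qed
    show ?thesis
      using *[OF Min_in[OF cells]] *[OF Max_in[OF cells]] j by simp
  qed
  define g where "g j z = p (par j) (\<tau> (par j) z)" for j z
  have gpt: "g j z \<in> points_of A1" "\<pi> (g j z) = prod_encode (par j, z div D)"
    if "j \<in> J" "Min (cells j) \<le> z" "z \<le> Max (cells j)" for j z
    using range[OF that] \<tau>[of "par j" z] ppt \<pi>p by (auto simp: g_def)
  have gstep: "(g j z, g j (Suc z)) \<in> le_of A1 \<inter> rel_of A1"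
    if "j \<in> J" "Min (cells j) \<le> z" "z < Max (cells j)" for j z
  proof -
    have r: "par j \<in> Ic" "lo (par j) * D \<le> z" "Suc z < Suc (hi (par j)) * D"
      using range[of j "Suc z"] range[of j z] that by auto
    have "\<tau> (par j) (Suc z) = \<tau> (par j) z \<or> \<tau> (par j) (Suc z) = Suc (\<tau> (par j) z)"
      using \<tau>S r by blast
    then show ?thesis
    proof
      assume "\<tau> (par j) (Suc z) = \<tau> (par j) z"
      then show ?thesis
        using gpt(1)[of j z] that D1(6) by (simp add: g_def)
    next
      assume S: "\<tau> (par j) (Suc z) = Suc (\<tau> (par j) z)"
      then have "\<tau> (par j) z < k (par j)"
        using \<tau>[of "par j" "Suc z"] r by auto
      then show ?thesis
        using pstep r(1) S by (simp add: g_def)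
    qed
  qed
  have J: "finite J" "\<forall>j\<in>J. even j"
  proof -
    have "J = (\<lambda>x. 2 * x) ` c' ` T"
      by (auto simp: J_def)
    then show "finite J"
      using c'(1) by simp
  qed (auto simp: J_def)
  have mm: "\<forall>j\<in>J. Min (cells j) \<le> Max (cells j)"
    using cells by (meson Max_ge Min_in)
  have gpt1: "\<forall>j\<in>J. \<forall>z. Min (cells j) \<le> z \<and> z \<le> Max (cells j) \<longrightarrow> g j z \<in> points_of A1"
    and gstep1: "\<forall>j\<in>J. \<forall>z. Min (cells j) \<le> z \<and> z < Max (cells j) \<longrightarrow> (g j z, g j (Suc z)) \<in> le_of A1 \<inter> rel_of A1"
    using gpt(1) gstep by blast+
  obtain I' lo' hi' \<phi>' \<sigma> where I': "J \<subseteq> I'" "\<forall>i\<in>J. lo' i = Min (cells i) \<and> hi' i = Max (cells i)"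
    "\<forall>i\<in>J. \<forall>z. \<sigma> (prod_encode (i, z)) = g i z"
    and C': "chain_forest I' lo' hi' \<in> finite_hasse_forests" "epimorphism F (chain_forest I' lo' hi') \<phi>'"
    and \<sigma>: "epimorphism (chain_forest I' lo' hi') A1 \<sigma>" "\<forall>x\<in>points_of F. \<theta> x = \<sigma> (\<phi>' x)"
    "\<forall>x\<in>points_of F. \<forall>y\<in>points_of F. fst (prod_decode (\<phi>' x)) \<notin> J \<and>
      near 1 (\<phi>' x) (\<phi>' y) \<longrightarrow> (\<theta> x, \<theta> y) \<in> rel_of A1"
    by (rule refine_by_chains[where J = J and lo = "\<lambda>j. Min (cells j)" and hi = "\<lambda>j. Max (cells j)" and g = g,
          OF A1 \<theta> zero_less_one J mm gpt1 gstep1])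
  have Jy: "2 * c' y \<in> J" "cell (E * D) (h y) \<in> cells (2 * c' y)" if "y \<in> T" for y
    using that by (auto simp: J_def cells_def)
  have "2 * c' y \<in> I' \<and> lo' (2 * c' y) \<le> cell (E * D) (h y) \<and> cell (E * D) (h y) \<le> hi' (2 * c' y)"
      if "y \<in> T" for y
      using Jy[OF that] I' cells by auto
  moreover have "\<exists>y'\<in>T. c' y' = c' y \<and> lo' (2 * c' y) = cell (E * D) (h y')" if "y \<in> T" for y
      using Min_in[OF cells(1) cells(2)[OF Jy(1)[OF that]]] bspec[OF I'(2) Jy(1)[OF that]]
      by (auto simp: cells_def)
  moreover have "\<exists>y'\<in>T. c' y' = c' y \<and> hi' (2 * c' y) = cell (E * D) (h y')" if "y \<in> T" for y
      using Max_in[OF cells(1) cells(2)[OF Jy(1)[OF that]]] bspec[OF I'(2) Jy(1)[OF that]]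
      by (auto simp: cells_def)
  \<comment> \<open>Distance 1 between points of a chain forest is its relation, which
    \<open>\<sigma>\<close> and \<open>\<rho>\<close> carry down to \<open>A\<close>.\<close>
  moreover have "(\<eta> w, \<eta> u) \<in> rel_of A"
      if wu: "w \<in> points_of F" "u \<in> points_of F" "near 1 (\<phi>' w) (\<phi>' u)" for w u
    proof -
      have "(\<phi>' w, \<phi>' u) \<in> rel_of (chain_forest I' lo' hi')"
        using wu epimorphism_imageD(1)[OF C'(2)] by (simp add: mem_rel_of_chain_forest)
      then show ?thesis
        using epimorphism_imageD(2)[OF \<rho>(1)] epimorphism_imageD(2)[OF \<sigma>(1)] \<rho>(2) \<sigma>(2) wu by simp
    qed
  moreover have "\<phi> w = prod_encode (2 * c y, z div D)"
      if w: "w \<in> points_of F" "y \<in> T" "\<phi>' w = prod_encode (2 * c' y, z)" for w y z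
    proof -
      have "prod_encode (2 * c' y, z) \<in> points_of (chain_forest I' lo' hi')"
        using epimorphism_imageD(1)[OF C'(2) w(1)] w(3) by simp
      then have "Min (cells (2 * c' y)) \<le> z" "z \<le> Max (cells (2 * c' y))"
        using I'(2) Jy(1)[OF w(2)] by auto
      then have "\<pi> (\<sigma> (\<phi>' w)) = prod_encode (par (2 * c' y), z div D)"
        using gpt(2)[OF Jy(1)[OF w(2)]] bspec[OF I'(3) Jy(1)[OF w(2)]] w(3) by simp
      then show ?thesis
        using \<pi>(2) \<sigma>(2) w par by simp
    qed
  ultimately show thesis
    using that[OF D(1) C'] by blast
qed

end

section \<open>Extremal points and endpoints\<close>

text \<open>Let a minimal \<open>x\<close> be interior to an arc. By comparability it is below both
  ends of the arc, and one end is below the other. That lower end then lies between \<open>x\<close>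
  and the upper end in the order, although the segment of the arc from \<open>x\<close> to the upper
  end avoids it.\<close>

lemma minimal_points_subset_endpoints:
  assumes L: "closedin (prod_topology X X) L" "antisym L"
    and comp: "\<And>S a b. connectedin X S \<Longrightarrow> a \<in> S \<Longrightarrow> b \<in> S \<Longrightarrow> (a, b) \<in> L \<or> (b, a) \<in> L"
  shows "minimal_points X L \<subseteq> endpoints X"
proof
  fix x assume x: "x \<in> minimal_points X L"
  let ?I = "top_of_set {0..1::real}"
  have "x = g 0 \<or> x = g 1" if g: "embedding_map ?I X g" and t: "t \<in> {0..1}" "x = g t" for g t
  proof (rule ccontr)
    assume "\<not> ?thesis"
    then have ne: "x \<noteq> g 0" "x \<noteq> g 1" by auto
    have "homeomorphic_map ?I (subtopology X (g ` topspace ?I)) g"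
      using g by (simp only: embedding_map_def)
    then have cont: "continuous_map ?I X g" and inj: "inj_on g {0..1}"
      using continuous_map_into_fulltopology homeomorphic_imp_continuous_map homeomorphic_imp_injective_map
      by (blast, fastforce)
    have gX: "g s \<in> topspace X" if "s \<in> {0..1}" for s
      using continuous_map_image_subset_topspace[OF cont] that by auto
    have tot: "(g s, g s') \<in> L \<or> (g s', g s) \<in> L" if "s \<in> {0..1}" "s' \<in> {0..1}" for s s'
    proof (rule comp)
      have "connectedin ?I {0..1}"
        by (simp add: connectedin_subtopology connectedin_iff_connected)
      then show "connectedin X (g ` {0..1})"
        by (rule connectedin_continuous_map_image[OF cont])
    qed (use that in auto)
    have below: "(x, g s) \<in> L" if "s \<in> {0..1}" for s
      using tot[OF t(1) that] t x gX[OF that] unfolding minimal_points_def by force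
    \<comment> \<open>The parameters of points below and above \<open>g s\<^sub>0\<close> form two
      closed sets covering the segment. By connectedness they meet, and by antisymmetry the common
      point is \<open>g s\<^sub>0\<close> itself.\<close>
    have no_between: False
      if s0: "s\<^sub>0 \<in> {0..1}" and ab: "0 \<le> a" "b \<le> 1" "s\<^sub>0 \<notin> {a..b}" and p: "p \<in> {a..b}" "(g p, g s\<^sub>0) \<in> L"
        and q: "q \<in> {a..b}" "(g s\<^sub>0, g q) \<in> L" for s\<^sub>0 a b p q
    proof -
      have c1: "continuous_map ?I (prod_topology X X) (\<lambda>s. (g s, g s\<^sub>0))"
        and c2: "continuous_map ?I (prod_topology X X) (\<lambda>s. (g s\<^sub>0, g s))"
        using cont gX[OF s0] by (auto intro!: continuous_map_pairedI)
      define E1 where "E1 = {s \<in> topspace ?I. (g s, g s\<^sub>0) \<in> L}"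
      define E2 where "E2 = {s \<in> topspace ?I. (g s\<^sub>0, g s) \<in> L}"
      have "closedin ?I E1" "closedin ?I E2"
        unfolding E1_def E2_def
        using closedin_continuous_map_preimage[OF c1 L(1)] closedin_continuous_map_preimage[OF c2 L(1)] by auto
      moreover have "connectedin ?I {a..b}"
        using ab by (auto simp: connectedin_subtopology connectedin_iff_connected)
      moreover have "{a..b} \<subseteq> E1 \<union> E2"
      proof
        fix s assume "s \<in> {a..b}"
        then have "s \<in> {0..1}"
          using ab by simp
        then show "s \<in> E1 \<union> E2"
          using tot[OF _ s0] by (simp add: E1_def E2_def)
      qed
      moreover have "p \<in> E1" "q \<in> E2"
        using p q ab by (auto simp: E1_def E2_def)
      ultimately have "E1 \<inter> E2 \<inter> {a..b} \<noteq> {}"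
        using p(1) q(1) unfolding connectedin_closedin by blast
      then obtain s where "s \<in> {a..b}" "(g s, g s\<^sub>0) \<in> L" "(g s\<^sub>0, g s) \<in> L"
        unfolding E1_def E2_def by blast
      then have "g s = g s\<^sub>0" "s \<in> {0..1}"
        using L(2) ab by (auto dest: antisymD)
      then have "s = s\<^sub>0"
        using inj s0 by (auto dest: inj_onD)
      then show False
        using \<open>s \<in> {a..b}\<close> ab by blast
    qed
    have t01: "0 < t" "t < 1"
      using ne t by (auto simp: less_eq_real_def)
    show False
    proof (cases "(g 0, g 1) \<in> L")
      case True
      then show False
        using no_between[of 0 t 1 t 1] t01 below[of 0] t by auto
    next
      case False
      then have "(g 1, g 0) \<in> L"
        using tot[of 0 1] by auto
      then show False
        using no_between[of 1 0 t t 0] t01 below[of 1] t by auto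
    qed
  qed
  then have "\<forall>g. embedding_map ?I X g \<and> x \<in> g ` {0..1} \<longrightarrow> x = g 0 \<or> x = g 1"
    by blast
  then show "x \<in> endpoints X"
    using x unfolding endpoints_def minimal_points_def by blast
qed

lemma maximal_points_converse: "maximal_points X L = minimal_points X (L\<inverse>)"
  by (simp add: maximal_points_def minimal_points_def)

text \<open>A point with others strictly below and strictly above it has all of them in its
  component, which is therefore an arc. If the point were an end of that arc, removing it would
  leave a connected set, yet the points below and those above split this set into two nonempty
  closed parts.\<close>

lemma endpoints_subset_extremal_points:
  assumes fence: "fence Y" and r: "strongly_compatible_order Y r"
  shows "endpoints Y \<subseteq> minimal_points Y r \<union> maximal_points Y r"
proof
  fix y assume y: "y \<in> endpoints Y"
  then have yY: "y \<in> topspace Y"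
    by (simp add: endpoints_def)
  have clo: "closedin (prod_topology Y Y) r" and po: "partial_order_on (topspace Y) r"
    and tot: "\<And>C. C \<in> connected_components_of Y \<Longrightarrow> total_on C r"
    and comp: "\<And>a b. a \<in> topspace Y \<Longrightarrow> b \<in> topspace Y \<Longrightarrow> (a, b) \<in> r \<Longrightarrow> connected_component_of Y a b"
    using r by (auto simp: strongly_compatible_order_def closed_partial_order_def)
  have anti: "antisym r" and refl: "(y, y) \<in> r"
    using po yY by (auto simp: partial_order_on_def preorder_on_def refl_on_def)
  show "y \<in> minimal_points Y r \<union> maximal_points Y r"
  proof (rule ccontr)
    assume "y \<notin> minimal_points Y r \<union> maximal_points Y r"
    then obtain a b where a: "a \<in> topspace Y" "(a, y) \<in> r" "a \<noteq> y" and b: "b \<in> topspace Y" "(y, b) \<in> r" "b \<noteq> y"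
      using yY by (auto simp: minimal_points_def maximal_points_def)
    define C where "C = connected_component_of_set Y y"
    have C: "C \<in> connected_components_of Y" "y \<in> C" "a \<in> C" "b \<in> C"
      using comp[OF a(1) yY a(2)] comp[OF yY b(1,2)] yY
      by (auto simp: C_def connected_component_in_connected_components_of connected_component_of_refl
          connected_component_of_sym)
    have "\<not> (\<exists>x. C = {x})"
      using C a(3) by auto
    then have "subtopology Y C homeomorphic_space top_of_set {0..1::real}"
      using fence C(1) by (auto simp: fence_def)
    then obtain g where g: "homeomorphic_map (top_of_set {0..1::real}) (subtopology Y C) g"
      using homeomorphic_space homeomorphic_space_sym by metis
    have CY: "C \<subseteq> topspace Y"
      by (simp add: C_def connected_component_of_subset_topspace)
    then have gC: "g ` {0..1} = C"
      using homeomorphic_imp_surjective_map[OF g] by (simp add: Int_absorb1)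
    have inj: "inj_on g {0..1}"
      using homeomorphic_imp_injective_map[OF g] by simp
    have cont: "continuous_map (top_of_set {0..1::real}) Y g"
      using homeomorphic_imp_continuous_map[OF g] continuous_map_into_fulltopology by blast
    have "embedding_map (top_of_set {0..1::real}) Y g"
      using g gC by (simp add: embedding_map_def)
    then have ends: "y = g 0 \<or> y = g 1"
      using y C(2) gC unfolding endpoints_def by blast
    have "\<exists>J. J \<subseteq> {0..1} \<and> connected J \<and> g ` J = C - {y}"
      using ends
    proof
      assume "y = g 0"
      moreover have "{0<..1} = {0..1} - {0::real}"
        by auto
      then have "g ` {0<..1} = g ` {0..1} - {g 0}"
        using inj_on_image_set_diff[OF inj, of "{0..1}" "{0}"] by simp
      ultimately have "g ` {0<..1} = C - {y}"
        using gC by simp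
      then show ?thesis
        by (intro exI[of _ "{0<..1}"]) auto
    next
      assume "y = g 1"
      moreover have "{0..<1} = {0..1} - {1::real}"
        by auto
      then have "g ` {0..<1} = g ` {0..1} - {g 1}"
        using inj_on_image_set_diff[OF inj, of "{0..1}" "{1}"] by simp
      ultimately have "g ` {0..<1} = C - {y}"
        using gC by simp
      then show ?thesis
        by (intro exI[of _ "{0..<1}"]) auto
    qed
    then obtain J where "J \<subseteq> {0..1}" "connected J" and J: "g ` J = C - {y}"
      by blast
    then have "connectedin (top_of_set {0..1::real}) J"
      by (simp add: connectedin_subtopology connectedin_iff_connected)
    then have con: "connectedin Y (C - {y})"
      using connectedin_continuous_map_image[OF cont] J by metis
    define P where "P = {s \<in> topspace Y. (s, y) \<in> r}"
    define P' where "P' = {s \<in> topspace Y. (y, s) \<in> r}"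
    have "continuous_map Y (prod_topology Y Y) (\<lambda>s. (s, y))" "continuous_map Y (prod_topology Y Y) (\<lambda>s. (y, s))"
      using yY by (auto intro!: continuous_map_pairedI)
    then have "closedin Y P" "closedin Y P'"
      unfolding P_def P'_def using closedin_continuous_map_preimage clo by fastforce+
    moreover have "C - {y} \<subseteq> P \<union> P'"
      using tot[OF C(1)] C(2) CY by (auto simp: total_on_def P_def P'_def)
    moreover have "P \<inter> P' \<inter> (C - {y}) = {}"
      using anti by (auto simp: P_def P'_def dest: antisymD)
    moreover have "a \<in> P \<inter> (C - {y})" "b \<in> P' \<inter> (C - {y})"
      using a b C by (auto simp: P_def P'_def)
    ultimately show False
      using con unfolding connectedin_closedin by blast
  qed
qed

text \<open>Intersecting the given order with the component relation removes comparabilities between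
  components; closedness survives because the component relation is closed.\<close>

lemma smooth_fence_imp_strongly_compatible_order:
  assumes "smooth_fence Y"
  obtains r where "strongly_compatible_order Y r"
proof -
  obtain r where r: "closed_partial_order Y r" "\<And>C. C \<in> connected_components_of Y \<Longrightarrow> total_on C r"
    using assms by (auto simp: smooth_fence_def)
  have "compact_space Y" "Hausdorff_space Y"
    using assms metrizable_imp_Hausdorff_space by (auto simp: smooth_fence_def fence_def)
  define s where "s = r \<inter> {(x, y). connected_component_of Y x y}"
  have clo: "closedin (prod_topology Y Y) s"
    unfolding s_def using r(1) closedin_connected_component_rel[OF \<open>compact_space Y\<close> \<open>Hausdorff_space Y\<close>]
    by (auto simp: closed_partial_order_def)
  have po: "partial_order_on (topspace Y) r"
    using r(1) by (simp add: closed_partial_order_def)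
  have "trans s"
    using po unfolding s_def partial_order_on_def preorder_on_def trans_def
    by (auto intro: connected_component_of_trans)
  moreover have "refl_on (topspace Y) s" "s \<subseteq> topspace Y \<times> topspace Y" "antisym s"
    using po closedin_subset[OF clo]
    by (auto simp: s_def partial_order_on_def preorder_on_def refl_on_def antisym_def connected_component_of_refl)
  ultimately have "partial_order_on (topspace Y) s"
    by (simp add: partial_order_on_def preorder_on_def)
  moreover have tot: "total_on C s" if "C \<in> connected_components_of Y" for C
  proof -
    have "connected_component_of Y x y" if "x \<in> C" "y \<in> C" for x y
      using \<open>C \<in> connected_components_of Y\<close> that
      unfolding connected_component_of_def by (meson connectedin_connected_components_of)
    then show ?thesis
      using r(2)[OF that] by (simp add: total_on_def s_def)
  qed
  moreover have "(x, y) \<in> s \<or> (y, x) \<in> s \<longleftrightarrow> connected_component_of Y x y"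
    if "x \<in> topspace Y" "y \<in> topspace Y" for x y
  proof
    assume "connected_component_of Y x y"
    then have "x \<in> connected_component_of_set Y x" "y \<in> connected_component_of_set Y x"
      "connected_component_of_set Y x \<in> connected_components_of Y"
      using that by (auto simp: connected_component_in_connected_components_of connected_component_of_refl)
    then have "x = y \<or> (x, y) \<in> s \<or> (y, x) \<in> s"
      using tot unfolding total_on_def by blast
    then show "(x, y) \<in> s \<or> (y, x) \<in> s"
      using \<open>refl_on (topspace Y) s\<close> that by (auto simp: refl_on_def)
  qed (auto simp: s_def connected_component_of_sym)
  ultimately show thesis
    using that[of s] clo by (simp add: strongly_compatible_order_def closed_partial_order_def)
qed

section \<open>The quotient as an ordered compact Hausdorff space\<close>

context hasse_limit
begin

abbreviation "q \<equiv> quotient_proj F"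
abbreviation "Q \<equiv> quotient_space F"

lemma q_eq_iff: "x \<in> points_of F \<Longrightarrow> y \<in> points_of F \<Longrightarrow> q x = q y \<longleftrightarrow> (x, y) \<in> rel_of F"
  unfolding quotient_proj_def by (rule eq_equiv_class_iff[OF equiv_rel])

lemma q_image: "q ` points_of F = topspace Q"
  using quotient_map_quotient_proj[of F] by (simp add: quotient_map_def)

lemma continuous_q: "continuous_map (space_of F) Q q"
  using quotient_imp_continuous_map quotient_map_quotient_proj by blast

lemma closed_map_q: "closed_map (space_of F) Q q"
  unfolding closed_map_def
proof (intro allI impI)
  fix C assume C: "closedin (space_of F) C"
  then have sub: "C \<subseteq> points_of F"
    by (rule closedin_subset)
  have "{x \<in> points_of F. q x \<in> q ` C} = rel_of F `` C"
  proof
    show "{x \<in> points_of F. q x \<in> q ` C} \<subseteq> rel_of F `` C"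
    proof clarify
      fix x c assume "x \<in> points_of F" "q x = q c" "c \<in> C"
      then show "x \<in> rel_of F `` C"
        using q_eq_iff[of c x] sub by auto
    qed
    show "rel_of F `` C \<subseteq> {x \<in> points_of F. q x \<in> q ` C}"
      using q_eq_iff sub rel_subset by blast
  qed
  then have "closedin (space_of F) {x \<in> points_of F. q x \<in> q ` C}"
    using closedin_relation_Image[OF compact closed_rel C] by simp
  moreover have "q ` C \<subseteq> topspace Q"
    using sub q_image by blast
  ultimately show "closedin Q (q ` C)"
    using quotient_map_quotient_proj[of F] unfolding quotient_map_closedin by blast
qed

text \<open>The projection is closed and its fibres are compact, so it is a perfect map. Regularity
  passes to perfect images, and points of the quotient are closed as images of closed
  points.\<close>

lemma Hausdorff_quotient: "Hausdorff_space Q"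
proof -
  have t1: "t1_space Q"
    unfolding t1_space_closedin_singleton
  proof
    fix c assume "c \<in> topspace Q"
    then obtain x where x: "x \<in> points_of F" "c = q x"
      using q_image by blast
    then have "closedin (space_of F) {x}"
      by (simp add: Hausdorff closedin_Hausdorff_singleton)
    then show "closedin Q {c}"
      using closed_map_q x unfolding closed_map_def by force
  qed
  have "proper_map (space_of F) Q q"
    unfolding proper_map_def
  proof (intro conjI ballI closed_map_q)
    fix c assume "c \<in> topspace Q"
    then have "closedin Q {c}"
      using t1 by (simp add: t1_space_closedin_singleton)
    then have "closedin (space_of F) {x \<in> points_of F. q x \<in> {c}}"
      by (rule closedin_continuous_map_preimage[OF continuous_q])
    then show "compactin (space_of F) {x \<in> points_of F. q x = c}"
      using closedin_compact_space[OF compact] by simp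
  qed
  then have "perfect_map (space_of F) Q q"
    using continuous_q q_image by (simp add: perfect_map_def)
  then have "regular_space Q"
    using regular_space_perfect_map_image compact_Hausdorff_imp_regular_space compact Hausdorff by blast
  then show ?thesis
    using t1 regular_t1_imp_Hausdorff_space by blast
qed

lemma closed_quotient_le: "closedin (prod_topology Q Q) (quotient_le F)"
proof -
  have "compact_space (prod_topology (space_of F) (space_of F))"
    using compact by (simp add: compact_space_prod_topology)
  then have "compactin (prod_topology (space_of F) (space_of F)) (le_of F)"
    using closed_le closedin_compact_space by blast
  moreover have "continuous_map (prod_topology (space_of F) (space_of F)) (prod_topology Q Q) (\<lambda>p. (q (fst p), q (snd p)))"
    using continuous_map_compose[OF continuous_map_fst continuous_q] continuous_map_compose[OF continuous_map_snd continuous_q]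
    by (intro continuous_map_pairedI) (auto simp: comp_def)
  moreover have "(\<lambda>p. (q (fst p), q (snd p))) = map_prod q q"
    by auto
  ultimately have "compactin (prod_topology Q Q) (quotient_le F)"
    unfolding quotient_le_def using image_compactin by metis
  then show ?thesis
    using Hausdorff_quotient by (simp add: compactin_imp_closedin Hausdorff_space_prod_topology)
qed

lemma quotient_le_cases:
  assumes "(a, b) \<in> quotient_le F"
  obtains x y where "(x, y) \<in> le_of F" "a = q x" "b = q y"
  using assms by (auto simp: quotient_le_def)

lemma antisym_quotient_le: "antisym (quotient_le F)"
proof (rule antisymI)
  fix a b assume "(a, b) \<in> quotient_le F" "(b, a) \<in> quotient_le F"
  then obtain x y y' x' where xy: "(x, y) \<in> le_of F" "a = q x" "b = q y"
    and yx: "(y', x') \<in> le_of F" "b = q y'" "a = q x'"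
    by (auto elim!: quotient_le_cases)
  have pts: "x \<in> points_of F" "y \<in> points_of F" "x' \<in> points_of F" "y' \<in> points_of F"
    using xy yx le_subset by auto
  then have rel: "(x, x') \<in> rel_of F" "(y, y') \<in> rel_of F"
    using xy yx q_eq_iff by metis+
  \<comment> \<open>The two inequalities use different representatives. In any chain forest the
    height of \<open>y\<close> exceeds that of \<open>y'\<close> by at most 1, that of
    \<open>x'\<close> is at least that of \<open>y'\<close>, and that of \<open>x'\<close> exceeds
    that of \<open>x\<close> by at most 1; so \<open>y\<close> is at most 2 above
    \<open>x\<close>.\<close>
  have "(x, y) \<in> rel_of F"
  proof (rule relI_near[OF pts(1,2), of 2])
    fix I lo hi \<psi> assume \<psi>: "epimorphism F (chain_forest I lo hi) \<psi>"
    show "near 2 (\<psi> x) (\<psi> y)"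
      using rel_imp_near[OF \<psi> rel(1)] rel_imp_near[OF \<psi> rel(2)]
        epimorphism_imageD(3)[OF \<psi> xy(1)] epimorphism_imageD(3)[OF \<psi> yx(1)]
      by (auto simp: mem_le_of_chain_forest near_def)
  qed
  then show "a = b"
    using xy pts q_eq_iff by simp
qed

text \<open>Representatives of incomparable classes are incomparable. Two epimorphisms witness the
  two failing inequalities, and a chain forest refining both puts the representatives into different
  chains. The preimage of a chain is clopen and saturated for \<open>R\<close>, since related points
  share a chain, and so it disconnects any set containing both classes.\<close>

lemma connected_imp_quotient_le_comparable:
  assumes S: "connectedin Q S" and ab: "a \<in> S" "b \<in> S"
  shows "(a, b) \<in> quotient_le F \<or> (b, a) \<in> quotient_le F"
proof (rule ccontr)
  assume no: "\<not> ?thesis"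
  have "S \<subseteq> topspace Q"
    using S connectedin_subset_topspace by blast
  then have "a \<in> q ` points_of F" "b \<in> q ` points_of F"
    using ab unfolding q_image by auto
  then obtain w u where wu: "w \<in> points_of F" "u \<in> points_of F" "a = q w" "b = q u"
    by blast
  then have "(w, u) \<notin> le_of F" "(u, w) \<notin> le_of F"
    using no by (auto simp: quotient_le_def rev_image_eqI)
  then obtain A B \<phi> \<psi> where A: "A \<in> finite_hasse_forests" "epimorphism F A \<phi>" "(\<phi> w, \<phi> u) \<notin> le_of A"
    and B: "B \<in> finite_hasse_forests" "epimorphism F B \<psi>" "(\<psi> u, \<psi> w) \<notin> le_of B"
    using separate_le wu by metis
  obtain C \<theta> \<pi> \<rho> where C: "C \<in> finite_hasse_forests" "epimorphism F C \<theta>"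
    "epimorphism C A \<pi>" "\<And>x. x \<in> points_of F \<Longrightarrow> \<phi> x = \<pi> (\<theta> x)"
    "epimorphism C B \<rho>" "\<And>x. x \<in> points_of F \<Longrightarrow> \<psi> x = \<rho> (\<theta> x)"
    using common_refinement[OF A(1,2) B(1,2)] by metis
  obtain I lo hi \<xi> \<sigma> where D: "chain_forest I lo hi \<in> finite_hasse_forests"
    "epimorphism F (chain_forest I lo hi) \<xi>" "epimorphism (chain_forest I lo hi) C \<sigma>"
    "\<And>x. x \<in> points_of F \<Longrightarrow> \<theta> x = \<sigma> (\<xi> x)"
    using refine_by_separated_chains[OF C(1,2)] by metis
  have "(\<xi> w, \<xi> u) \<notin> le_of (chain_forest I lo hi)" "(\<xi> u, \<xi> w) \<notin> le_of (chain_forest I lo hi)"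
    using epimorphism_imageD(3)[OF C(3) epimorphism_imageD(3)[OF D(3)]]
      epimorphism_imageD(3)[OF C(5) epimorphism_imageD(3)[OF D(3)]] A(3) B(3) C(4,6) D(4) wu by metis+
  then have neq: "fst (prod_decode (\<xi> w)) \<noteq> fst (prod_decode (\<xi> u))"
    using epimorphism_imageD(1)[OF D(2)] wu by (auto simp: mem_le_of_chain_forest)
  define K where "K = {x \<in> points_of F. \<xi> x \<in> {z. fst (prod_decode z) = fst (prod_decode (\<xi> w))}}"
  have K: "openin (space_of F) K" "closedin (space_of F) K"
    unfolding K_def by (rule clopen_preimage[OF D(1,2)])+
  have sat: "{x \<in> points_of F. q x \<in> q ` K} = K"
  proof
    show "{x \<in> points_of F. q x \<in> q ` K} \<subseteq> K"
    proof clarify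
      fix x y assume xy: "x \<in> points_of F" "q x = q y" "y \<in> K"
      then have "(x, y) \<in> rel_of F"
        using q_eq_iff by (simp add: K_def)
      then have "near 1 (\<xi> x) (\<xi> y)"
        by (rule rel_imp_near[OF D(2)])
      then show "x \<in> K"
        using xy by (simp add: K_def near_def)
    qed
  qed (auto simp: K_def)
  have sub: "q ` K \<subseteq> topspace Q"
    using q_image by (auto simp: K_def)
  have "openin (space_of F) {x \<in> points_of F. q x \<in> V} \<longleftrightarrow> openin Q V" if "V \<subseteq> topspace Q" for V
    using quotient_map_quotient_proj[of F] that unfolding quotient_map_def by blast
  from this[OF sub] have "openin Q (q ` K)"
    using K(1) sat by simp
  moreover have "closedin Q (q ` K)"
    using K(2) closed_map_q unfolding closed_map_def by blast
  ultimately have "S \<subseteq> q ` K \<or> disjnt S (q ` K)"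
    using connectedin_clopen_cases[OF S] by blast
  moreover have "a \<in> q ` K"
    using wu by (auto simp: K_def)
  ultimately have "q u \<in> q ` K"
    using ab wu by (auto simp: disjnt_iff)
  then have "u \<in> K"
    using sat wu by blast
  then show False
    using neq by (simp add: K_def)
qed

lemma quotient_extremal_points_subset_endpoints:
  "minimal_points Q (quotient_le F) \<subseteq> endpoints Q" "maximal_points Q (quotient_le F) \<subseteq> endpoints Q"
proof -
  show "minimal_points Q (quotient_le F) \<subseteq> endpoints Q"
    using closed_quotient_le antisym_quotient_le connected_imp_quotient_le_comparable
    by (rule minimal_points_subset_endpoints)
  show "maximal_points Q (quotient_le F) \<subseteq> endpoints Q"
    unfolding maximal_points_converse
  proof (rule minimal_points_subset_endpoints)
    show "closedin (prod_topology Q Q) ((quotient_le F)\<inverse>)"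
      by (rule closedin_converse[OF closed_quotient_le])
    show "antisym ((quotient_le F)\<inverse>)"
      using antisym_quotient_le by simp
  qed (use connected_imp_quotient_le_comparable in auto)
qed

end

section \<open>Embedding fences\<close>

lemma div_le_div_add: "z \<le> z' + d \<Longrightarrow> 0 < m \<Longrightarrow> z div m \<le> z' div m + d" for z z' d m :: nat
proof -
  assume "z \<le> z' + d" "0 < m"
  then have "z \<le> z' + d * m"
    by (cases m) auto
  then have "z div m \<le> (z' + d * m) div m"
    by (rule div_le_mono)
  then show ?thesis
    using \<open>0 < m\<close> by simp
qed

context hasse_limit
begin

text \<open>A triangle inequality along a chain: every height between those of two points is
  attained by some point of \<open>F\<close>, so larger distances are bridged by steps of length 1.
  This is needed because a stage is built with control on distance 1 alone, whereas detecting
  \<open>R\<close> later requires distance 2.\<close>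

lemma near_1_imp_near:
  assumes \<phi>: "epimorphism F (chain_forest I lo hi) \<phi>"
    and *: "\<And>w u. w \<in> points_of F \<Longrightarrow> u \<in> points_of F \<Longrightarrow> near 1 (\<phi> w) (\<phi> u) \<Longrightarrow> near 1 (\<eta> w) (\<eta> u)"
    and "w \<in> points_of F" "u \<in> points_of F" "near (Suc d) (\<phi> w) (\<phi> u)"
  shows "near (Suc d) (\<eta> w) (\<eta> u)"
  using assms(4,5)
proof (induction d arbitrary: u)
  case 0
  then show ?case
    using * assms(3) by simp
next
  case (Suc d)
  obtain i z where w: "\<phi> w = prod_encode (i, z)" "i \<in> I" "lo i \<le> z" "z \<le> hi i"
    using epimorphism_imageD(1)[OF \<phi> assms(3)] by (rule points_of_chain_forestE)
  obtain j z' where u: "\<phi> u = prod_encode (j, z')" "j \<in> I" "lo j \<le> z'" "z' \<le> hi j"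
    using epimorphism_imageD(1)[OF \<phi> Suc.prems(1)] by (rule points_of_chain_forestE)
  have ij: "j = i" "z \<le> z' + Suc (Suc d)" "z' \<le> z + Suc (Suc d)"
    using Suc.prems w u by auto
  \<comment> \<open>The height one step from \<open>z'\<close> towards \<open>z\<close>, or
    \<open>z'\<close> itself if the two are equal.\<close>
  define m where "m = (if z < z' then z' - 1 else if z' < z then Suc z' else z')"
  have m: "lo i \<le> m" "m \<le> hi i" "z \<le> m + Suc d" "m \<le> z + Suc d" "m \<le> z' + 1" "z' \<le> m + 1"
    using w u ij by (auto simp: m_def)
  have "prod_encode (i, m) \<in> \<phi> ` points_of F"
    using \<phi> w m by (simp add: epimorphism_def)
  then obtain v where v: "v \<in> points_of F" "\<phi> v = prod_encode (i, m)"
    by auto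
  have "near (Suc d) (\<eta> w) (\<eta> v)"
    using Suc.IH[OF v(1)] w v m by simp
  moreover have "near 1 (\<eta> v) (\<eta> u)"
    using *[OF v(1) Suc.prems(1)] u v m ij by simp
  ultimately show ?case
    using near_trans[of "Suc d" _ _ 1] by simp
qed

text \<open>Dependent choice along \<open>refine_with_fence_chains\<close>. Stage
  \<open>Suc n\<close> absorbs \<open>\<eta> n\<close>, so the sequence \<open>\<phi>\<close>
  inherits from \<open>\<eta>\<close> the power to detect \<open>R\<close>.\<close>

lemma fence_approximations:
  fixes h :: "'b \<Rightarrow> real" and c :: "nat \<Rightarrow> 'b \<Rightarrow> nat"
  assumes h: "\<forall>y\<in>T. h y \<in> {0..1}" and fin: "\<And>n. finite (c n ` T)"
    and c: "\<And>n. \<forall>y\<in>T. \<forall>y'\<in>T. c (Suc n) y = c (Suc n) y' \<longrightarrow> c n y = c n y'"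
  obtains E I lo hi \<phi> D where
    "\<forall>n. chain_forest (I n) (lo n) (hi n) \<in> finite_hasse_forests"
    "\<forall>n. epimorphism F (chain_forest (I n) (lo n) (hi n)) (\<phi> n)"
    "\<forall>n. \<forall>y\<in>T. 2 * c n y \<in> I n \<and> lo n (2 * c n y) \<le> cell (E n) (h y) \<and> cell (E n) (h y) \<le> hi n (2 * c n y)"
    "\<forall>n. \<forall>y\<in>T. \<exists>y'\<in>T. c n y' = c n y \<and> lo n (2 * c n y) = cell (E n) (h y')"
    "\<forall>n. \<forall>y\<in>T. \<exists>y'\<in>T. c n y' = c n y \<and> hi n (2 * c n y) = cell (E n) (h y')"
    "\<forall>w\<in>points_of F. \<forall>u\<in>points_of F. (\<forall>n. near (Suc d) (\<phi> n w) (\<phi> n u)) \<longrightarrow> (w, u) \<in> rel_of F"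
    "\<forall>n. \<forall>w\<in>points_of F. \<forall>y\<in>T. \<forall>z. \<phi> (Suc n) w = prod_encode (2 * c (Suc n) y, z) \<longrightarrow>
      \<phi> n w = prod_encode (2 * c n y, z div D n)"
    "\<forall>n. 2 \<le> D n \<and> E (Suc n) = E n * D n" "0 < E 0"
proof -
  obtain I\<^sub>0 :: "nat \<Rightarrow> nat set" and lo\<^sub>0 hi\<^sub>0 \<eta> where \<eta>: "\<forall>n. chain_forest (I\<^sub>0 n) (lo\<^sub>0 n) (hi\<^sub>0 n) \<in> finite_hasse_forests"
    "\<forall>n. epimorphism F (chain_forest (I\<^sub>0 n) (lo\<^sub>0 n) (hi\<^sub>0 n)) (\<eta> n)"
    "\<forall>w\<in>points_of F. \<forall>u\<in>points_of F. (\<forall>n. near (Suc d) (\<eta> n w) (\<eta> n u)) \<longrightarrow> (w, u) \<in> rel_of F"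
    by (rule separating_sequence[where d = "Suc d"])
  define good where "good n st \<longleftrightarrow> (case st of (E, I, lo, hi, \<phi>) \<Rightarrow> 0 < E \<and>
      chain_forest I lo hi \<in> finite_hasse_forests \<and> epimorphism F (chain_forest I lo hi) \<phi> \<and>
      (\<forall>y\<in>T. 2 * c n y \<in> I \<and> lo (2 * c n y) \<le> cell E (h y) \<and> cell E (h y) \<le> hi (2 * c n y)) \<and>
      (\<forall>y\<in>T. \<exists>y'\<in>T. c n y' = c n y \<and> lo (2 * c n y) = cell E (h y')) \<and>
      (\<forall>y\<in>T. \<exists>y'\<in>T. c n y' = c n y \<and> hi (2 * c n y) = cell E (h y')))"
    for n :: nat and st :: "nat \<times> nat set \<times> (nat \<Rightarrow> nat) \<times> (nat \<Rightarrow> nat) \<times> ('a \<Rightarrow> nat)"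
  define succ where "succ n st st' \<longleftrightarrow> (case st of (E, I, lo, hi, \<phi>) \<Rightarrow> case st' of (E', I', lo', hi', \<phi>') \<Rightarrow>
      (\<forall>w\<in>points_of F. \<forall>u\<in>points_of F. near 1 (\<phi>' w) (\<phi>' u) \<longrightarrow> near 1 (\<eta> n w) (\<eta> n u)) \<and>
      (\<exists>D\<ge>2. E' = E * D \<and> (\<forall>w\<in>points_of F. \<forall>y\<in>T. \<forall>z. \<phi>' w = prod_encode (2 * c (Suc n) y, z) \<longrightarrow>
        \<phi> w = prod_encode (2 * c n y, z div D))))"
    for n :: nat and st st' :: "nat \<times> nat set \<times> (nat \<Rightarrow> nat) \<times> (nat \<Rightarrow> nat) \<times> ('a \<Rightarrow> nat)"
  have "\<exists>st. \<forall>n. good n (st n) \<and> succ n (st n) (st (Suc n))"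
  proof (rule dependent_nat_choice)
    \<comment> \<open>The start is a single piece with the grid of mesh 1, whose cells 0 and 1 form
      a chain of two points. It is refined once, because only a refinement guarantees that the ends
      of a chain are cells of points of its piece.\<close>
    have C: "chain_forest {0} (\<lambda>_. 0) (\<lambda>_. 1) \<in> finite_hasse_forests"
      by (rule chain_forest_in_finite_hasse_forests) auto
    then obtain \<phi> where \<phi>: "epimorphism F (chain_forest {0} (\<lambda>_. 0) (\<lambda>_. 1)) \<phi>"
      using epimorphism_exists by blast
    have range: "\<forall>y\<in>T. 2 * 0 \<in> {0::nat} \<and> 0 \<le> cell 1 (h y) \<and> cell 1 (h y) \<le> 1"
      using cell_le[of _ 1] h by simp
    have const: "\<forall>y\<in>T. \<forall>y'\<in>T. c 0 y = c 0 y' \<longrightarrow> (0::nat) = 0"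
      by simp
    obtain D I' lo' hi' \<phi>' where "2 \<le> D" "chain_forest I' lo' hi' \<in> finite_hasse_forests"
      "epimorphism F (chain_forest I' lo' hi') \<phi>'"
      "\<forall>y\<in>T. 2 * c 0 y \<in> I' \<and> lo' (2 * c 0 y) \<le> cell (1 * D) (h y) \<and> cell (1 * D) (h y) \<le> hi' (2 * c 0 y)"
      "\<forall>y\<in>T. \<exists>y'\<in>T. c 0 y' = c 0 y \<and> lo' (2 * c 0 y) = cell (1 * D) (h y')"
      "\<forall>y\<in>T. \<exists>y'\<in>T. c 0 y' = c 0 y \<and> hi' (2 * c 0 y) = cell (1 * D) (h y')"
      "\<forall>w\<in>points_of F. \<forall>u\<in>points_of F. near 1 (\<phi>' w) (\<phi>' u) \<longrightarrow>
        (\<eta> 0 w, \<eta> 0 u) \<in> rel_of (chain_forest (I\<^sub>0 0) (lo\<^sub>0 0) (hi\<^sub>0 0))"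
      "\<forall>w\<in>points_of F. \<forall>y\<in>T. \<forall>z. \<phi>' w = prod_encode (2 * c 0 y, z) \<longrightarrow>
        \<phi> w = prod_encode (2 * 0, z div D)"
      by (rule refine_with_fence_chains[where c = "\<lambda>_. 0" and c' = "c 0" and E = 1 and T = T and h = h,
          OF spec[OF \<eta>(1), of 0] spec[OF \<eta>(2), of 0] C \<phi> h range fin const])
    then have "good 0 (D, I', lo', hi', \<phi>')"
      by (simp add: good_def)
    then show "\<exists>st. good 0 st" by blast
  next
    fix st n assume "good n st"
    obtain E I lo hi \<phi> where st: "st = (E, I, lo, hi, \<phi>)"
      by (cases st)
    have g: "0 < E" "chain_forest I lo hi \<in> finite_hasse_forests" "epimorphism F (chain_forest I lo hi) \<phi>"
      "\<forall>y\<in>T. 2 * c n y \<in> I \<and> lo (2 * c n y) \<le> cell E (h y) \<and> cell E (h y) \<le> hi (2 * c n y)"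
      using \<open>good n st\<close> by (auto simp: good_def st)
    obtain D I' lo' hi' \<phi>' where *: "2 \<le> D" "chain_forest I' lo' hi' \<in> finite_hasse_forests"
      "epimorphism F (chain_forest I' lo' hi') \<phi>'"
      "\<forall>y\<in>T. 2 * c (Suc n) y \<in> I' \<and> lo' (2 * c (Suc n) y) \<le> cell (E * D) (h y) \<and> cell (E * D) (h y) \<le> hi' (2 * c (Suc n) y)"
      "\<forall>y\<in>T. \<exists>y'\<in>T. c (Suc n) y' = c (Suc n) y \<and> lo' (2 * c (Suc n) y) = cell (E * D) (h y')"
      "\<forall>y\<in>T. \<exists>y'\<in>T. c (Suc n) y' = c (Suc n) y \<and> hi' (2 * c (Suc n) y) = cell (E * D) (h y')"
      "\<forall>w\<in>points_of F. \<forall>u\<in>points_of F. near 1 (\<phi>' w) (\<phi>' u) \<longrightarrow>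
        (\<eta> n w, \<eta> n u) \<in> rel_of (chain_forest (I\<^sub>0 n) (lo\<^sub>0 n) (hi\<^sub>0 n))"
      "\<forall>w\<in>points_of F. \<forall>y\<in>T. \<forall>z. \<phi>' w = prod_encode (2 * c (Suc n) y, z) \<longrightarrow>
        \<phi> w = prod_encode (2 * c n y, z div D)"
      by (rule refine_with_fence_chains[where c = "c n" and c' = "c (Suc n)" and E = E and T = T and h = h,
          OF spec[OF \<eta>(1), of n] spec[OF \<eta>(2), of n] g(2,3) h g(4) fin c])
    have "good (Suc n) (E * D, I', lo', hi', \<phi>')"
      using *(1-6) g(1) by (simp add: good_def)
    moreover have "succ n st (E * D, I', lo', hi', \<phi>')"
      unfolding succ_def st using *(1,7,8) by (auto simp: mem_rel_of_chain_forest)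
    ultimately show "\<exists>st'. good (Suc n) st' \<and> succ n st st'"
      by blast
  qed
  then obtain st where st: "\<And>n. good n (st n)" "\<And>n. succ n (st n) (st (Suc n))"
    by blast
  define E where "E n = fst (st n)" for n
  define I where "I n = fst (snd (st n))" for n
  define lo where "lo n = fst (snd (snd (st n)))" for n
  define hi where "hi n = fst (snd (snd (snd (st n))))" for n
  define \<phi> where "\<phi> n = snd (snd (snd (snd (st n))))" for n
  have st_eq: "st n = (E n, I n, lo n, hi n, \<phi> n)" for n
    by (simp add: E_def I_def lo_def hi_def \<phi>_def)
  have good: "0 < E n \<and> chain_forest (I n) (lo n) (hi n) \<in> finite_hasse_forests \<and>
      epimorphism F (chain_forest (I n) (lo n) (hi n)) (\<phi> n) \<and>
      (\<forall>y\<in>T. 2 * c n y \<in> I n \<and> lo n (2 * c n y) \<le> cell (E n) (h y) \<and> cell (E n) (h y) \<le> hi n (2 * c n y)) \<and>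
      (\<forall>y\<in>T. \<exists>y'\<in>T. c n y' = c n y \<and> lo n (2 * c n y) = cell (E n) (h y')) \<and>
      (\<forall>y\<in>T. \<exists>y'\<in>T. c n y' = c n y \<and> hi n (2 * c n y) = cell (E n) (h y'))" for n
    using st(1)[of n] unfolding good_def st_eq split_conv .
  have nxt: "(\<forall>w\<in>points_of F. \<forall>u\<in>points_of F. near 1 (\<phi> (Suc n) w) (\<phi> (Suc n) u) \<longrightarrow> near 1 (\<eta> n w) (\<eta> n u)) \<and>
      (\<exists>D\<ge>2. E (Suc n) = E n * D \<and> (\<forall>w\<in>points_of F. \<forall>y\<in>T. \<forall>z. \<phi> (Suc n) w = prod_encode (2 * c (Suc n) y, z) \<longrightarrow>
        \<phi> n w = prod_encode (2 * c n y, z div D)))" for n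
    using st(2)[of n] unfolding succ_def st_eq split_conv .
  then obtain D where D: "\<And>n. 2 \<le> D n \<and> E (Suc n) = E n * D n \<and> (\<forall>w\<in>points_of F. \<forall>y\<in>T. \<forall>z.
      \<phi> (Suc n) w = prod_encode (2 * c (Suc n) y, z) \<longrightarrow> \<phi> n w = prod_encode (2 * c n y, z div D n))"
    by metis
  have rel: "\<forall>w\<in>points_of F. \<forall>u\<in>points_of F. (\<forall>n. near (Suc d) (\<phi> n w) (\<phi> n u)) \<longrightarrow> (w, u) \<in> rel_of F"
  proof (intro ballI impI)
    fix w u assume wu: "w \<in> points_of F" "u \<in> points_of F" "\<forall>n. near (Suc d) (\<phi> n w) (\<phi> n u)"
    have "near (Suc d) (\<eta> n w) (\<eta> n u)" for n
      using near_1_imp_near[of "I (Suc n)" "lo (Suc n)" "hi (Suc n)" "\<phi> (Suc n)" "\<eta> n" w u d] good[of "Suc n"] nxt[of n] wu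
      by simp
    then show "(w, u) \<in> rel_of F"
      using \<eta>(3) wu by blast
  qed
  show thesis
  proof (rule that[where E = E and D = D, OF _ _ _ _ _ rel])
    show "\<forall>n. chain_forest (I n) (lo n) (hi n) \<in> finite_hasse_forests"
      "\<forall>n. epimorphism F (chain_forest (I n) (lo n) (hi n)) (\<phi> n)"
      using good by blast+
  qed (use good D in blast)+
qed

end

text \<open>The binary digits of \<open>c n y\<close> record which of the first \<open>n\<close>
  separating clopen sets contain \<open>y\<close>; hence the pieces are finitely many, clopen and
  successively finer.\<close>

lemma clopen_pieces:
  assumes "compact_space Y" "metrizable_space Y"
  obtains c :: "nat \<Rightarrow> 'b \<Rightarrow> nat" where "\<forall>n. finite (range (c n))"
    "\<forall>n y y'. c (Suc n) y = c (Suc n) y' \<longrightarrow> c n y = c n y'"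
    "\<forall>n i. openin Y {y \<in> topspace Y. c n y = i} \<and> closedin Y {y \<in> topspace Y. c n y = i}"
    "\<forall>y\<in>topspace Y. \<forall>y'\<in>topspace Y. (\<forall>n. c n y = c n y') \<longrightarrow> connected_component_of Y y y'"
proof -
  have Haus: "Hausdorff_space Y"
    using assms metrizable_imp_Hausdorff_space by blast
  let ?YY = "prod_topology Y Y"
  define P where "P U \<longleftrightarrow> openin Y U \<and> closedin Y U" for U
  have cmp: "compact_space ?YY" "metrizable_space ?YY"
    using assms by (auto simp: compact_space_prod_topology metrizable_space_prod_topology)
  have op: "openin ?YY (U \<times> (topspace Y - U))" if "P U" for U
    using that by (auto simp: P_def openin_prod_Times_iff)
  have cover: "\<exists>U. P U \<and> p \<in> U \<times> (topspace Y - U)"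
    if p: "p \<in> topspace ?YY - {(x, y). connected_component_of Y x y}" for p
  proof -
    obtain x y where xy: "p = (x, y)"
      by (cases p)
    with p have "x \<in> topspace Y" "y \<in> topspace Y" "\<not> connected_component_of Y x y"
      by auto
    then obtain U where "openin Y U" "closedin Y U" "x \<in> U" "y \<notin> U"
      by (rule separate_connected_components[OF assms(1) Haus])
    then show ?thesis
      using xy \<open>y \<in> topspace Y\<close> by (auto simp: P_def)
  qed
  have "P {}"
    by (simp add: P_def)
  obtain K :: "nat \<Rightarrow> 'b set" where K: "\<And>n. P (K n)"
    and sep: "\<And>p. p \<in> topspace ?YY - {(x, y). connected_component_of Y x y} \<Longrightarrow> \<exists>n. p \<in> K n \<times> (topspace Y - K n)"
    using countable_subcover_of_open_complement[where P = P and W = "\<lambda>U. U \<times> (topspace Y - U)",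
        OF cmp closedin_connected_component_rel[OF assms(1) Haus] op cover \<open>P {}\<close>] by blast
  define c where "c = rec_nat (\<lambda>_::'b. 0::nat) (\<lambda>n f y. 2 * f y + of_bool (y \<in> K n))"
  have c0: "c 0 y = 0" and cS: "c (Suc n) y = 2 * c n y + of_bool (y \<in> K n)" for n y
    by (simp_all add: c_def)
  have cS_eq: "c (Suc n) y = c (Suc n) y' \<longleftrightarrow> c n y = c n y' \<and> (y \<in> K n \<longleftrightarrow> y' \<in> K n)" for n y y'
    unfolding cS by (cases "y \<in> K n"; cases "y' \<in> K n") (auto, presburger+)
  have clopen: "openin Y {y \<in> topspace Y. c n y = i} \<and> closedin Y {y \<in> topspace Y. c n y = i}" for n i
  proof (induction n arbitrary: i)
    case 0
    then show ?case
      by (cases "i = 0") (auto simp: c0)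
  next
    case (Suc n)
    have "{y \<in> topspace Y. c (Suc n) y = i} =
      (if even i then {y \<in> topspace Y. c n y = i div 2} - K n else {y \<in> topspace Y. c n y = i div 2} \<inter> K n)"
      by (auto simp: cS split: if_splits)
    moreover have "openin Y (K n)" "closedin Y (K n)"
      using K by (auto simp: P_def)
    ultimately show ?case
      using Suc[of "i div 2"] by (simp add: openin_diff closedin_diff openin_Int closedin_Int)
  qed
  have "c n y < 2 ^ n" for n y
    by (induction n) (auto simp: c0 cS)
  then have "range (c n) \<subseteq> {..<2 ^ n}" for n
    by auto
  then have "finite (range (c n))" for n
    by (rule finite_subset) simp
  moreover have "connected_component_of Y y y'"
    if yy: "y \<in> topspace Y" "y' \<in> topspace Y" "\<forall>n. c n y = c n y'" for y y'
  proof (rule ccontr)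
    assume "\<not> ?thesis"
    then obtain n where "y \<in> K n" "y' \<notin> K n"
      using sep[of "(y, y')"] yy(1,2) by auto
    then show False
      using yy(3) cS_eq by blast
  qed
  ultimately show thesis
    using that[of c] cS_eq clopen by blast
qed

context hasse_limit
begin

lemma fence_embedding:
  assumes fence: "fence Y" and r: "strongly_compatible_order Y r"
  obtains f where "embedding_map Y Q f"
    "f ` minimal_points Y r \<subseteq> minimal_points Q (quotient_le F)"
    "f ` maximal_points Y r \<subseteq> maximal_points Q (quotient_le F)"
proof -
  define T where "T = topspace Y"
  have cptY: "compact_space Y" and metY: "metrizable_space Y"
    using fence by (auto simp: fence_def)
  have cpo: "closed_partial_order Y r"
    and comp: "\<And>x y. x \<in> T \<Longrightarrow> y \<in> T \<Longrightarrow> (x, y) \<in> r \<or> (y, x) \<in> r \<longleftrightarrow> connected_component_of Y x y"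
    using r by (auto simp: strongly_compatible_order_def T_def)
  obtain h where conth: "continuous_map Y euclideanreal h" and h01: "\<And>a. h a \<in> {0..1}"
    and hmono: "\<And>a b. (a, b) \<in> r \<Longrightarrow> h a \<le> h b" and hstrict: "\<And>a b. (a, b) \<in> r \<Longrightarrow> a \<noteq> b \<Longrightarrow> h a < h b"
    using strictly_monotone_function[OF cptY metY cpo] by metis
  obtain c :: "nat \<Rightarrow> 'b \<Rightarrow> nat" where fin: "\<forall>n. finite (range (c n))"
    and cS: "\<forall>n y y'. c (Suc n) y = c (Suc n) y' \<longrightarrow> c n y = c n y'"
    and cclopen: "\<forall>n i. openin Y {y \<in> topspace Y. c n y = i} \<and> closedin Y {y \<in> topspace Y. c n y = i}"
    and csep: "\<forall>y\<in>topspace Y. \<forall>y'\<in>topspace Y. (\<forall>n. c n y = c n y') \<longrightarrow> connected_component_of Y y y'"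
    by (rule clopen_pieces[OF cptY metY])
  have h_T: "\<forall>y\<in>T. h y \<in> {0..1}"
    using h01 by blast
  have fin_T: "\<And>n. finite (c n ` T)"
    using fin by (meson finite_subset image_mono subset_UNIV)
  have cS_T: "\<And>n. \<forall>y\<in>T. \<forall>y'\<in>T. c (Suc n) y = c (Suc n) y' \<longrightarrow> c n y = c n y'"
    using cS by blast
  \<comment> \<open>The value \<open>d = 1\<close> means that \<open>R\<close> is detected at
    distance 2, the error that \<open>squeeze\<close> leaves below.\<close>
  obtain E I lo hi \<phi> D where
    chain: "\<forall>n. chain_forest (I n) (lo n) (hi n) \<in> finite_hasse_forests" and
    epi: "\<forall>n. epimorphism F (chain_forest (I n) (lo n) (hi n)) (\<phi> n)" and
    inside: "\<forall>n. \<forall>y\<in>T. 2 * c n y \<in> I n \<and> lo n (2 * c n y) \<le> cell (E n) (h y) \<and> cell (E n) (h y) \<le> hi n (2 * c n y)" and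
    lo: "\<forall>n. \<forall>y\<in>T. \<exists>y'\<in>T. c n y' = c n y \<and> lo n (2 * c n y) = cell (E n) (h y')" and
    hi: "\<forall>n. \<forall>y\<in>T. \<exists>y'\<in>T. c n y' = c n y \<and> hi n (2 * c n y) = cell (E n) (h y')" and
    near_rel: "\<forall>w\<in>points_of F. \<forall>u\<in>points_of F. (\<forall>n. near (Suc 1) (\<phi> n w) (\<phi> n u)) \<longrightarrow> (w, u) \<in> rel_of F" and
    down: "\<forall>n. \<forall>w\<in>points_of F. \<forall>y\<in>T. \<forall>z. \<phi> (Suc n) w = prod_encode (2 * c (Suc n) y, z) \<longrightarrow>
      \<phi> n w = prod_encode (2 * c n y, z div D n)" and
    D: "\<forall>n. 2 \<le> D n \<and> E (Suc n) = E n * D n" and E0: "0 < E 0"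
    by (rule fence_approximations[where d = 1 and T = T and h = h and c = c, OF h_T fin_T cS_T])
  have E_ge: "2 ^ n \<le> E n" for n
  proof (induction n)
    case (Suc n)
    then have "2 ^ n * 2 \<le> E n * D n"
      using D by (intro mult_le_mono) auto
    then show ?case
      using D by (simp add: mult.commute)
  qed (use E0 in simp)
  then have E_pos: "0 < E n" for n
    by (metis less_le_trans zero_less_numeral zero_less_power)
  then have E_inv_pos: "0 < 1 / real (E n)" for n
    by simp
  have h0: "0 \<le> h y" for y
    using h01[of y] by simp

  define pos where "pos n y = prod_encode (2 * c n y, cell (E n) (h y))" for n y
  define S where "S y n = {w \<in> points_of F. \<phi> n w \<in> {pos n y}}" for y n
  have pos_near: "near d (pos n y) (pos n y') \<longleftrightarrow> c n y = c n y' \<and>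
      cell (E n) (h y) \<le> cell (E n) (h y') + d \<and> cell (E n) (h y') \<le> cell (E n) (h y) + d" for d n y y'
    by (simp add: pos_def)
  \<comment> \<open>At each stage the position of \<open>y\<close> is a point of the forest, hence
    has a nonempty clopen fibre. The fibres are nested because \<open>down\<close> divides heights
    exactly as passing to the coarser grid does, so compactness yields a common point.\<close>
  have "\<exists>u\<in>points_of F. \<forall>n. \<phi> n u = pos n y" if y: "y \<in> T" for y
  proof -
    have "closedin (space_of F) (S y n)" for n
      unfolding S_def using clopen_preimage(2) chain epi by blast
    moreover have "S y n \<noteq> {}" for n
    proof -
      have "pos n y \<in> points_of (chain_forest (I n) (lo n) (hi n))"
        using inside y by (simp add: pos_def)
      also have "\<dots> = \<phi> n ` points_of F"
        using epi by (simp add: epimorphism_def)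
      finally show ?thesis
        by (auto simp: S_def)
    qed
    moreover have "decseq (S y)"
    proof (rule decseq_SucI)
      fix n
      have "cell (E (Suc n)) (h y) div D n = cell (E n) (h y)"
        using D[rule_format, of n] cell_mult_div[OF h0, of "D n" "E n" y] by simp
      then show "S y (Suc n) \<subseteq> S y n"
        using down y by (auto simp: S_def pos_def)
    qed
    ultimately have "(\<Inter>n. S y n) \<noteq> {}"
      by (rule compact_space_imp_nest[OF compact])
    then show ?thesis
      by (auto simp: S_def)
  qed
  then obtain u where u: "\<And>y. y \<in> T \<Longrightarrow> u y \<in> points_of F" "\<And>y n. y \<in> T \<Longrightarrow> \<phi> n (u y) = pos n y"
    by metis
  define f where "f y = q (u y)" for y
  have rel_near: "near 1 (\<phi> n w) (\<phi> n v)" if "(w, v) \<in> rel_of F" for n w v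
    using rel_imp_near epi that by blast
  have rel_if_near: "(w, v) \<in> rel_of F" if "w \<in> points_of F" "v \<in> points_of F" "\<And>n. near 2 (\<phi> n w) (\<phi> n v)" for w v
    using near_rel that by (simp add: numeral_2_eq_2)

  have contf: "continuous_map Y Q f"
    unfolding continuous_map_def
  proof (intro conjI allI impI)
    show "f \<in> topspace Y \<rightarrow> topspace Q"
      using u(1) q_image by (auto simp: f_def T_def)
    fix V assume V: "openin Q V"
    define K where "K = points_of F - {x \<in> points_of F. q x \<in> V}"
    have K: "closedin (space_of F) K"
      unfolding K_def using openin_continuous_map_preimage[OF continuous_q V] by blast
    show "openin Y {y \<in> topspace Y. f y \<in> V}"
    proof (subst openin_subopen, intro ballI)
      fix y\<^sub>0 assume "y\<^sub>0 \<in> {y \<in> topspace Y. f y \<in> V}"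
      then have y\<^sub>0: "y\<^sub>0 \<in> T" "f y\<^sub>0 \<in> V"
        by (auto simp: T_def)
      \<comment> \<open>The margin of one step in \<open>N n\<close> allows for points near
        \<open>y\<^sub>0\<close> that fall into an adjacent cell. A point in all \<open>N n\<close>
        would be \<open>R\<close>-related to \<open>u y\<^sub>0\<close> while its class is outside
        \<open>V\<close>; so by compactness one stage already decides.\<close>
      define N where "N n = K \<inter> {w \<in> points_of F. \<phi> n w \<in> {x. near 1 x (pos n y\<^sub>0)}}" for n
      have "\<exists>n. N n = {}"
      proof (rule ccontr)
        assume ne: "\<nexists>n. N n = {}"
        have "closedin (space_of F) (N n)" for n
          unfolding N_def using clopen_preimage(2) chain epi K by blast
        moreover have "decseq N"
        proof (rule decseq_SucI)
          fix n
          have eq: "cell (E (Suc n)) (h y\<^sub>0) div D n = cell (E n) (h y\<^sub>0)" and "0 < D n"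
            using D[rule_format, of n] cell_mult_div[OF h0, of "D n" "E n" y\<^sub>0] by simp_all
          have "near 1 (\<phi> n w) (pos n y\<^sub>0)" if w: "w \<in> points_of F" "near 1 (\<phi> (Suc n) w) (pos (Suc n) y\<^sub>0)" for w
          proof -
            obtain i z where z: "\<phi> (Suc n) w = prod_encode (i, z)"
              by (metis prod_decode_inverse surj_pair)
            then have "i = 2 * c (Suc n) y\<^sub>0" "z \<le> cell (E (Suc n)) (h y\<^sub>0) + 1" "cell (E (Suc n)) (h y\<^sub>0) \<le> z + 1"
              using w by (auto simp: pos_def)
            moreover from this have "\<phi> n w = prod_encode (2 * c n y\<^sub>0, z div D n)"
              using down w y\<^sub>0 z by blast
            ultimately show ?thesis
              using div_le_div_add[OF _ \<open>0 < D n\<close>, of z "cell (E (Suc n)) (h y\<^sub>0)" 1]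
                div_le_div_add[OF _ \<open>0 < D n\<close>, of "cell (E (Suc n)) (h y\<^sub>0)" z 1] eq by (simp add: pos_def)
          qed
          then show "N (Suc n) \<subseteq> N n"
            by (auto simp: N_def)
        qed
        ultimately have "(\<Inter>n. N n) \<noteq> {}"
          using ne by (intro compact_space_imp_nest[OF compact]) auto
        then obtain w where w: "w \<in> K" "\<And>n. near 1 (\<phi> n w) (pos n y\<^sub>0)"
          by (auto simp: N_def)
        then have "w \<in> points_of F" "q w \<notin> V"
          by (auto simp: K_def)
        moreover have "(w, u y\<^sub>0) \<in> rel_of F"
          using rel_if_near[of w "u y\<^sub>0"] u y\<^sub>0 w near_mono[of 1 _ _ 2] calculation by simp
        ultimately show False
          using q_eq_iff[of w "u y\<^sub>0"] u(1)[of y\<^sub>0] y\<^sub>0 by (simp add: f_def)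
      qed
      then obtain n where n: "N n = {}" by blast
      \<comment> \<open>With this radius the heights scaled by \<open>E n\<close> differ by less
        than 1, so the cell numbers differ by at most 1.\<close>
      define W where "W = {y \<in> topspace Y. c n y = c n y\<^sub>0} \<inter>
        {y \<in> topspace Y. h y \<in> {h y\<^sub>0 - 1 / real (E n)<..<h y\<^sub>0 + 1 / real (E n)}}"
      have "openin Y W"
        unfolding W_def
        by (intro openin_Int openin_continuous_map_preimage[OF conth]) (use cclopen in auto)
      moreover have "y\<^sub>0 \<in> W"
        using y\<^sub>0 E_pos by (simp add: W_def T_def)
      moreover have "f y \<in> V" if y: "y \<in> W" for y
      proof -
        have yT: "y \<in> T" "c n y = c n y\<^sub>0"
          using y by (auto simp: W_def T_def)
        have "real (E n) * h y < real (E n) * h y\<^sub>0 + 1" "real (E n) * h y\<^sub>0 < real (E n) * h y + 1"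
          using y E_pos[of n] by (auto simp: W_def field_simps)
        then have "real (cell (E n) (h y)) < real (cell (E n) (h y\<^sub>0)) + 2"
          "real (cell (E n) (h y\<^sub>0)) < real (cell (E n) (h y)) + 2"
          using cell_bounds[OF h0, of "E n" y] cell_bounds[OF h0, of "E n" y\<^sub>0] by linarith+
        then have "near 1 (pos n y) (pos n y\<^sub>0)"
          unfolding pos_near using yT by simp
        then have "u y \<notin> K"
          using n u yT by (auto simp: N_def)
        then show ?thesis
          using u yT by (simp add: K_def f_def)
      qed
      ultimately show "\<exists>W. openin Y W \<and> y\<^sub>0 \<in> W \<and> W \<subseteq> {y \<in> topspace Y. f y \<in> V}"
        by (intro exI[of _ W]) (auto simp: W_def)
    qed
  qed

  have "inj_on f (topspace Y)"
  proof (rule inj_onI)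
    fix y y' assume yy: "y \<in> topspace Y" "y' \<in> topspace Y" "f y = f y'"
    then have T: "y \<in> T" "y' \<in> T"
      by (auto simp: T_def)
    then have "(u y, u y') \<in> rel_of F"
      using yy u q_eq_iff by (simp add: f_def)
    then have near: "near 1 (pos n y) (pos n y')" for n
      using rel_near u T by metis
    then have "connected_component_of Y y y'"
      using csep yy unfolding pos_near by blast
    moreover have "h y = h y'"
    proof (rule ccontr)
      assume "h y \<noteq> h y'"
      \<comment> \<open>Equal or adjacent cells allow a difference of heights of at most
        \<open>2 / E n\<close>, so a fine enough grid separates \<open>h y\<close> from
        \<open>h y'\<close>.\<close>
      then obtain n where "2 / \<bar>h y - h y'\<bar> < 2 ^ n"
        using real_arch_pow[of 2 "2 / \<bar>h y - h y'\<bar>"] by auto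
      moreover have "(2::real) ^ n \<le> real (E n)"
        using E_ge[of n] by (metis of_nat_le_iff of_nat_numeral of_nat_power)
      ultimately have "2 / \<bar>h y - h y'\<bar> < real (E n)"
        by linarith
      then have *: "2 < real (E n) * \<bar>h y - h y'\<bar>"
        using \<open>h y \<noteq> h y'\<close> by (simp add: field_simps)
      have "real (cell (E n) (h y)) \<le> real (cell (E n) (h y')) + 1" "real (cell (E n) (h y')) \<le> real (cell (E n) (h y)) + 1"
        using near[of n] unfolding pos_near by linarith+
      then have "\<bar>real (E n) * h y - real (E n) * h y'\<bar> \<le> 2"
        using cell_bounds[OF h0, of "E n" y] cell_bounds[OF h0, of "E n" y'] by linarith
      then show False
        using * by (simp add: abs_mult flip: right_diff_distrib)
    qed
    ultimately show "y = y'"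
      using comp[OF T] hstrict by (metis less_irrefl)
  qed
  then have emb: "embedding_map Y Q f"
    using contf continuous_imp_closed_map[OF contf cptY Hausdorff_quotient] injective_closed_imp_embedding_map by blast

  have E_dvd: "E n dvd E m" if "n \<le> m" for n m
    using that by (induction m rule: dec_induct) (auto simp: D)
  have down_iter: "\<phi> n w = prod_encode (2 * c n y, z div (E m div E n))"
    if "n \<le> m" "w \<in> points_of F" "y \<in> T" "\<phi> m w = prod_encode (2 * c m y, z)" for n m w y z
    using that(1,4)
  proof (induction m arbitrary: z rule: dec_induct)
    case base
    then show ?case
      using E_pos[of n] by simp
  next
    case (step m)
    have "\<phi> m w = prod_encode (2 * c m y, z div D m)"
      using down step.prems that(2,3) by blast
    then have "\<phi> n w = prod_encode (2 * c n y, z div D m div (E m div E n))"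
      by (rule step.IH)
    moreover have "E (Suc m) div E n = D m * (E m div E n)"
      using E_dvd[OF step.hyps(1)] D by (simp add: div_mult_swap mult.commute)
    ultimately show ?case
      by (simp add: div_mult2_eq)
  qed
  \<comment> \<open>The pieces around \<open>y\<close> shrink to its component, so by compactness a
    closed set disjoint from the component is left behind at some stage, which can be taken beyond
    any given \<open>n\<close>.\<close>
  have eventually_away: "\<exists>m\<ge>n. \<forall>y'\<in>K. c m y' \<noteq> c m y"
    if y: "y \<in> T" and K: "closedin Y K" and away: "\<And>y'. y' \<in> K \<Longrightarrow> \<not> connected_component_of Y y y'" for y K n
  proof (rule ccontr)
    assume no: "\<not> ?thesis"
    define N where "N m = K \<inter> {y' \<in> topspace Y. c (n + m) y' = c (n + m) y}" for m
    have "closedin Y (N m)" for m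
      unfolding N_def using K cclopen by blast
    moreover have "N m \<noteq> {}" for m
      using no closedin_subset[OF K] le_add1[of n m] unfolding N_def by fastforce
    moreover have "decseq N"
    proof (rule decseq_SucI)
      fix m
      have "c (n + m) x = c (n + m) y" if "c (n + Suc m) x = c (n + Suc m) y" for x
        using cS[rule_format, of "n + m" x y] that by simp
      then show "N (Suc m) \<subseteq> N m"
        unfolding N_def by blast
    qed
    ultimately have "(\<Inter>m. N m) \<noteq> {}"
      by (rule compact_space_imp_nest[OF cptY])
    then obtain y' where y': "y' \<in> K" "y' \<in> topspace Y" "\<And>m. c (n + m) y' = c (n + m) y"
      by (auto simp: N_def)
    have "c m y = c m y'" if "m \<le> n" for m
      using that y'(3)[of 0]
    proof (induction m rule: inc_induct)
      case (step k)
      then show ?case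
        using cS by blast
    qed simp
    then have "c m y = c m y'" for m
      using y'(3)[of "m - n"] by (cases "m \<le> n") auto
    then have "connected_component_of Y y y'"
      using csep y y' by (auto simp: T_def)
    then show False
      using away y' by blast
  qed

  \<comment> \<open>At stage \<open>m\<close> the point \<open>v\<close> lies, up to one cell,
    between \<open>a\<close> and \<open>b\<close>. Coarsening to stage \<open>n\<close> keeps that
    error of one cell, and the cells of \<open>a\<close> and \<open>b\<close> may pass that of
    \<open>y\<close> by one more; this gives 2.\<close>
  have squeeze: "near 2 (\<phi> n v) (\<phi> n (u y))"
    if v: "v \<in> points_of F" and y: "y \<in> T" and "n \<le> m" and z: "\<phi> m v = prod_encode (2 * c m y, z)"
      and a: "cell (E m) (h a) \<le> z + 1" "h y - 1 / real (E n) < h a"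
      and b: "z \<le> cell (E m) (h b) + 1" "h b < h y + 1 / real (E n)" for v y n m z a b
  proof -
    define k where "k = E m div E n"
    have Em: "E m = E n * k" and k: "0 < k"
      using E_dvd[OF \<open>n \<le> m\<close>] E_pos[of m] by (auto simp: k_def)
    have \<phi>v: "\<phi> n v = prod_encode (2 * c n y, z div k)"
      using down_iter[OF \<open>n \<le> m\<close> v y z] by (simp add: k_def)
    have "cell (E n) (h a) \<le> z div k + 1"
      using div_le_div_add[OF a(1) k] cell_mult_div[OF h0 k, of "E n" a] Em by simp
    moreover have "z div k \<le> cell (E n) (h b) + 1"
      using div_le_div_add[OF b(1) k] cell_mult_div[OF h0 k, of "E n" b] Em by simp
    moreover have "real (E n) * h y - 1 < real (E n) * h a" "real (E n) * h b < real (E n) * h y + 1"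
      using a(2) b(2) E_pos[of n] by (auto simp: field_simps)
    then have "real (cell (E n) (h y)) < real (cell (E n) (h a)) + 2"
      "real (cell (E n) (h b)) < real (cell (E n) (h y)) + 2"
      using cell_bounds[OF h0, of "E n" y] cell_bounds[OF h0, of "E n" a] cell_bounds[OF h0, of "E n" b] by linarith+
    ultimately show ?thesis
      using \<phi>v u(2)[OF y] by (simp add: pos_def)
  qed
  have low: "closedin Y {y' \<in> topspace Y. h y' \<in> {..t}}" and high: "closedin Y {y' \<in> topspace Y. h y' \<in> {t..}}" for t
    by (rule closedin_continuous_map_preimage[OF conth], simp)+
  \<comment> \<open>Comparable points share a chain at every stage, and so do related ones. Thus
    \<open>v\<close> lies in the chain belonging to the piece of \<open>y\<close>, and passing from
    \<open>w\<close> to \<open>u y\<close> changes the height by at most 1.\<close>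
  have in_chain: "\<exists>z. \<phi> m v = prod_encode (2 * c m y, z) \<and> lo m (2 * c m y) \<le> z \<and> z \<le> hi m (2 * c m y) \<and>
      ((v, w) \<in> le_of F \<longrightarrow> z \<le> cell (E m) (h y) + 1) \<and> ((w, v) \<in> le_of F \<longrightarrow> cell (E m) (h y) \<le> z + 1)"
    if vw: "(v, w) \<in> le_of F \<or> (w, v) \<in> le_of F" and w: "(w, u y) \<in> rel_of F" and y: "y \<in> T" for v w y m
  proof -
    have v: "v \<in> points_of F"
      using vw le_subset by auto
    have epi_m: "epimorphism F (chain_forest (I m) (lo m) (hi m)) (\<phi> m)"
      using epi by blast
    then have "\<phi> m v \<in> points_of (chain_forest (I m) (lo m) (hi m))"
      using v by (rule epimorphism_imageD(1))
    then obtain i z where z: "\<phi> m v = prod_encode (i, z)" "lo m i \<le> z" "z \<le> hi m i"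
      by (rule points_of_chain_forestE)
    have "near 1 (\<phi> m w) (pos m y)"
      using rel_near[OF w] u(2)[OF y] by metis
    moreover have "(v, w) \<in> le_of F \<Longrightarrow> (\<phi> m v, \<phi> m w) \<in> le_of (chain_forest (I m) (lo m) (hi m))"
      "(w, v) \<in> le_of F \<Longrightarrow> (\<phi> m w, \<phi> m v) \<in> le_of (chain_forest (I m) (lo m) (hi m))"
      by (rule epimorphism_imageD(3)[OF epi_m], assumption)+
    ultimately show ?thesis
      using vw z by (auto simp: mem_le_of_chain_forest near_def pos_def)
  qed

  have "f y \<in> minimal_points Q (quotient_le F)" if ymin: "y \<in> minimal_points Y r" for y
  proof -
    have y: "y \<in> T"
      using ymin by (simp add: minimal_points_def T_def)
    have "x = f y" if "(x, f y) \<in> quotient_le F" for x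
    proof -
      obtain v w where vw: "(v, w) \<in> le_of F" "x = q v" "f y = q w"
        using \<open>(x, f y) \<in> quotient_le F\<close> by (rule quotient_le_cases)
      have pts: "v \<in> points_of F" "w \<in> points_of F"
        using vw le_subset by auto
      have wu: "(w, u y) \<in> rel_of F"
        using vw(3) q_eq_iff[of w "u y"] pts u(1)[OF y] by (simp add: f_def)
      have "near 2 (\<phi> n v) (\<phi> n (u y))" for n
      proof -
        \<comment> \<open>Everything in the component of the minimal point \<open>y\<close> is above
          \<open>y\<close>, where \<open>h\<close> is no smaller. So the points lower than
          \<open>y\<close> by at least \<open>1 / E n\<close> lie in other components and leave the
          piece of \<open>y\<close> at some stage \<open>m\<close>.\<close>
        have "\<not> connected_component_of Y y y'" if "y' \<in> {y' \<in> topspace Y. h y' \<in> {..h y - 1 / real (E n)}}" for y'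
        proof
          assume "connected_component_of Y y y'"
          then have "(y, y') \<in> r"
            using comp[of y y'] y that ymin by (auto simp: T_def minimal_points_def)
          then show False
            using hmono[of y y'] that E_inv_pos[of n] by (smt (verit) atLeast_iff atMost_iff mem_Collect_eq)
        qed
        then have "\<exists>m\<ge>n. \<forall>y'\<in>{y' \<in> topspace Y. h y' \<in> {..h y - 1 / real (E n)}}. c m y' \<noteq> c m y"
          by (rule eventually_away[OF y low])
        then obtain m where m: "n \<le> m" and away: "\<forall>y'\<in>{y' \<in> topspace Y. h y' \<in> {..h y - 1 / real (E n)}}. c m y' \<noteq> c m y"
          by blast
        have far: "h y - 1 / real (E n) < h y'" if "y' \<in> T" "c m y' = c m y" for y'
        proof (rule ccontr)
          assume "\<not> ?thesis"
          then have "y' \<in> {y' \<in> topspace Y. h y' \<in> {..h y - 1 / real (E n)}}"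
            using that(1) by (simp add: T_def)
          then show False
            using away that(2) by blast
        qed
        obtain z where z: "\<phi> m v = prod_encode (2 * c m y, z)" "lo m (2 * c m y) \<le> z" "z \<le> cell (E m) (h y) + 1"
          using in_chain[of v w y m] vw wu y by blast
        \<comment> \<open>The lower end of the chain is the cell of a point \<open>a\<close> of the
          piece, which by \<open>far\<close> is hardly lower than \<open>y\<close>. This end bounds
          \<open>v\<close> from below.\<close>
        obtain a where a: "a \<in> T" "c m a = c m y" "lo m (2 * c m y) = cell (E m) (h a)"
          using lo y by blast
        show ?thesis
          using squeeze[OF pts(1) y m z(1), of a y] a far z E_pos[of n] by simp
      qed
      then have "(v, u y) \<in> rel_of F"
        using rel_if_near pts u y by blast
      then show ?thesis
        using vw q_eq_iff pts u y by (simp add: f_def)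
    qed
    then show ?thesis
      using u y q_image by (auto simp: minimal_points_def f_def)
  qed
  moreover have "f y \<in> maximal_points Q (quotient_le F)" if ymax: "y \<in> maximal_points Y r" for y
  proof -
    have y: "y \<in> T"
      using ymax by (simp add: maximal_points_def T_def)
    have "x = f y" if "(f y, x) \<in> quotient_le F" for x
    proof -
      obtain w v where vw: "(w, v) \<in> le_of F" "f y = q w" "x = q v"
        using \<open>(f y, x) \<in> quotient_le F\<close> by (rule quotient_le_cases)
      have pts: "v \<in> points_of F" "w \<in> points_of F"
        using vw le_subset by auto
      have wu: "(w, u y) \<in> rel_of F"
        using vw(2) q_eq_iff[of w "u y"] pts u(1)[OF y] by (simp add: f_def)
      have "near 2 (\<phi> n v) (\<phi> n (u y))" for n
      proof -
        have "\<not> connected_component_of Y y y'" if "y' \<in> {y' \<in> topspace Y. h y' \<in> {h y + 1 / real (E n)..}}" for y'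
        proof
          assume "connected_component_of Y y y'"
          then have "(y', y) \<in> r"
            using comp[of y y'] y that ymax by (auto simp: T_def maximal_points_def)
          then show False
            using hmono[of y' y] that E_inv_pos[of n] by (smt (verit) atLeast_iff atMost_iff mem_Collect_eq)
        qed
        then have "\<exists>m\<ge>n. \<forall>y'\<in>{y' \<in> topspace Y. h y' \<in> {h y + 1 / real (E n)..}}. c m y' \<noteq> c m y"
          by (rule eventually_away[OF y high])
        then obtain m where m: "n \<le> m" and away: "\<forall>y'\<in>{y' \<in> topspace Y. h y' \<in> {h y + 1 / real (E n)..}}. c m y' \<noteq> c m y"
          by blast
        have far: "h y' < h y + 1 / real (E n)" if "y' \<in> T" "c m y' = c m y" for y'
        proof (rule ccontr)
          assume "\<not> ?thesis"
          then have "y' \<in> {y' \<in> topspace Y. h y' \<in> {h y + 1 / real (E n)..}}"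
            using that(1) by (simp add: T_def)
          then show False
            using away that(2) by blast
        qed
        obtain z where z: "\<phi> m v = prod_encode (2 * c m y, z)" "z \<le> hi m (2 * c m y)" "cell (E m) (h y) \<le> z + 1"
          using in_chain[of v w y m] vw wu y by blast
        \<comment> \<open>Dually, the upper end of the chain is the cell of a point \<open>b\<close>
          that is hardly higher than \<open>y\<close>.\<close>
        obtain b where b: "b \<in> T" "c m b = c m y" "hi m (2 * c m y) = cell (E m) (h b)"
          using hi y by blast
        show ?thesis
          using squeeze[OF pts(1) y m z(1), of y b] b far z E_pos[of n] by simp
      qed
      then have "(v, u y) \<in> rel_of F"
        using rel_if_near pts u y by blast
      then show ?thesis
        using vw q_eq_iff pts u y by (simp add: f_def)
    qed
    then show ?thesis
      using u y q_image by (auto simp: maximal_points_def f_def)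
  qed
  ultimately show thesis
    using that[OF emb] by blast
qed

end

theorem theorem5p13:
  fixes F :: "'a lr_structure" and Y :: "'b topology"
  assumes "projective_fraisse_limit finite_hasse_forests F"
    and "smooth_fence Y"
  shows "(\<exists>f. embedding_map Y (quotient_space F) f \<and>
            f ` endpoints Y \<subseteq> endpoints (quotient_space F)) \<and>
         (\<forall>r. strongly_compatible_order Y r \<longrightarrow>
            (\<exists>f. embedding_map Y (quotient_space F) f \<and>
               f ` endpoints Y \<subseteq> endpoints (quotient_space F) \<and>
               f ` minimal_points Y r \<subseteq> minimal_points (quotient_space F) (quotient_le F) \<and>
               f ` maximal_points Y r \<subseteq> maximal_points (quotient_space F) (quotient_le F)))"
proof -
  interpret hasse_limit F
    by unfold_locales (rule assms(1))
  have fence: "fence Y"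
    using assms(2) by (simp add: smooth_fence_def)
  have main: "\<exists>f. embedding_map Y Q f \<and> f ` endpoints Y \<subseteq> endpoints Q \<and>
      f ` minimal_points Y r \<subseteq> minimal_points Q (quotient_le F) \<and>
      f ` maximal_points Y r \<subseteq> maximal_points Q (quotient_le F)"
    if r: "strongly_compatible_order Y r" for r
  proof -
    obtain f where f: "embedding_map Y Q f"
      "f ` minimal_points Y r \<subseteq> minimal_points Q (quotient_le F)"
      "f ` maximal_points Y r \<subseteq> maximal_points Q (quotient_le F)"
      by (rule fence_embedding[OF fence r])
    then have "f ` endpoints Y \<subseteq> endpoints Q"
      using endpoints_subset_extremal_points[OF fence r] quotient_extremal_points_subset_endpoints by blast
    then show ?thesis
      using f by blast
  qed
  obtain r where "strongly_compatible_order Y r"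
    using smooth_fence_imp_strongly_compatible_order[OF assms(2)] by blast
  from main[OF this] have "\<exists>f. embedding_map Y Q f \<and> f ` endpoints Y \<subseteq> endpoints Q"
    by (elim exE conjE) (intro exI conjI)
  then show ?thesis
    using main by simp
qed

end
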